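(* For any VC class $\mathbb C$, Meta-Algorithm 1 is a universal activizer for $\mathbb C$.
   Context: Setting. $(\mathcal X,\mathcal F)$ is a standard Borel space; a classifier is a measurable $h:\mathcal X\to\{-1,+1\}$; a concept space $\mathbb C$ is a set of classifiers; a VC class is a concept space whose VC dimension $d$ satisfies $0<d<\infty$. All sets arising are implicitly assumed measurable. For a probability measure ("distribution") $\mathcal P$ on $\mathcal X$ and a target function $f\in\mathbb C$: $X_1,X_2,\ldots$ are i.i.d. $\mathcal P$, $Y_i=f(X_i)$, $\mathcal Z_m=((X_1,Y_1),\ldots,(X_m,Y_m))$, and $\mathrm{er}(h)=\mathcal P(x:h(x)\ne f(x))$. A passive learning algorithm is a (possibly randomized) map $\mathcal A$ from finite sequences $\mathcal L\in\bigcup_n(\mathcal X\times\{-1,+1\})^n$ to classifiers. An active learning algorithm (possibly randomized) gets a label budget $n\in\mathbb N$ and access to the unlabeled data; it sequentially requests labels $Y_i$ of indices of its choice (choices may depend on labels already seen), at most $n$ in total, and returns a classifier $\mathcal A(n)$. A passive (resp. active) algorithm achieves label complexity $\Lambda$ if for every $f\in\mathbb C$, distribution $\mathcal P$, $\varepsilon\in(0,1)$ and integer $n\ge\Lambda(\varepsilon,f,\mathcal P)$, $\mathbb E[\mathrm{er}(\mathcal A(\mathcal Z_n))]\le\varepsilon$ (resp. $\mathbb E[\mathrm{er}(\mathcal A(n))]\le\varepsilon$). Label complexities take values in $\{1,2,\ldots\}\cup\{\infty\}$. Asymptotic notation is as $\varepsilon\to0^+$. Activizers. $\mathrm{Polylog}(1/\varepsilon)$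 is the class of $g:(0,1)\to[0,\infty)$ with $g(\varepsilon)=O(\log^k(1/\varepsilon))$ for some $k\in[0,\infty)$. $\mathrm{Nontrivial}(\Lambda)$ is the set of pairs $(f,\mathcal P)$ with $\Lambda(\varepsilon,f,\mathcal P)<\infty$ for all $\varepsilon>0$ and $\Lambda(\varepsilon,f,\mathcal P)=\omega(g(\varepsilon))$ for all $g\in\mathrm{Polylog}(1/\varepsilon)$. An active meta-algorithm $\mathcal A_a$ takes a passive algorithm $\mathcal A_p$ and a budget $n$, and $\mathcal A_a(\mathcal A_p,\cdot)$ is an active learning algorithm for every $\mathcal A_p$. $\mathcal A_a$ activizes $\mathcal A_p$ for $\mathbb C$ if for any label complexity $\Lambda_p$ achieved by $\mathcal A_p$, $\mathcal A_a(\mathcal A_p,\cdot)$ achieves a label complexity $\Lambda_a$ such that for every $f\in\mathbb C$ and every distribution $\mathcal P$ with $(f,\mathcal P)\in\mathrm{Nontrivial}(\Lambda_p)$ there is a constant $c\in[1,\infty)$ with $\Lambda_a(c\varepsilon,f,\mathcal P)=o(\Lambda_p(\varepsilon,f,\mathcal P))$. $\mathcal A_a$ is a universal activizer for $\mathbb C$ if it activizes every passive learning algorithm for $\mathbb C$. Shattering. $\mathcal H$ shatters $S=(x_1,\ldots,x_k)\in\mathcal X^k$ if for all $(y_1,\ldots,y_k)\in\{-1,+1\}^k$ some $h\in\mathcal H$ has $h(x_i)=y_i$ for all $i$. $\mathcal X^0=\{\varnothing\}$, and $\mathcal H$ shatters $\varnothing$ iff $\mathcal H\neq\emptyset$. $S\cup\{x\}$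 denotes the tuple $S$ extended by $x$. $\mathcal H[(x,y)]=\{h\in\mathcal H:h(x)=y\}$. $\mathrm{DIS}(\mathcal H)=\{x:\exists h_1,h_2\in\mathcal H,h_1(x)\neq h_2(x)\}$. For a finite labeled sequence $Q$, $\mathrm{er}_Q(h)$ is the fraction of $(x,y)\in Q$ with $h(x)\neq y$, and $\mathrm{er}_\emptyset(h)=0$. Estimators. The algorithm also has access to two further unlabeled i.i.d.-$\mathcal P$ sequences $W_1=(w_1,w_2,\ldots)$ and $W_2=(w_1',w_2',\ldots)$, independent of each other and of $X_1,X_2,\ldots$ (e.g. obtained by splitting the unlabeled data stream in three). For $k\ge2$ let $S_i^{(k)}=(w'_{1+(i-1)(k-1)},\ldots,w'_{i(k-1)})\in\mathcal X^{k-1}$. For $\mathcal H\subseteq\mathbb C$, $x\in\mathcal X$, $y\in\{-1,+1\}$, $m\in\mathbb N$: for $k=1$, $\hat\Gamma_m^{(1)}(x,y,\mathcal H)=\mathbb 1[\forall h\in\mathcal H,\ h(x)=y]$ and $\hat\Delta_m^{(1)}(x,\mathcal H)=\mathbb 1[x\in\mathrm{DIS}(\mathcal H)]$; for $k\ge2$, $M_m^{(k)}(\mathcal H)=\max\{1,\#\{i\le m^3:\mathcal H\text{ shatters }S_i^{(k)}\}\}$, $\hat\Gamma_m^{(k)}(x,y,\mathcal H)=\frac{1}{M_m^{(k)}(\mathcal H)}\#\{i\le m^3:\mathcal H\text{ shatters }S_i^{(k)},\ \mathcal H[(x,-y)]\text{ does not shatter }S_i^{(k)}\}$, $\hat\Delta_m^{(k)}(x,\mathcal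 H)=\frac{1}{M_m^{(k)}(\mathcal H)}\#\{i\le m^3:\mathcal H\text{ shatters }S_i^{(k)}\cup\{x\}\}$; and for all $k\geq 1$, $\hat\Delta_m^{(k)}(\mathcal H)=\frac2m+\frac1{m^3}\#\{i\le m^3:\hat\Delta_m^{(k)}(w_i,\mathcal H)\ge 1/8\}$. Meta-Algorithm 1 (input: passive algorithm $\mathcal A_p$, budget $n$). 0. Let $m_n=\lfloor n/3\rfloor$; request $Y_1,\ldots,Y_{m_n}$; $t\gets m_n$. 1. $V=\{h\in\mathbb C:h(X_i)=Y_i\ \forall i\le m_n\}$. 2. For $k=1,\ldots,d+1$: 3. $\hat\Delta^{(k)}\gets\hat\Delta^{(k)}_{m_n}(V)$; 4. $\mathcal L_k\gets()$; 5. for $m=m_n+1,\ldots,m_n+\lfloor n/(6\cdot2^k\hat\Delta^{(k)})\rfloor$: 6. if $\hat\Delta_m^{(k)}(X_m,V)\ge1/2$ and $t<\lfloor2n/3\rfloor$, 7. request $Y_m$, let $\hat y\gets Y_m$, $t\gets t+1$; 8. else $\hat y\gets\arg\max_{y\in\{-1,+1\}}\hat\Gamma_m^{(k)}(X_m,y,V)$; 9. append $(X_m,\hat y)$ to $\mathcal L_k$. 10. Return $\mathrm{ActiveSelect}(\{\mathcal A_p(\mathcal L_1),\ldots,\mathcal A_p(\mathcal L_{d+1})\},\lfloor n/3\rfloor,\{X_{m_n+\max_k|\mathcal L_k|+1},\ldots\})$. ActiveSelect (input: classifiers $h_1,\ldots,h_N$, budget $m$, unlabeled sequence $\mathcal U$):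 for each $1\le j<k\le N$, let $R_{jk}$ be the first $\lfloor\frac{m}{j(N-j)\ln(eN)}\rfloor$ points of $\mathcal U$ in $\{x:h_j(x)\ne h_k(x)\}$ (if they exist), request their labels, let $Q_{jk}$ be the resulting labeled set, and let $m_{kj}=\mathrm{er}_{Q_{jk}}(h_k)$. Return $h_{\hat k}$ with $\hat k=\max\{k\in\{1,\ldots,N\}:\max_{j<k}m_{kj}\le7/12\}$ (the condition is vacuous for $k=1$). *)

theory Defs
  imports "HOL-Probability.Probability"
begin

section \<open>Classifiers, shattering and VC classes\<close>

text \<open>
  Labels are Booleans: \<^const>\<open>True\<close> stands for \<open>+1\<close>, \<^const>\<open>False\<close> for \<open>-1\<close>, so that negation is
  the change of sign.
\<close>

type_synonym 'a classifier = "'a \<Rightarrow> bool"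
type_synonym 'a sample = "('a \<times> bool) list"

definition standard_borel :: "'a measure \<Rightarrow> bool" where
  "standard_borel M \<longleftrightarrow>
     (\<exists>T. topspace T = space M \<and> completely_metrizable_space T \<and> second_countable T \<and>
          sets M = sigma_sets (space M) {U. openin T U})"

definition classifiers :: "'a measure \<Rightarrow> 'a classifier set" where
  "classifiers M = measurable M (count_space UNIV)"

definition distributions :: "'a measure \<Rightarrow> 'a measure set" where
  "distributions M = {P. prob_space P \<and> sets P = sets M}"

definition er :: "'a measure \<Rightarrow> 'a classifier \<Rightarrow> 'a classifier \<Rightarrow> real" where
  "er P f h = measure P {x \<in> space P. h x \<noteq> f x}"

definition emp_er :: "'a sample \<Rightarrow> 'a classifier \<Rightarrow> real" where
  "emp_er Q h = real (length (filter (\<lambda>(x, y). h x \<noteq> y) Q)) / real (length Q)"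

definition shatters :: "'a classifier set \<Rightarrow> 'a list \<Rightarrow> bool" where
  "shatters H S \<longleftrightarrow> (\<forall>ys. length ys = length S \<longrightarrow> (\<exists>h\<in>H. map h S = ys))"

definition restrict_label :: "'a classifier set \<Rightarrow> 'a \<Rightarrow> bool \<Rightarrow> 'a classifier set" where
  "restrict_label H x y = {h \<in> H. h x = y}"

definition DIS :: "'a classifier set \<Rightarrow> 'a set" where
  "DIS H = {x. \<exists>h1\<in>H. \<exists>h2\<in>H. h1 x \<noteq> h2 x}"

definition vc_dim :: "'a measure \<Rightarrow> 'a classifier set \<Rightarrow> enat" where
  "vc_dim M C = Sup {enat (length S) | S. set S \<subseteq> space M \<and> shatters C S}"

definition vc_class :: "'a measure \<Rightarrow> 'a classifier set \<Rightarrow> bool" where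
  "vc_class M C \<longleftrightarrow> C \<subseteq> classifiers M \<and> 0 < vc_dim M C \<and> vc_dim M C < \<infinity>"

text \<open>
  The standing convention that the sets which arise are measurable: for every pattern of \<open>n\<close>
  labels, the set of \<open>n\<close>-tuples of points on which some concept realizes the pattern is measurable.
  The estimators below depend on the version space only through events of the form ``the version
  space of \<open>(x\<^sub>1, y\<^sub>1), \<dots>, (x\<^sub>m, y\<^sub>m)\<close> shatters \<open>(s\<^sub>1, \<dots>, s\<^sub>k)\<close>'', which are finite intersections
  of such sets; conversely, the sets below are these events for \<open>k = 0\<close>.
\<close>

definition measurable_concepts :: "'a measure \<Rightarrow> 'a classifier set \<Rightarrow> bool" where
  "measurable_concepts M C \<longleftrightarrow>
     (\<forall>(n::nat) (y::nat \<Rightarrow> bool).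
        {x \<in> space (PiM {..<n} (\<lambda>_. M)). \<exists>h\<in>C. \<forall>i<n. h (x i) = y i}
          \<in> sets (PiM {..<n} (\<lambda>_. M)))"


section \<open>Passive learning\<close>

text \<open>
  Sequences of data points are functions on \<^typ>\<open>nat\<close> and are used from index 1 on. A randomized
  algorithm is a probability space of random seeds together with a deterministic algorithm that
  takes a seed; deterministic algorithms are the case of a one-point seed space.
\<close>

definition sequences :: "'a measure \<Rightarrow> (nat \<Rightarrow> 'a) measure" where
  "sequences P = PiM UNIV (\<lambda>_. P)"

record ('r, 'a) passive_alg =
  pseeds :: "'r measure"
  plearn :: "'r \<Rightarrow> 'a sample \<Rightarrow> 'a classifier"

definition passive_algorithm :: "'a measure \<Rightarrow> ('r, 'a) passive_alg \<Rightarrow> bool" where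
  "passive_algorithm M A \<longleftrightarrow> prob_space (pseeds A) \<and>
     (\<forall>n. (\<lambda>(r, z, x). plearn A r (map z [0..<n]) x)
            \<in> measurable (pseeds A \<Otimes>\<^sub>M PiM {..<n} (\<lambda>_. M \<Otimes>\<^sub>M count_space UNIV) \<Otimes>\<^sub>M M)
                (count_space UNIV))"

definition labeled_data :: "'a classifier \<Rightarrow> (nat \<Rightarrow> 'a) \<Rightarrow> nat \<Rightarrow> 'a sample" where
  "labeled_data f X n = map (\<lambda>i. (X i, f (X i))) [1..<n + 1]"

definition passive_risk ::
    "('r, 'a) passive_alg \<Rightarrow> nat \<Rightarrow> 'a classifier \<Rightarrow> 'a measure \<Rightarrow> real" where
  "passive_risk A n f P =
     (\<integral>(r, X). er P f (plearn A r (labeled_data f X n)) \<partial>(pseeds A \<Otimes>\<^sub>M sequences P))"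

type_synonym 'a label_complexity = "real \<Rightarrow> 'a classifier \<Rightarrow> 'a measure \<Rightarrow> enat"

definition achieves ::
    "'a measure \<Rightarrow> 'a classifier set \<Rightarrow> (nat \<Rightarrow> 'a classifier \<Rightarrow> 'a measure \<Rightarrow> real) \<Rightarrow>
     'a label_complexity \<Rightarrow> bool" where
  "achieves M C risk \<Lambda> \<longleftrightarrow>
     (\<forall>f\<in>C. \<forall>P\<in>distributions M. \<forall>\<epsilon>\<in>{0<..<1}.
        1 \<le> \<Lambda> \<epsilon> f P \<and> (\<forall>n. \<Lambda> \<epsilon> f P \<le> enat n \<longrightarrow> risk n f P \<le> \<epsilon>))"


section \<open>Active learning\<close>

text \<open>
  An interaction with the labeling oracle: \<open>Request i c\<close> asks for the label \<open>Y\<^sub>i\<close> and continues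
  with \<open>c Y\<^sub>i\<close>. Hence a request can depend only on the labels revealed before it.
\<close>

datatype 'b query = Return 'b | Request nat "bool \<Rightarrow> 'b query"

primrec run :: "(nat \<Rightarrow> bool) \<Rightarrow> 'b query \<Rightarrow> 'b" where
  "run Y (Return b) = b"
| "run Y (Request i c) = run Y (c (Y i))"

primrec num_requests :: "(nat \<Rightarrow> bool) \<Rightarrow> 'b query \<Rightarrow> nat" where
  "num_requests Y (Return b) = 0"
| "num_requests Y (Request i c) = Suc (num_requests Y (c (Y i)))"

primrec bind_query :: "'b query \<Rightarrow> ('b \<Rightarrow> 'c query) \<Rightarrow> 'c query" where
  "bind_query (Return b) g = g b"
| "bind_query (Request i c) g = Request i (\<lambda>y. bind_query (c y) g)"

adhoc_overloading Monad_Syntax.bind \<rightleftharpoons> bind_query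

primrec map_requests :: "('b \<Rightarrow> 'c query) \<Rightarrow> 'b list \<Rightarrow> 'c list query" where
  "map_requests g [] = Return []"
| "map_requests g (b # bs) = do { c \<leftarrow> g b; cs \<leftarrow> map_requests g bs; Return (c # cs) }"

definition request_labels :: "nat list \<Rightarrow> bool list query" where
  "request_labels = map_requests (\<lambda>i. Request i Return)"

text \<open>
  The unlabeled data consist of the sequence \<open>X\<close>, whose labels can be requested, and of two
  auxiliary sequences \<open>W\<^sub>1\<close> and \<open>W\<^sub>2\<close>.
\<close>

type_synonym 'a unlabeled = "(nat \<Rightarrow> 'a) \<times> (nat \<Rightarrow> 'a) \<times> (nat \<Rightarrow> 'a)"

definition unlabeled_data :: "'a measure \<Rightarrow> 'a unlabeled measure" where
  "unlabeled_data P = sequences P \<Otimes>\<^sub>M sequences P \<Otimes>\<^sub>M sequences P"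

record ('s, 'a) active_alg =
  aseeds :: "'s measure"
  alearn :: "nat \<Rightarrow> 's \<Rightarrow> 'a unlabeled \<Rightarrow> 'a classifier query"

definition active_algorithm :: "'a measure \<Rightarrow> ('s, 'a) active_alg \<Rightarrow> bool" where
  "active_algorithm M A \<longleftrightarrow> prob_space (aseeds A) \<and>
     (\<forall>n. (\<forall>s\<in>space (aseeds A). \<forall>U\<in>space (unlabeled_data M). \<forall>Y.
             num_requests Y (alearn A n s U) \<le> n) \<and>
          (\<lambda>(s, U, Y, x). run Y (alearn A n s U) x)
            \<in> measurable (aseeds A \<Otimes>\<^sub>M unlabeled_data M \<Otimes>\<^sub>M sequences (count_space UNIV) \<Otimes>\<^sub>M M)
                (count_space UNIV))"

definition active_risk ::
    "('s, 'a) active_alg \<Rightarrow> nat \<Rightarrow> 'a classifier \<Rightarrow> 'a measure \<Rightarrow> real" where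
  "active_risk A n f P =
     (\<integral>(s, U). er P f (run (\<lambda>i. f (fst U i)) (alearn A n s U)) \<partial>(aseeds A \<Otimes>\<^sub>M unlabeled_data P))"


section \<open>Activizers\<close>

definition polylog :: "(real \<Rightarrow> real) set" where
  "polylog = {g. (\<forall>\<epsilon>\<in>{0<..<1}. 0 \<le> g \<epsilon>) \<and>
                 (\<exists>k\<ge>0. g \<in> O[at_right 0](\<lambda>\<epsilon>. ln (1 / \<epsilon>) powr k))}"

definition nontrivial :: "'a label_complexity \<Rightarrow> ('a classifier \<times> 'a measure) set" where
  "nontrivial \<Lambda> = {(f, P). (\<forall>\<epsilon>>0. \<Lambda> \<epsilon> f P < \<infinity>) \<and>
     (\<forall>g\<in>polylog. (\<lambda>\<epsilon>. real (the_enat (\<Lambda> \<epsilon> f P))) \<in> \<omega>[at_right 0](g))}"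

definition activizes ::
    "'a measure \<Rightarrow> 'a classifier set \<Rightarrow> (('r, 'a) passive_alg \<Rightarrow> ('s, 'a) active_alg) \<Rightarrow>
     ('r, 'a) passive_alg \<Rightarrow> bool" where
  "activizes M C \<A> A \<longleftrightarrow>
     (\<forall>\<Lambda>p. achieves M C (passive_risk A) \<Lambda>p \<longrightarrow>
        (\<exists>\<Lambda>a. achieves M C (active_risk (\<A> A)) \<Lambda>a \<and>
           (\<forall>f\<in>C. \<forall>P\<in>distributions M. (f, P) \<in> nontrivial \<Lambda>p \<longrightarrow>
              (\<exists>c\<ge>1. (\<forall>\<^sub>F \<epsilon> in at_right 0. \<Lambda>a (c * \<epsilon>) f P < \<infinity>) \<and>
                     (\<lambda>\<epsilon>. real (the_enat (\<Lambda>a (c * \<epsilon>) f P)))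
                       \<in> o[at_right 0](\<lambda>\<epsilon>. real (the_enat (\<Lambda>p \<epsilon> f P)))))))"

definition active_meta_algorithm ::
    "'a measure \<Rightarrow> (('r, 'a) passive_alg \<Rightarrow> ('s, 'a) active_alg) \<Rightarrow> bool" where
  "active_meta_algorithm M \<A> \<longleftrightarrow> (\<forall>A. passive_algorithm M A \<longrightarrow> active_algorithm M (\<A> A))"

definition universal_activizer ::
    "'a measure \<Rightarrow> 'a classifier set \<Rightarrow> (('r, 'a) passive_alg \<Rightarrow> ('s, 'a) active_alg) \<Rightarrow> bool" where
  "universal_activizer M C \<A> \<longleftrightarrow> active_meta_algorithm M \<A> \<and>
     (\<forall>A. passive_algorithm M A \<longrightarrow> activizes M C \<A> A)"


section \<open>Estimators\<close>

text \<open>In the following, \<open>w\<close> and \<open>w'\<close> are the auxiliary sequences \<open>W\<^sub>1\<close> and \<open>W\<^sub>2\<close>.\<close>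

definition block :: "(nat \<Rightarrow> 'a) \<Rightarrow> nat \<Rightarrow> nat \<Rightarrow> 'a list" where
  "block w' k i = map w' [1 + (i - 1) * (k - 1)..<i * (k - 1) + 1]"

definition shatter_count :: "(nat \<Rightarrow> 'a) \<Rightarrow> nat \<Rightarrow> nat \<Rightarrow> 'a classifier set \<Rightarrow> nat" where
  "shatter_count w' k m H = max 1 (card {i \<in> {1..m ^ 3}. shatters H (block w' k i)})"

definition Gamma_hat ::
    "(nat \<Rightarrow> 'a) \<Rightarrow> nat \<Rightarrow> nat \<Rightarrow> 'a \<Rightarrow> bool \<Rightarrow> 'a classifier set \<Rightarrow> real" where
  "Gamma_hat w' k m x y H =
     (if k = 1 then of_bool (\<forall>h\<in>H. h x = y)
      else real (card {i \<in> {1..m ^ 3}. shatters H (block w' k i) \<and>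
                         \<not> shatters (restrict_label H x (\<not> y)) (block w' k i)})
             / real (shatter_count w' k m H))"

definition Delta_hat_point ::
    "(nat \<Rightarrow> 'a) \<Rightarrow> nat \<Rightarrow> nat \<Rightarrow> 'a \<Rightarrow> 'a classifier set \<Rightarrow> real" where
  "Delta_hat_point w' k m x H =
     (if k = 1 then of_bool (x \<in> DIS H)
      else real (card {i \<in> {1..m ^ 3}. shatters H (block w' k i @ [x])})
             / real (shatter_count w' k m H))"

definition Delta_hat ::
    "(nat \<Rightarrow> 'a) \<Rightarrow> (nat \<Rightarrow> 'a) \<Rightarrow> nat \<Rightarrow> nat \<Rightarrow> 'a classifier set \<Rightarrow> real" where
  "Delta_hat w w' k m H =
     2 / real m + real (card {i \<in> {1..m ^ 3}. Delta_hat_point w' k m (w i) H \<ge> 1 / 8}) / real (m ^ 3)"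


section \<open>ActiveSelect\<close>

text \<open>
  The indices \<open>i > u\<close> of the first \<open>l\<close> points among \<open>X\<^sub>u\<^sub>+\<^sub>1, X\<^sub>u\<^sub>+\<^sub>2, \<dots>\<close> that lie in \<open>D\<close>; these are
  fewer than \<open>l\<close> indices if there are not enough such points.
\<close>

definition first_points :: "(nat \<Rightarrow> 'a) \<Rightarrow> nat \<Rightarrow> 'a set \<Rightarrow> nat \<Rightarrow> nat list" where
  "first_points X u D l =
     sorted_list_of_set {i. u < i \<and> X i \<in> D \<and> card {i'. u < i' \<and> i' < i \<and> X i' \<in> D} < l}"

text \<open>The classifiers are \<open>h 1, \<dots>, h N\<close>, and the unlabeled sequence is \<open>X\<^sub>u\<^sub>+\<^sub>1, X\<^sub>u\<^sub>+\<^sub>2, \<dots>\<close>.\<close>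

definition compare_error ::
    "(nat \<Rightarrow> 'a classifier) \<Rightarrow> nat \<Rightarrow> nat \<Rightarrow> (nat \<Rightarrow> 'a) \<Rightarrow> nat \<Rightarrow> nat \<Rightarrow> nat \<Rightarrow> real query" where
  "compare_error h N m X u k j =
     (let R = first_points X u {x. h j x \<noteq> h k x}
                (nat \<lfloor>real m / (real j * real (N - j) * ln (exp 1 * real N))\<rfloor>)
      in do { ys \<leftarrow> request_labels R;
              Return (emp_er (zip (map X R) ys) (h k)) })"

definition active_select ::
    "(nat \<Rightarrow> 'a classifier) \<Rightarrow> nat \<Rightarrow> nat \<Rightarrow> (nat \<Rightarrow> 'a) \<Rightarrow> nat \<Rightarrow> 'a classifier query" where
  "active_select h N m X u = do {
     es \<leftarrow> map_requests (\<lambda>k. map_requests (compare_error h N m X u k) [1..<k]) [1..<N + 1];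
     Return (h (Max {k \<in> {1..N}. \<forall>e\<in>set (es ! (k - 1)). e \<le> 7 / 12})) }"


section \<open>The meta-algorithm\<close>

text \<open>
  The inner loop, over a list of indices. The state is the number \<open>t\<close> of labels requested so far
  and the labeled sequence \<open>L\<close>. The label of \<open>X\<^sub>m\<close> is requested if \<open>want m\<close> holds and \<open>t\<close> is below
  \<open>cap\<close>, and is \<open>infer m\<close> otherwise.
\<close>

primrec label_points ::
    "(nat \<Rightarrow> bool) \<Rightarrow> (nat \<Rightarrow> bool) \<Rightarrow> nat \<Rightarrow> (nat \<Rightarrow> 'a) \<Rightarrow> nat list \<Rightarrow> nat \<Rightarrow> 'a sample \<Rightarrow>
     (nat \<times> 'a sample) query" where
  "label_points want infer cap X [] t L = Return (t, L)"
| "label_points want infer cap X (m # ms) t L =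
     (if want m \<and> t < cap
      then Request m (\<lambda>y. label_points want infer cap X ms (t + 1) (L @ [(X m, y)]))
      else label_points want infer cap X ms t (L @ [(X m, infer m)]))"

text \<open>
  The outer loop, over a list of values of \<open>k\<close>; it returns the list of the \<open>\<L>\<^sub>k\<close>. Ties in the
  maximization are broken by \<^const>\<open>arg_max\<close> in an unspecified way.
\<close>

primrec label_samples ::
    "nat \<Rightarrow> 'a unlabeled \<Rightarrow> 'a classifier set \<Rightarrow> nat list \<Rightarrow> nat \<Rightarrow> 'a sample list query" where
  "label_samples n U V [] t = Return []"
| "label_samples n U V (k # ks) t =
     (case U of (X, w, w') \<Rightarrow>
        let mn = n div 3;
            len = nat \<lfloor>real n / (6 * 2 ^ k * Delta_hat w w' k mn V)\<rfloor>
        in do {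
          (t', L) \<leftarrow> label_points
            (\<lambda>m. Delta_hat_point w' k m (X m) V \<ge> 1 / 2)
            (\<lambda>m. arg_max (\<lambda>y. Gamma_hat w' k m (X m) y V) (\<lambda>_. True))
            (2 * n div 3) X [mn + 1..<mn + len + 1] t [];
          Ls \<leftarrow> label_samples n U V ks t';
          Return (L # Ls) })"

text \<open>The runs of the passive algorithm on the \<open>d + 1\<close> samples use independent random seeds.\<close>

definition meta_algorithm1 ::
    "'a measure \<Rightarrow> 'a classifier set \<Rightarrow> ('r, 'a) passive_alg \<Rightarrow> (nat \<Rightarrow> 'r, 'a) active_alg" where
  "meta_algorithm1 M C A =
     (let N = the_enat (vc_dim M C) + 1 in
      \<lparr> aseeds = PiM {1..N} (\<lambda>_. pseeds A),
        alearn = (\<lambda>n s U.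
          let X = fst U; mn = n div 3 in do {
            ys \<leftarrow> request_labels [1..<mn + 1];
            let V = {h \<in> C. \<forall>i\<in>{1..mn}. h (X i) = ys ! (i - 1)};
            Ls \<leftarrow> label_samples n U V [1..<N + 1] mn;
            active_select (\<lambda>k. plearn A (s k) (Ls ! (k - 1))) N (n div 3) X
              (mn + Max (set (map length Ls)))
          }) \<rparr>)"

end

theory Submission
  imports Defs "HOL-Real_Asymp.Real_Asymp"
begin

text \<open>
  Let \<open>p\<^sub>k\<close> be the essential infimum, over finite samples, of the probability that the version space
  of the sample shatters \<open>k\<close> random points. By monotonicity of version spaces this probability is
  almost surely at least \<open>p\<^sub>k\<close>, and since the version space of a long sample is contained in those of
  its independent blocks, it exceeds any \<open>r > p\<^sub>k\<close> only with exponentially small probability. Let \<open>K\<close>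
  be the least \<open>k\<close> with \<open>p\<^sub>k = 0\<close>; it is at most \<open>d + 1\<close>. In round \<open>K\<close> almost all \<open>(K - 1)\<close>-tuples
  shattered by the version space \<open>V\<close> are still shattered after the correct label of a further point is
  added to the sample. Hence a point whose label is not requested, for which less than half of the
  shattered tuples stay shattered when the point is appended, gets its correct label. As \<open>p\<^sub>K = 0\<close>,
  the points whose labels are requested become rare, so the correctly labelled sample of round \<open>K\<close> is
  longer than any multiple of \<open>n\<close>. The passive algorithm is applied to this sample, and the pairwise
  comparisons lose at most a factor 2. All failure probabilities are exponentially small in \<open>n\<close>, which
  is negligible because the passive label complexity is superlogarithmic. No uniform convergence is
  needed.
\<close>

text \<open>Round \<open>K\<close> works because one probability is squeezed from two sides. Adding
  a correctly labelled point to the sample leaves a set that contains the version space of a longer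
  sample, so it shatters random \<open>(K - 1)\<close>-tuples with probability at least
  \<open>limit_prob (K - 1)\<close>; after \<open>n div 3\<close> labels \<open>V\<close> typically
  has at most \<open>11 / 10\<close> of this probability. So the true label destroys few shattered
  tuples. Requests are rare by Markov's inequality: the mean probability that a random point extends
  a \<open>(K - 1)\<close>-tuple to a shattered one is that of shattering \<open>K\<close> points,
  which becomes arbitrarily small while the probability for \<open>K - 1\<close> points does not.
  The algorithm does not know \<open>K\<close>, hence all rounds up to \<open>d + 1\<close> and the
  selection.

  The obstacle is that the version space, the round lengths, the hypotheses and the start of the
  comparisons are all random. Each estimate is made conditionally on what determines these: the
  estimators use sequences independent of \<open>X\<close>, the length of a round is fixed before
  its points are seen, and the comparisons start at a stopping time. Given the past, every count
  runs over i.i.d. points or blocks.\<close>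

definition shift :: "nat \<Rightarrow> (nat \<Rightarrow> 'a) \<Rightarrow> nat \<Rightarrow> 'a" where
  "shift a w = (\<lambda>j. w (a + j))"

lemma shift_0 [simp]: "shift 0 w = w"
  by (simp add: shift_def)

lemma map_shift: "map (shift a w) [0..<b] = map w [a..<a + b]"
  by (rule nth_equalityI) (auto simp: shift_def)

lemma shift_comb_seq: "shift (i + b) (comb_seq b v w) = shift i w"
  by (auto simp: shift_def comb_seq_def fun_eq_iff)

section \<open>Infinite i.i.d. sequences: splitting, stopping and concentration over blocks\<close>

locale distribution = prob_space P for P :: "'a measure"
begin

abbreviation Q :: "(nat \<Rightarrow> 'a) measure" where "Q \<equiv> sequences P"

sublocale S: sequence_space P
  by unfold_locales

sublocale Q: prob_space Q
  unfolding sequences_def by (rule S.P.prob_space_axioms)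

lemma space_Q: "w \<in> space Q \<longleftrightarrow> (\<forall>i. w i \<in> space P)"
  by (auto simp: sequences_def space_PiM)

lemma component_measurable [measurable]: "(\<lambda>w. w i) \<in> measurable Q P"
  unfolding sequences_def by measurable

lemma measurable_into_Q:
  assumes "\<And>i. (\<lambda>x. F x i) \<in> measurable N P" shows "F \<in> measurable N Q"
  unfolding sequences_def
  by (rule measurable_PiM_single') (use assms in \<open>auto simp: space_PiM dest: measurable_space\<close>)

lemma shift_measurable [measurable]: "shift a \<in> measurable Q Q"
  unfolding shift_def[abs_def] by (rule measurable_into_Q) simp

lemma comb_seq_measurable [measurable]:
  "(\<lambda>(v, w). comb_seq i v w) \<in> measurable (Q \<Otimes>\<^sub>M Q) Q"
  unfolding sequences_def by (rule measurable_comb_seq)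

lemma comb_seq_measurable2 [measurable]: "v \<in> space Q \<Longrightarrow> comb_seq i v \<in> measurable Q Q"
proof -
  assume "v \<in> space Q"
  then have "(\<lambda>w. (\<lambda>(v, w). comb_seq i v w) (v, w)) \<in> measurable Q Q"
    by (rule measurable_compose[OF measurable_Pair1' comb_seq_measurable])
  then show ?thesis by simp
qed

lemma comb_seq_space: "v \<in> space Q \<Longrightarrow> w \<in> space Q \<Longrightarrow> comb_seq i v w \<in> space Q"
  by (auto simp: space_Q comb_seq_def)

text \<open>Independence of the first \<open>i\<close> coordinates from the rest, as an integral
  identity. Splitting off one point, shifting, block products and stopping times below all come down
  to it.\<close>

lemma nn_integral_comb_seq:
  assumes [measurable]: "F \<in> borel_measurable Q"
  shows "(\<integral>\<^sup>+ w. F w \<partial>Q) = (\<integral>\<^sup>+ v. \<integral>\<^sup>+ w. F (comb_seq i v w) \<partial>Q \<partial>Q)"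
proof -
  have "(\<integral>\<^sup>+ w. F w \<partial>Q) = (\<integral>\<^sup>+ w. F w \<partial>distr (Q \<Otimes>\<^sub>M Q) Q (\<lambda>(v, w). comb_seq i v w))"
    using S.PiM_comb_seq[of i] by (simp add: sequences_def)
  also have "\<dots> = (\<integral>\<^sup>+ z. F ((\<lambda>(v, w). comb_seq i v w) z) \<partial>(Q \<Otimes>\<^sub>M Q))"
    by (rule nn_integral_distr) auto
  also have "\<dots> = (\<integral>\<^sup>+ v. \<integral>\<^sup>+ w. F (comb_seq i v w) \<partial>Q \<partial>Q)"
    by (subst Q.nn_integral_fst[symmetric]) auto
  finally show ?thesis .
qed

lemma nn_integral_component:
  assumes [measurable]: "F \<in> borel_measurable P"
  shows "(\<integral>\<^sup>+ w. F (w i) \<partial>Q) = (\<integral>\<^sup>+ x. F x \<partial>P)"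
proof -
  have "(\<integral>\<^sup>+ x. F x \<partial>P) = (\<integral>\<^sup>+ x. F x \<partial>distr Q P (\<lambda>w. w i))"
    unfolding sequences_def using S.PiM_component[of i] by simp
  also have "\<dots> = (\<integral>\<^sup>+ w. F (w i) \<partial>Q)"
    by (rule nn_integral_distr) auto
  finally show ?thesis by simp
qed

lemma nn_integral_case_nat:
  assumes [measurable]: "F \<in> borel_measurable Q"
  shows "(\<integral>\<^sup>+ w. F w \<partial>Q) = (\<integral>\<^sup>+ x. \<integral>\<^sup>+ w. F (case_nat x w) \<partial>Q \<partial>P)"
proof -
  have m: "(\<lambda>(x, w). case_nat x w) \<in> measurable (P \<Otimes>\<^sub>M Q) Q"
    unfolding sequences_def by measurable
  then have [measurable]: "(\<lambda>(x, w). F (case_nat x w)) \<in> borel_measurable (P \<Otimes>\<^sub>M Q)"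
    by (auto simp: split_beta' intro!: measurable_compose[OF _ assms])
  have [measurable]: "(\<lambda>x. \<integral>\<^sup>+ w. F (case_nat x w) \<partial>Q) \<in> borel_measurable P"
    by measurable
  have "(\<integral>\<^sup>+ w. F w \<partial>Q) = (\<integral>\<^sup>+ v. \<integral>\<^sup>+ w. F (case_nat (v 0) w) \<partial>Q \<partial>Q)"
    using nn_integral_comb_seq[OF assms, of 1] by simp
  also have "\<dots> = (\<integral>\<^sup>+ x. \<integral>\<^sup>+ w. F (case_nat x w) \<partial>Q \<partial>P)"
    by (rule nn_integral_component) measurable
  finally show ?thesis .
qed

lemma nn_integral_shift:
  assumes [measurable]: "F \<in> borel_measurable Q"
  shows "(\<integral>\<^sup>+ w. F (shift b w) \<partial>Q) = (\<integral>\<^sup>+ w. F w \<partial>Q)"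
proof -
  have "(\<integral>\<^sup>+ w. F (shift b w) \<partial>Q) = (\<integral>\<^sup>+ v. \<integral>\<^sup>+ w. F (shift b (comb_seq b v w)) \<partial>Q \<partial>Q)"
    by (rule nn_integral_comb_seq) measurable
  also have "\<dots> = (\<integral>\<^sup>+ v. \<integral>\<^sup>+ w. F w \<partial>Q \<partial>Q)"
  proof (intro nn_integral_cong)
    fix v w :: "nat \<Rightarrow> 'a"
    show "F (shift b (comb_seq b v w)) = F w"
      using shift_comb_seq[of 0 b v w] by simp
  qed
  finally show ?thesis by (simp add: Q.emeasure_space_1)
qed

lemma measure_eq_nn_integral:
  assumes [measurable]: "Measurable.pred Q \<phi>"
  shows "ennreal (\<P>(w in Q. \<phi> w)) = (\<integral>\<^sup>+ w. (if \<phi> w then 1 else 0) \<partial>Q)"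
proof -
  have "(\<integral>\<^sup>+ w. (if \<phi> w then 1 else 0) \<partial>Q) = (\<integral>\<^sup>+ w. indicator {w \<in> space Q. \<phi> w} w \<partial>Q)"
    by (intro nn_integral_cong) (auto simp: indicator_def)
  then show ?thesis
    by (simp add: Q.emeasure_eq_measure)
qed

lemma measure_shift:
  assumes [measurable]: "Measurable.pred Q \<phi>"
  shows "\<P>(w in Q. \<phi> (shift b w)) = \<P>(w in Q. \<phi> w)"
proof -
  have "ennreal (\<P>(w in Q. \<phi> (shift b w))) = ennreal (\<P>(w in Q. \<phi> w))"
    using nn_integral_shift[of "\<lambda>w. if \<phi> w then 1 else 0" b]
    by (simp add: measure_eq_nn_integral)
  then show ?thesis by simp
qed

text \<open>Markov's inequality in the form used for exponential moments: \<open>G\<close> dominates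
  the indicator of the event.\<close>

lemma measure_le_nn_integral:
  assumes [measurable]: "Measurable.pred Q \<phi>" "G \<in> borel_measurable Q"
    and "\<And>w. w \<in> space Q \<Longrightarrow> \<phi> w \<Longrightarrow> 1 \<le> G w"
    and "(\<integral>\<^sup>+ w. G w \<partial>Q) \<le> ennreal c" "0 \<le> c"
  shows "\<P>(w in Q. \<phi> w) \<le> c"
proof -
  have "ennreal (\<P>(w in Q. \<phi> w)) \<le> (\<integral>\<^sup>+ w. G w \<partial>Q)"
    unfolding measure_eq_nn_integral[OF assms(1)]
    by (intro nn_integral_mono) (auto simp: indicator_def assms)
  also have "\<dots> \<le> ennreal c" by fact
  finally show ?thesis using assms by simp
qed

text \<open>Induction on \<open>N\<close> splits off the first block, which is independent of the
  rest. The case \<open>b = 0\<close>, with \<open>g\<close> constant, is included; it occurs for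
  \<open>k = 1\<close>, where the tuples are empty.\<close>

lemma nn_integral_prod_blocks:
  fixes g :: "(nat \<Rightarrow> 'a) \<Rightarrow> ennreal"
  assumes g [measurable]: "g \<in> borel_measurable Q"
    and dep: "\<And>v w. (\<And>j. j < b \<Longrightarrow> v j = w j) \<Longrightarrow> g v = g w"
  shows "(\<integral>\<^sup>+ w. (\<Prod>i<N. g (shift (i * b) w)) \<partial>Q) = (\<integral>\<^sup>+ w. g w \<partial>Q) ^ N"
proof (induction N)
  case 0
  show ?case by (simp add: Q.emeasure_space_1)
next
  case (Suc N)
  have "(\<integral>\<^sup>+ w. (\<Prod>i<Suc N. g (shift (i * b) w)) \<partial>Q) =
        (\<integral>\<^sup>+ v. \<integral>\<^sup>+ w. (\<Prod>i<Suc N. g (shift (i * b) (comb_seq b v w))) \<partial>Q \<partial>Q)"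
    by (rule nn_integral_comb_seq) measurable
  also have "\<dots> = (\<integral>\<^sup>+ v. \<integral>\<^sup>+ w. g v * (\<Prod>i<N. g (shift (i * b) w)) \<partial>Q \<partial>Q)"
  proof (intro nn_integral_cong)
    fix v w :: "nat \<Rightarrow> 'a"
    have "g (comb_seq b v w) = g v"
      by (rule dep) (simp add: comb_seq_def)
    moreover have "shift (b + i * b) (comb_seq b v w) = shift (i * b) w" for i
      using shift_comb_seq[of "i * b" b v w] by (simp add: add.commute)
    ultimately show "(\<Prod>i<Suc N. g (shift (i * b) (comb_seq b v w)))
        = g v * (\<Prod>i<N. g (shift (i * b) w))"
      by (simp add: prod.lessThan_Suc_shift del: prod.lessThan_Suc)
  qed
  also have "\<dots> = (\<integral>\<^sup>+ v. g v * (\<integral>\<^sup>+ w. (\<Prod>i<N. g (shift (i * b) w)) \<partial>Q) \<partial>Q)"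
    by (intro nn_integral_cong nn_integral_cmult) measurable
  also have "\<dots> = (\<integral>\<^sup>+ v. g v \<partial>Q) * (\<integral>\<^sup>+ w. (\<Prod>i<N. g (shift (i * b) w)) \<partial>Q)"
    by (rule nn_integral_multc) measurable
  finally show ?case by (simp add: Suc)
qed

text \<open>\<open>\<tau>\<close> is a stopping time, expressed pointwise through
  \<open>stop\<close> instead of a filtration. The integral is split by the value \<open>i\<close>
  of \<open>\<tau>\<close>: the event \<open>\<tau> = i\<close> depends on the first
  \<open>i\<close> coordinates only, and given these the rest is a fresh sequence, to which
  \<open>bound\<close> applies.\<close>

lemma strong_markov:
  fixes F :: "(nat \<Rightarrow> 'a) \<Rightarrow> ennreal"
  assumes F [measurable]: "F \<in> borel_measurable Q"
    and \<tau> [measurable]: "\<tau> \<in> measurable Q (count_space UNIV)"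
    and stop: "\<And>v w. v \<in> space Q \<Longrightarrow> w \<in> space Q \<Longrightarrow> (\<And>i. i < \<tau> v \<Longrightarrow> w i = v i) \<Longrightarrow> \<tau> w = \<tau> v"
    and bound: "\<And>v. v \<in> space Q \<Longrightarrow> (\<integral>\<^sup>+ w. F (comb_seq (\<tau> v) v w) \<partial>Q) \<le> \<delta>"
  shows "(\<integral>\<^sup>+ w. F w \<partial>Q) \<le> \<delta>"
proof -
  have one: "(\<Sum>i. indicator {i} (\<tau> w)) = (1::ennreal)" for w
  proof -
    have "(\<Sum>i. indicator {i} (\<tau> w)) = (\<Sum>i\<in>{\<tau> w}. indicator {i} (\<tau> w) :: ennreal)"
      by (rule suminf_finite) auto
    then show ?thesis by simp
  qed
  have [measurable]: "(\<lambda>w. indicator {i} (\<tau> w) :: ennreal) \<in> borel_measurable Q" for i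
    by (rule measurable_compose[OF \<tau>]) simp
  \<comment> \<open>Both sequences agree below \<open>i\<close>, so \<open>stop\<close> can be
    applied starting from whichever of them has the value \<open>i\<close>.\<close>
  have eq: "indicator {i} (\<tau> (comb_seq i v w)) = (indicator {i} (\<tau> v) :: ennreal)"
    if "v \<in> space Q" "w \<in> space Q" for i v w
  proof -
    have "\<tau> (comb_seq i v w) = i" if "\<tau> v = i"
      using stop[of v "comb_seq i v w"] that \<open>v \<in> space Q\<close> \<open>w \<in> space Q\<close>
      by (simp add: comb_seq_space comb_seq_less)
    moreover have "\<tau> v = i" if "\<tau> (comb_seq i v w) = i"
      using stop[of "comb_seq i v w" v] that \<open>v \<in> space Q\<close> \<open>w \<in> space Q\<close>
      by (simp add: comb_seq_space comb_seq_less)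
    ultimately have "\<tau> (comb_seq i v w) = i \<longleftrightarrow> \<tau> v = i" by blast
    then show ?thesis by (auto simp: indicator_def)
  qed
  have "(\<integral>\<^sup>+ w. F w \<partial>Q) = (\<integral>\<^sup>+ w. (\<Sum>i. F w * indicator {i} (\<tau> w)) \<partial>Q)"
    by (simp add: one)
  also have "\<dots> = (\<Sum>i. \<integral>\<^sup>+ w. F w * indicator {i} (\<tau> w) \<partial>Q)"
    by (rule nn_integral_suminf) measurable
  also have "\<dots> \<le> (\<Sum>i. \<integral>\<^sup>+ v. \<delta> * indicator {i} (\<tau> v) \<partial>Q)"
  proof (rule suminf_le)
    fix i
    have "(\<integral>\<^sup>+ w. F w * indicator {i} (\<tau> w) \<partial>Q) =
        (\<integral>\<^sup>+ v. \<integral>\<^sup>+ w. F (comb_seq i v w) * indicator {i} (\<tau> (comb_seq i v w)) \<partial>Q \<partial>Q)"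
      by (rule nn_integral_comb_seq) measurable
    also have "\<dots> = (\<integral>\<^sup>+ v. \<integral>\<^sup>+ w. F (comb_seq i v w) * indicator {i} (\<tau> v) \<partial>Q \<partial>Q)"
      by (intro nn_integral_cong) (simp add: eq)
    also have "\<dots> \<le> (\<integral>\<^sup>+ v. \<delta> * indicator {i} (\<tau> v) \<partial>Q)"
    proof (rule nn_integral_mono)
      fix v assume v: "v \<in> space Q"
      show "(\<integral>\<^sup>+ w. F (comb_seq i v w) * indicator {i} (\<tau> v) \<partial>Q) \<le> \<delta> * indicator {i} (\<tau> v)"
        using bound[OF v] by (cases "\<tau> v = i") auto
    qed
    finally show "(\<integral>\<^sup>+ w. F w * indicator {i} (\<tau> w) \<partial>Q) \<le> (\<integral>\<^sup>+ v. \<delta> * indicator {i} (\<tau> v) \<partial>Q)" .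
  qed (rule summableI)+
  also have "\<dots> = (\<integral>\<^sup>+ v. (\<Sum>i. \<delta> * indicator {i} (\<tau> v)) \<partial>Q)"
    by (rule nn_integral_suminf[symmetric]) measurable
  also have "\<dots> = \<delta>"
    by (simp add: one Q.emeasure_space_1)
  finally show ?thesis .
qed

lemma measure_strong_markov:
  assumes \<phi> [measurable]: "Measurable.pred Q \<phi>"
    and \<tau>: "\<tau> \<in> measurable Q (count_space UNIV)"
    and stop: "\<And>v w. v \<in> space Q \<Longrightarrow> w \<in> space Q \<Longrightarrow> (\<And>i. i < \<tau> v \<Longrightarrow> w i = v i) \<Longrightarrow> \<tau> w = \<tau> v"
    and bound: "\<And>v. v \<in> space Q \<Longrightarrow> \<P>(w in Q. \<phi> (comb_seq (\<tau> v) v w)) \<le> \<delta>"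
    and "0 \<le> \<delta>"
  shows "\<P>(w in Q. \<phi> w) \<le> \<delta>"
proof -
  have "(\<integral>\<^sup>+ w. (if \<phi> w then 1 else 0) \<partial>Q) \<le> ennreal \<delta>"
  proof (rule strong_markov[OF _ \<tau> stop])
    fix v assume v [measurable]: "v \<in> space Q"
    have "(\<integral>\<^sup>+ w. (if \<phi> (comb_seq (\<tau> v) v w) then 1 else 0) \<partial>Q)
        = ennreal (\<P>(w in Q. \<phi> (comb_seq (\<tau> v) v w)))"
      by (simp add: measure_eq_nn_integral)
    also have "\<dots> \<le> ennreal \<delta>" by (intro ennreal_leI bound v)
    finally show "(\<integral>\<^sup>+ w. (if \<phi> (comb_seq (\<tau> v) v w) then 1 else 0) \<partial>Q) \<le> ennreal \<delta>" .
  qed measurable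
  then have "ennreal (\<P>(w in Q. \<phi> w)) \<le> ennreal \<delta>"
    by (simp add: measure_eq_nn_integral)
  then show ?thesis using \<open>0 \<le> \<delta>\<close> by simp
qed

lemma measure_all_blocks:
  assumes T [measurable]: "Measurable.pred Q T"
    and dep: "\<And>v w. (\<And>j. j < b \<Longrightarrow> v j = w j) \<Longrightarrow> T v = T w"
  shows "\<P>(w in Q. \<forall>i<N. T (shift (i * b) w)) = \<P>(w in Q. T w) ^ N"
proof -
  have "ennreal (\<P>(w in Q. \<forall>i<N. T (shift (i * b) w)))
      = (\<integral>\<^sup>+ w. (\<Prod>i<N. if T (shift (i * b) w) then 1 else 0) \<partial>Q)"
    by (subst measure_eq_nn_integral) (auto intro!: nn_integral_cong)
  also have "\<dots> = (\<integral>\<^sup>+ w. (if T w then 1 else 0) \<partial>Q) ^ N"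
  proof (rule nn_integral_prod_blocks)
    show "(if T v then 1 else 0) = (if T w then 1 else (0::ennreal))" if "\<And>j. j < b \<Longrightarrow> v j = w j" for v w
      using dep[OF that] by simp
  qed measurable
  also have "\<dots> = ennreal (\<P>(w in Q. T w) ^ N)"
    by (simp add: measure_eq_nn_integral[symmetric] ennreal_power)
  finally show ?thesis by simp
qed

lemma card_blocks_sum:
  "real (card {i \<in> {..<N::nat}. T (shift (i * b) w)}) = (\<Sum>i<N. indicator {w. T w} (shift (i * b) w))"
  by (simp add: indicator_def sum.If_cases Int_def)

lemma card_blocks_measurable [measurable]:
  assumes T [measurable]: "Measurable.pred Q T"
  shows "(\<lambda>w. real (card {i \<in> {..<N::nat}. T (shift (i * b) w)})) \<in> borel_measurable Q"
  unfolding card_blocks_sum by measurable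

text \<open>Exponential Markov inequality for the count: Hoeffding's lemma bounds the moment of one
  block, and independence multiplies these bounds.\<close>

lemma hoeffding_blocks_upper:
  assumes T [measurable]: "Measurable.pred Q T"
    and dep: "\<And>v w. (\<And>j. j < b \<Longrightarrow> v j = w j) \<Longrightarrow> T v = T w"
    and "0 < \<sigma>"
  shows "\<P>(w in Q. (\<P>(w in Q. T w) + \<sigma>) * N
            \<le> real (card {i \<in> {..<N::nat}. T (shift (i * b) w)})) \<le> exp (- 2 * \<sigma>\<^sup>2 * N)"
proof -
  define t where "t = \<P>(w in Q. T w)"
  \<comment> \<open>The exponent \<open>4 * \<sigma>\<close> minimizes
    \<open>l\<^sup>2 / 8 - l * \<sigma>\<close>, the logarithmic bound per block from Hoeffding's
    lemma on the unit interval; the minimum is \<open>- 2 * \<sigma>\<^sup>2\<close>.\<close>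
  define g where "g = (\<lambda>w. ennreal (exp (4 * \<sigma> * (indicator {w. T w} w - t))))"
  have [measurable]: "g \<in> borel_measurable Q" unfolding g_def by measurable
  have g_dep: "g v = g w" if "\<And>j. j < b \<Longrightarrow> v j = w j" for v w
    using dep[OF that] by (simp add: g_def indicator_def)
  interpret X: interval_bounded_random_variable Q "\<lambda>w. indicator {w. T w} w :: real" 0 1
    by unfold_locales (auto simp: indicator_def)
  have E: "Q.expectation (\<lambda>w. indicator {w. T w} w) = t"
  proof -
    have "Q.expectation (\<lambda>w. indicator {w. T w} w) = Q.expectation (\<lambda>w. indicator {w \<in> space Q. T w} w)"
      by (intro Bochner_Integration.integral_cong) (auto simp: indicator_def)
    also have "\<dots> = t" by (simp add: t_def)
    finally show ?thesis .
  qed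
  have g_le: "(\<integral>\<^sup>+ w. g w \<partial>Q) \<le> ennreal (exp (2 * \<sigma>\<^sup>2))"
    using X.Hoeffdings_lemma_nn_integral[of "4 * \<sigma>", unfolded E] \<open>0 < \<sigma>\<close>
    by (simp add: g_def power_mult_distrib)
  have "(\<integral>\<^sup>+ w. ennreal (exp (- 4 * \<sigma>\<^sup>2 * N)) * (\<Prod>i<N. g (shift (i * b) w)) \<partial>Q)
      = ennreal (exp (- 4 * \<sigma>\<^sup>2 * N)) * (\<integral>\<^sup>+ w. g w \<partial>Q) ^ N"
    by (subst nn_integral_cmult, measurable, subst nn_integral_prod_blocks[where b = b, OF _ g_dep])
       simp_all
  also have "\<dots> \<le> ennreal (exp (- 4 * \<sigma>\<^sup>2 * N)) * ennreal (exp (2 * \<sigma>\<^sup>2)) ^ N"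
    by (intro mult_left_mono power_mono g_le) auto
  also have "\<dots> = ennreal (exp (- 4 * \<sigma>\<^sup>2 * N) * exp (2 * \<sigma>\<^sup>2 * N))"
    by (simp add: ennreal_power ennreal_mult' exp_of_nat_mult[symmetric] mult_ac)
  also have "exp (- 4 * \<sigma>\<^sup>2 * N) * exp (2 * \<sigma>\<^sup>2 * N) = exp (- 2 * \<sigma>\<^sup>2 * N)"
    by (simp add: mult_exp_exp algebra_simps)
  finally have le: "(\<integral>\<^sup>+ w. ennreal (exp (- 4 * \<sigma>\<^sup>2 * N)) * (\<Prod>i<N. g (shift (i * b) w)) \<partial>Q)
      \<le> ennreal (exp (- 2 * \<sigma>\<^sup>2 * N))" .
  have eq: "ennreal (exp (- 4 * \<sigma>\<^sup>2 * N)) * (\<Prod>i<N. g (shift (i * b) w)) =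
      ennreal (exp (4 * \<sigma> * (real (card {i \<in> {..<N::nat}. T (shift (i * b) w)}) - (t + \<sigma>) * N)))" for w
  proof -
    have "(\<Prod>i<N. g (shift (i * b) w))
        = ennreal (exp (\<Sum>i<N. 4 * \<sigma> * (indicator {w. T w} (shift (i * b) w) - t)))"
      by (simp add: g_def prod_ennreal exp_sum)
    also have "(\<Sum>i<N. 4 * \<sigma> * (indicator {w. T w} (shift (i * b) w) - t))
        = 4 * \<sigma> * (real (card {i \<in> {..<N::nat}. T (shift (i * b) w)}) - t * N)"
      unfolding card_blocks_sum by (simp add: sum_distrib_left[symmetric] sum_subtractf)
    finally show ?thesis
      by (simp add: ennreal_mult'[symmetric] mult_exp_exp algebra_simps power2_eq_square)
  qed
  show ?thesis
    unfolding t_def[symmetric]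
  proof (rule measure_le_nn_integral[OF _ _ _ le])
    fix w assume "(t + \<sigma>) * N \<le> real (card {i \<in> {..<N}. T (shift (i * b) w)})"
    then have "0 \<le> 4 * \<sigma> * (real (card {i \<in> {..<N}. T (shift (i * b) w)}) - (t + \<sigma>) * N)"
      using \<open>0 < \<sigma>\<close> by simp
    then show "1 \<le> ennreal (exp (- 4 * \<sigma>\<^sup>2 * N)) * (\<Prod>i<N. g (shift (i * b) w))"
      unfolding eq by (simp only: ennreal_ge_1 one_le_exp_iff)
  next
    show "0 \<le> exp (- 2 * \<sigma>\<^sup>2 * N)" by simp
  qed measurable
qed

text \<open>The lower tail of the count is the upper tail of the count for the complement
  \<open>\<not> T\<close>.\<close>

lemma hoeffding_blocks:
  assumes T [measurable]: "Measurable.pred Q T"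
    and dep: "\<And>v w. (\<And>j. j < b \<Longrightarrow> v j = w j) \<Longrightarrow> T v = T w"
    and "0 < \<sigma>"
  shows "\<P>(w in Q. \<sigma> * N < \<bar>real (card {i \<in> {..<N::nat}. T (shift (i * b) w)})
            - \<P>(w in Q. T w) * N\<bar>) \<le> 2 * exp (- 2 * \<sigma>\<^sup>2 * N)"
proof -
  define t where "t = \<P>(w in Q. T w)"
  let ?n = "\<lambda>w. real (card {i \<in> {..<N::nat}. T (shift (i * b) w)})"
  let ?n' = "\<lambda>w. real (card {i \<in> {..<N::nat}. \<not> T (shift (i * b) w)})"
  have t': "\<P>(w in Q. \<not> T w) = 1 - t"
    using Q.prob_neg[of T] by (simp add: t_def)
  have n': "?n' w = N - ?n w" for w
  proof -
    define A where "A = {i \<in> {..<N}. T (shift (i * b) w)}"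
    have "A \<subseteq> {..<N}" and eq: "{i \<in> {..<N}. \<not> T (shift (i * b) w)} = {..<N} - A"
      by (auto simp: A_def)
    then have "card A \<le> N" "card ({..<N} - A) = N - card A"
      using card_mono[of "{..<N}" A] card_Diff_subset[of A "{..<N}"] finite_subset[of A "{..<N}"] by auto
    then show ?thesis unfolding eq A_def[symmetric] by simp
  qed
  have A: "\<P>(w in Q. (t + \<sigma>) * N \<le> ?n w) \<le> exp (- 2 * \<sigma>\<^sup>2 * N)"
    using hoeffding_blocks_upper[OF T dep \<open>0 < \<sigma>\<close>, where N = N] by (simp add: t_def)
  have [measurable]: "Measurable.pred Q (\<lambda>w. \<not> T w)" by measurable
  have dep': "(\<not> T v) = (\<not> T w)" if "\<And>j. j < b \<Longrightarrow> v j = w j" for v w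
    using dep[OF that] by simp
  have B: "\<P>(w in Q. (1 - t + \<sigma>) * N \<le> ?n' w) \<le> exp (- 2 * \<sigma>\<^sup>2 * N)"
    using hoeffding_blocks_upper[of "\<lambda>w. \<not> T w" b, OF _ dep' \<open>0 < \<sigma>\<close>, where N = N]
    unfolding t' by measurable
  have "\<P>(w in Q. \<sigma> * N < \<bar>?n w - t * N\<bar>) \<le>
      measure Q ({w \<in> space Q. (t + \<sigma>) * N \<le> ?n w} \<union> {w \<in> space Q. (1 - t + \<sigma>) * N \<le> ?n' w})"
    by (rule Q.finite_measure_mono, unfold n') (auto simp: algebra_simps)
  also have "\<dots> \<le> \<P>(w in Q. (t + \<sigma>) * N \<le> ?n w)
      + \<P>(w in Q. (1 - t + \<sigma>) * N \<le> ?n' w)"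
    by (rule measure_Un_le) (unfold n', measurable)
  finally show ?thesis using A B by (simp add: t_def)
qed

text \<open>Markov's inequality for 2 to the power of the count; \<open>1 / 3\<close> is a lower bound of \<open>2 ln 2 - 1\<close>.\<close>

lemma chernoff_blocks:
  assumes T [measurable]: "Measurable.pred Q T"
    and dep: "\<And>v w. (\<And>j. j < b \<Longrightarrow> v j = w j) \<Longrightarrow> T v = T w"
    and \<mu>: "\<P>(w in Q. T w) * N \<le> \<mu>"
  shows "\<P>(w in Q. 2 * \<mu> \<le> real (card {i \<in> {..<N::nat}. T (shift (i * b) w)}))
      \<le> exp (- \<mu> / 3)"
proof -
  define t where "t = \<P>(w in Q. T w)"
  define g where "g = (\<lambda>w. 1 + indicator {w. T w} w :: ennreal)"
  let ?n = "\<lambda>w. card {i \<in> {..<N::nat}. T (shift (i * b) w)}"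
  have "0 \<le> \<mu>" using \<mu> by (smt (verit) mult_nonneg_nonneg measure_nonneg of_nat_0_le_iff)
  have [measurable]: "g \<in> borel_measurable Q" unfolding g_def by measurable
  have g_dep: "g v = g w" if "\<And>j. j < b \<Longrightarrow> v j = w j" for v w
    using dep[OF that] by (simp add: g_def indicator_def)
  have "(\<integral>\<^sup>+ w. g w \<partial>Q) = (\<integral>\<^sup>+ w. 1 + (if T w then 1 else 0) \<partial>Q)"
    by (simp add: g_def indicator_def of_bool_def)
  also have "\<dots> = 1 + ennreal t"
    by (subst nn_integral_add) (auto simp: t_def measure_eq_nn_integral Q.emeasure_space_1)
  finally have g_eq: "(\<integral>\<^sup>+ w. g w \<partial>Q) = ennreal (1 + t)"
    by (simp add: t_def)
  have pw: "(\<Prod>i<N. g (shift (i * b) w)) = ennreal (exp (ln 2 * ?n w))" for w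
  proof -
    have "(\<Prod>i<N. g (shift (i * b) w)) = (\<Prod>i<N. if T (shift (i * b) w) then 2 else 1)"
      by (intro prod.cong) (auto simp: g_def indicator_def)
    also have "\<dots> = 2 ^ ?n w"
      by (simp add: prod.If_cases Int_def)
    also have "\<dots> = ennreal (2 ^ ?n w)" by (simp add: ennreal_power[symmetric])
    also have "2 ^ ?n w = exp (ln 2 * real (?n w))"
      by (simp add: exp_of_nat2_mult)
    finally show ?thesis .
  qed
  have "(\<integral>\<^sup>+ w. ennreal (exp (- 2 * \<mu> * ln 2)) * (\<Prod>i<N. g (shift (i * b) w)) \<partial>Q)
      = ennreal (exp (- 2 * \<mu> * ln 2)) * (\<integral>\<^sup>+ w. g w \<partial>Q) ^ N"
    by (subst nn_integral_cmult, measurable, subst nn_integral_prod_blocks[where b = b, OF _ g_dep])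
       simp_all
  also have "\<dots> = ennreal (exp (- 2 * \<mu> * ln 2) * (1 + t) ^ N)"
    unfolding g_eq by (subst ennreal_power) (auto simp: t_def ennreal_mult')
  also have "\<dots> \<le> ennreal (exp (- \<mu> / 3))"
  proof (rule ennreal_leI)
    have "(1 + t) ^ N \<le> exp t ^ N" by (intro power_mono) (auto simp: t_def)
    also have "\<dots> \<le> exp \<mu>" using \<mu> by (simp add: exp_of_nat_mult[symmetric] t_def mult.commute)
    finally have "exp (- 2 * \<mu> * ln 2) * (1 + t) ^ N \<le> exp (- 2 * \<mu> * ln 2) * exp \<mu>" by simp
    also have "\<dots> = exp (\<mu> * (1 - 2 * ln 2))" by (simp add: mult_exp_exp algebra_simps)
    also have "\<dots> \<le> exp (- \<mu> / 3)"
      using ln2_ge_two_thirds mult_left_mono[of "1 - 2 * ln 2" "- 1 / 3 :: real" \<mu>] \<open>0 \<le> \<mu>\<close> by simp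
    finally show "exp (- 2 * \<mu> * ln 2) * (1 + t) ^ N \<le> exp (- \<mu> / 3)" .
  qed
  finally have le: "(\<integral>\<^sup>+ w. ennreal (exp (- 2 * \<mu> * ln 2)) * (\<Prod>i<N. g (shift (i * b) w)) \<partial>Q)
      \<le> ennreal (exp (- \<mu> / 3))" .
  show ?thesis
  proof (rule measure_le_nn_integral[OF _ _ _ le])
    fix w assume "2 * \<mu> \<le> real (?n w)"
    then have "0 \<le> ln 2 * (real (?n w) - 2 * \<mu>)" by simp
    then show "1 \<le> ennreal (exp (- 2 * \<mu> * ln 2)) * (\<Prod>i<N. g (shift (i * b) w))"
      unfolding pw by (simp add: ennreal_mult'[symmetric] mult_exp_exp algebra_simps)
  next
    show "0 \<le> exp (- \<mu> / 3)" by simp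
  qed measurable
qed

end

section \<open>Version spaces, shattering and a uniform form of the estimators\<close>

definition version_space :: "'a classifier set \<Rightarrow> 'a sample \<Rightarrow> 'a classifier set" where
  "version_space C ps = {h \<in> C. \<forall>(x, y)\<in>set ps. h x = y}"

lemma restrict_label_version_space:
  "restrict_label (version_space C ps) x y = version_space C (ps @ [(x, y)])"
  by (auto simp: restrict_label_def version_space_def)

lemma shatters_Nil [simp]: "shatters H [] \<longleftrightarrow> H \<noteq> {}"
  by (auto simp: shatters_def)

lemma shatters_mono: "shatters H S \<Longrightarrow> H \<subseteq> H' \<Longrightarrow> shatters H' S"
  unfolding shatters_def by blast

lemma shatters_appendD:
  assumes "shatters H (S @ T)" shows "shatters H S"
  unfolding shatters_def
proof (intro allI impI)
  fix ys :: "bool list" assume "length ys = length S"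
  then obtain h where "h \<in> H" "map h (S @ T) = ys @ map (\<lambda>_. True) T"
    using assms[unfolded shatters_def, rule_format, of "ys @ map (\<lambda>_. True) T"] by auto
  then show "\<exists>h\<in>H. map h S = ys"
    using \<open>length ys = length S\<close> by (intro bexI[of _ h]) auto
qed

text \<open>Patterns on the longer tuple are split by their last label. Hence the tuples counted by
  \<open>Delta_hat_point\<close> are the intersection of the two sets of tuples that stay shattered
  under either label of the new point.\<close>

lemma shatters_snoc:
  "shatters H (S @ [x]) \<longleftrightarrow>
     shatters (restrict_label H x True) S \<and> shatters (restrict_label H x False) S"
proof
  assume *: "shatters H (S @ [x])"
  have "\<exists>h\<in>restrict_label H x y. map h S = ys" if len: "length ys = length S" for y :: bool and ys
  proof -
    obtain h where "h \<in> H" "map h (S @ [x]) = ys @ [y]"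
      using *[unfolded shatters_def, rule_format, of "ys @ [y]"] len by auto
    then show ?thesis by (intro bexI[of _ h]) (auto simp: restrict_label_def)
  qed
  then show "shatters (restrict_label H x True) S \<and> shatters (restrict_label H x False) S"
    by (auto simp: shatters_def)
next
  assume *: "shatters (restrict_label H x True) S \<and> shatters (restrict_label H x False) S"
  show "shatters H (S @ [x])"
    unfolding shatters_def
  proof (intro allI impI)
    fix ys :: "bool list" assume "length ys = length (S @ [x])"
    then obtain zs y where ys: "ys = zs @ [y]" "length zs = length S"
      by (cases ys rule: rev_cases) auto
    have "shatters (restrict_label H x y) S" using * by (cases y) auto
    then obtain h where "h \<in> restrict_label H x y" "map h S = zs"
      using ys by (auto simp: shatters_def)
    then show "\<exists>h\<in>H. map h (S @ [x]) = ys"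
      using ys by (intro bexI[of _ h]) (auto simp: restrict_label_def)
  qed
qed

lemma DIS_iff_shatters: "x \<in> DIS H \<longleftrightarrow> shatters H [x]"
proof -
  have "shatters H [x] \<longleftrightarrow> restrict_label H x True \<noteq> {} \<and> restrict_label H x False \<noteq> {}"
    using shatters_snoc[of H "[]" x] by simp
  then show ?thesis by (auto simp: DIS_def restrict_label_def)
qed

lemma unanimous_iff_shatters: "(\<forall>h\<in>H. h x = y) \<longleftrightarrow> \<not> shatters (restrict_label H x (\<not> y)) []"
  by (auto simp: restrict_label_def)

lemma block_1 [simp]: "block w' (Suc 0) i = []"
  by (simp add: block_def)

lemma shift_shift: "shift a (shift b w) = shift (b + a) w"
  by (simp add: shift_def add.assoc)

text \<open>Passes to blocks counted from 0: \<open>shift 1\<close> accounts for sequences being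
  used from index 1 on, and block \<open>Suc i\<close> starts \<open>i * (k - 1)\<close> places
  later.\<close>

lemma block_eq_shift:
  "block w' k (Suc i) = map (shift (i * (k - 1)) (shift 1 w')) [0..<k - 1]"
  by (simp add: block_def shift_shift map_shift add_ac del: upt_Suc)

lemma card_blocks_eq:
  "card {i \<in> {1..N}. \<phi> (block w' k i)}
     = card {i \<in> {..<N}. \<phi> (map (shift (i * (k - 1)) (shift 1 w')) [0..<k - 1])}"
proof -
  have "{i \<in> {1..N}. \<phi> (block w' k i)} = Suc ` {i \<in> {..<N}. \<phi> (block w' k (Suc i))}"
  proof (intro set_eqI iffI)
    fix i assume "i \<in> {i \<in> {1..N}. \<phi> (block w' k i)}"
    then show "i \<in> Suc ` {i \<in> {..<N}. \<phi> (block w' k (Suc i))}"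
      by (cases i) auto
  qed auto
  then show ?thesis
    by (simp only: card_image[OF inj_Suc[THEN inj_on_subset], OF subset_UNIV] block_eq_shift)
qed

text \<open>The separate definition for \<open>k = 1\<close> is the general formula for empty
  tuples: a nonempty \<open>H\<close> shatters all \<open>m ^ 3\<close> of them and a restriction of
  it shatters all or none, so the ratio is 0 or 1. Later arguments can thus treat all
  \<open>k\<close> alike.\<close>

lemma Gamma_hat_eq:
  assumes "1 \<le> m" "H \<noteq> {}"
  shows "Gamma_hat w' k m x y H =
    real (card {i \<in> {1..m ^ 3}. shatters H (block w' k i) \<and>
                         \<not> shatters (restrict_label H x (\<not> y)) (block w' k i)})
             / real (shatter_count w' k m H)"
proof (cases "k = 1")
  case True
  have "{i. Suc 0 \<le> i \<and> i \<le> m ^ 3} = {1..m ^ 3}" "1 \<le> m ^ 3"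
    using assms by auto
  note * = this
  show ?thesis
    using True assms * by (cases "restrict_label H x (\<not> y) = {}")
      (simp_all add: Gamma_hat_def shatter_count_def unanimous_iff_shatters)
qed (simp add: Gamma_hat_def)

lemma Delta_hat_point_eq:
  assumes "1 \<le> m" "H \<noteq> {}"
  shows "Delta_hat_point w' k m x H =
    real (card {i \<in> {1..m ^ 3}. shatters H (block w' k i @ [x])}) / real (shatter_count w' k m H)"
proof (cases "k = 1")
  case True
  have "{i. Suc 0 \<le> i \<and> i \<le> m ^ 3} = {1..m ^ 3}" "1 \<le> m ^ 3"
    using assms by auto
  note * = this
  show ?thesis
    using True assms * by (cases "shatters H [x]")
      (simp_all add: Delta_hat_point_def shatter_count_def DIS_iff_shatters)
qed (simp add: Delta_hat_point_def)

lemma all_less_add: "(\<forall>i<n + l. \<phi> i) \<longleftrightarrow> (\<forall>i<n. \<phi> i) \<and> (\<forall>i<l. \<phi> (n + i))" for n l :: nat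
proof safe
  fix i assume *: "\<forall>i<n. \<phi> i" "\<forall>i<l. \<phi> (n + i)" "i < n + l"
  show "\<phi> i"
  proof (cases "i < n")
    case False
    then have "\<phi> (n + (i - n))" using * by (intro *(2)[rule_format]) simp
    then show ?thesis using False by simp
  qed (use * in simp)
qed auto

section \<open>Measurability of shattering events\<close>

locale concepts =
  fixes M :: "'a measure" and C :: "'a classifier set"
  assumes classifiers: "C \<subseteq> classifiers M" and measurable_concepts: "measurable_concepts M C"
begin

text \<open>The standing assumption concerns a fixed label pattern. A random pattern has only
  finitely many values \<open>l\<close>, and the event is split accordingly.\<close>

lemma pred_realizes:
  fixes n :: nat
  assumes g: "\<And>i. i < n \<Longrightarrow> g i \<in> measurable \<Omega> M"
    and y [measurable]: "\<And>i. i < n \<Longrightarrow> Measurable.pred \<Omega> (y i)"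
  shows "Measurable.pred \<Omega> (\<lambda>\<omega>. \<exists>h\<in>C. \<forall>i<n. h (g i \<omega>) = y i \<omega>)"
proof -
  have fin: "finite {l :: bool list. length l = n}"
    using finite_lists_length_eq[of "UNIV :: bool set" n] by simp
  have [measurable]: "Measurable.pred \<Omega> (\<lambda>\<omega>. \<exists>h\<in>C. \<forall>i<n. h (g i \<omega>) = z i)" for z
  proof -
    have G: "(\<lambda>\<omega>. \<lambda>i\<in>{..<n}. g i \<omega>) \<in> measurable \<Omega> (PiM {..<n} (\<lambda>_. M))"
      by (rule measurable_restrict) (use g in auto)
    have "Measurable.pred (PiM {..<n} (\<lambda>_. M)) (\<lambda>x. \<exists>h\<in>C. \<forall>i<n. h (x i) = z i)"
      using measurable_concepts unfolding measurable_concepts_def pred_def by blast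
    from measurable_compose[OF G this] show ?thesis
      by (rule measurable_cong[THEN iffD1, rotated]) auto
  qed
  have "Measurable.pred \<Omega> (\<lambda>\<omega>. \<exists>l\<in>{l. length l = n}.
      (\<forall>i\<in>{..<n}. y i \<omega> = l ! i) \<and> (\<exists>h\<in>C. \<forall>i<n. h (g i \<omega>) = l ! i))"
  proof (rule pred_intros_finite(4)[OF fin])
    fix l :: "bool list"
    have "Measurable.pred \<Omega> (\<lambda>\<omega>. y i \<omega> = l ! i)" if "i \<in> {..<n}" for i
      using y[of i] that by (cases "l ! i") auto
    then have [measurable]: "Measurable.pred \<Omega> (\<lambda>\<omega>. \<forall>i\<in>{..<n}. y i \<omega> = l ! i)"
      by (intro pred_intros_finite(3) finite_lessThan)
    show "Measurable.pred \<Omega> (\<lambda>\<omega>. (\<forall>i\<in>{..<n}. y i \<omega> = l ! i) \<and> (\<exists>h\<in>C. \<forall>i<n. h (g i \<omega>) = l ! i))"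
      by measurable
  qed
  also have "(\<lambda>\<omega>. \<exists>l\<in>{l. length l = n}.
      (\<forall>i\<in>{..<n}. y i \<omega> = l ! i) \<and> (\<exists>h\<in>C. \<forall>i<n. h (g i \<omega>) = l ! i))
      = (\<lambda>\<omega>. \<exists>h\<in>C. \<forall>i<n. h (g i \<omega>) = y i \<omega>)"
  proof (intro ext iffI)
    fix \<omega> assume "\<exists>h\<in>C. \<forall>i<n. h (g i \<omega>) = y i \<omega>"
    then show "\<exists>l\<in>{l. length l = n}. (\<forall>i\<in>{..<n}. y i \<omega> = l ! i) \<and> (\<exists>h\<in>C. \<forall>i<n. h (g i \<omega>) = l ! i)"
      by (intro bexI[of _ "map (\<lambda>i. y i \<omega>) [0..<n]"]) auto
  qed auto
  finally show ?thesis .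
qed

text \<open>Shattering by a version space is a finite intersection, over the patterns
  \<open>ys\<close> of the tuple, of the events that some concept realizes the sample and
  \<open>ys\<close> together.\<close>

lemma pred_shatters_version_space:
  assumes gs: "\<And>g y. (g, y) \<in> set gs \<Longrightarrow> g \<in> measurable \<Omega> M \<and> Measurable.pred \<Omega> y"
    and qs: "\<And>q. q \<in> set qs \<Longrightarrow> q \<in> measurable \<Omega> M"
  shows "Measurable.pred \<Omega> (\<lambda>\<omega>. shatters (version_space C (map (\<lambda>(g, y). (g \<omega>, y \<omega>)) gs))
                                 (map (\<lambda>q. q \<omega>) qs))"
proof -
  define n where "n = length gs"
  define l where "l = length qs"
  have fin: "finite {ys :: bool list. length ys = l}"
    using finite_lists_length_eq[of "UNIV :: bool set" l] by simp
  define g where "g = (\<lambda>i. if i < n then fst (gs ! i) else qs ! (i - n))"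
  define y where "y = (\<lambda>ys i. if i < n then snd (gs ! i) else (\<lambda>_. (ys :: bool list) ! (i - n)))"
  have "Measurable.pred \<Omega> (\<lambda>\<omega>. \<exists>h\<in>C. \<forall>i<n + l. h (g i \<omega>) = y ys i \<omega>)" for ys
  proof (rule pred_realizes)
    fix i assume "i < n + l"
    show "g i \<in> measurable \<Omega> M"
      using gs[of "fst (gs ! i)" "snd (gs ! i)"] qs[of "qs ! (i - n)"] \<open>i < n + l\<close>
      by (auto simp: g_def n_def l_def)
    show "Measurable.pred \<Omega> (y ys i)"
      using gs[of "fst (gs ! i)" "snd (gs ! i)"] \<open>i < n + l\<close>
      by (auto simp: y_def n_def l_def)
  qed
  then have "Measurable.pred \<Omega> (\<lambda>\<omega>. \<forall>ys\<in>{ys. length ys = l}. \<exists>h\<in>C. \<forall>i<n + l. h (g i \<omega>) = y ys i \<omega>)"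
    by (rule pred_intros_finite(3)[OF fin])
  also have "(\<lambda>\<omega>. \<forall>ys\<in>{ys. length ys = l}. \<exists>h\<in>C. \<forall>i<n + l. h (g i \<omega>) = y ys i \<omega>) =
    (\<lambda>\<omega>. shatters (version_space C (map (\<lambda>(g, y). (g \<omega>, y \<omega>)) gs)) (map (\<lambda>q. q \<omega>) qs))"
  proof
    fix \<omega>
    have "(\<forall>i<n + l. h (g i \<omega>) = y ys i \<omega>) \<longleftrightarrow>
        (\<forall>(x, z)\<in>set (map (\<lambda>(g, y). (g \<omega>, y \<omega>)) gs). h x = z) \<and> map h (map (\<lambda>q. q \<omega>) qs) = ys"
      if "length ys = l" for h ys
    proof -
      have "(\<forall>i<n + l. h (g i \<omega>) = y ys i \<omega>) \<longleftrightarrow>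
          (\<forall>i<n. h (g i \<omega>) = y ys i \<omega>) \<and> (\<forall>i<l. h (g (n + i) \<omega>) = y ys (n + i) \<omega>)"
        by (rule all_less_add)
      also have "(\<forall>i<n. h (g i \<omega>) = y ys i \<omega>) \<longleftrightarrow>
          (\<forall>(x, z)\<in>set (map (\<lambda>(g, y). (g \<omega>, y \<omega>)) gs). h x = z)"
        by (simp add: all_set_conv_all_nth g_def y_def n_def split_beta)
      also have "(\<forall>i<l. h (g (n + i) \<omega>) = y ys (n + i) \<omega>) \<longleftrightarrow> map h (map (\<lambda>q. q \<omega>) qs) = ys"
        using that by (auto simp: g_def y_def l_def list_eq_iff_nth_eq)
      finally show ?thesis .
    qed
    note iff = this
    have "(\<exists>h\<in>C. \<forall>i<n + l. h (g i \<omega>) = y ys i \<omega>) \<longleftrightarrow>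
        (\<exists>h\<in>version_space C (map (\<lambda>(g, y). (g \<omega>, y \<omega>)) gs). map h (map (\<lambda>q. q \<omega>) qs) = ys)"
      if "length ys = l" for ys
      unfolding version_space_def by (simp only: mem_Collect_eq Bex_def iff[OF that] conj_assoc)
    then show "(\<forall>ys\<in>{ys. length ys = l}. \<exists>h\<in>C. \<forall>i<n + l. h (g i \<omega>) = y ys i \<omega>) =
      shatters (version_space C (map (\<lambda>(g, y). (g \<omega>, y \<omega>)) gs)) (map (\<lambda>q. q \<omega>) qs)"
      unfolding shatters_def by (simp add: l_def)
  qed
  finally show ?thesis .
qed

end

section \<open>Running the algorithm\<close>

lemma run_bind_query: "run Y (bind_query q g) = run Y (g (run Y q))"
  by (induction q) auto

lemma num_requests_bind_query:
  "num_requests Y (bind_query q g) = num_requests Y q + num_requests Y (g (run Y q))"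
  by (induction q) auto

lemma run_map_requests: "run Y (map_requests g bs) = map (\<lambda>b. run Y (g b)) bs"
  by (induction bs) (auto simp: run_bind_query)

lemma num_requests_map_requests:
  "num_requests Y (map_requests g bs) = sum_list (map (\<lambda>b. num_requests Y (g b)) bs)"
  by (induction bs) (auto simp: num_requests_bind_query run_bind_query)

lemma run_request_labels: "run Y (request_labels is) = map Y is"
  by (simp add: request_labels_def run_map_requests)

lemma num_requests_request_labels: "num_requests Y (request_labels is) = length is"
  by (induction "is") (simp_all add: request_labels_def num_requests_bind_query)

text \<open>The inner loop with the oracle replaced by its answers. Only the counter and the labels
  are kept, as the points are known from the index list; the result lies in a countable type, which
  the measurability proofs exploit.\<close>

primrec point_labels ::
    "(nat \<Rightarrow> bool) \<Rightarrow> (nat \<Rightarrow> bool) \<Rightarrow> nat \<Rightarrow> (nat \<Rightarrow> bool) \<Rightarrow> nat list \<Rightarrow> nat \<Rightarrow> nat \<times> bool list" where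
  "point_labels want infer cap Y [] t = (t, [])"
| "point_labels want infer cap Y (m # ms) t =
     (let q = want m \<and> t < cap; r = point_labels want infer cap Y ms (if q then t + 1 else t)
      in (fst r, (if q then Y m else infer m) # snd r))"

lemma length_point_labels [simp]:
  "length (snd (point_labels want infer cap Y ms t)) = length ms"
  by (induction ms arbitrary: t) (auto simp: Let_def)

lemma run_label_points:
  "run Y (label_points want infer cap X ms t L) =
     (fst (point_labels want infer cap Y ms t),
      L @ zip (map X ms) (snd (point_labels want infer cap Y ms t)))"
  by (induction ms arbitrary: t L) (auto simp: Let_def)

lemma num_requests_label_points:
  "num_requests Y (label_points want infer cap X ms t L) + t = fst (point_labels want infer cap Y ms t)"
proof (induction ms arbitrary: t L)
  case (Cons m ms)
  show ?case
    using Cons[of t "L @ [(X m, infer m)]"] Cons[of "t + 1" "L @ [(X m, Y m)]"] by (auto simp: Let_def)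
qed simp

lemma point_labels_le:
  "t \<le> cap \<Longrightarrow> fst (point_labels want infer cap Y ms t) \<le> cap"
  by (induction ms arbitrary: t) (auto simp: Let_def)

lemma point_labels_cong:
  assumes "\<And>m. m \<in> set ms \<Longrightarrow> want m = want' m \<and> infer m = infer' m \<and> Y m = Y' m"
  shows "point_labels want infer cap Y ms t = point_labels want' infer' cap Y' ms t"
  using assms by (induction ms arbitrary: t) (auto simp: Let_def)

lemma point_labels_requests:
  "fst (point_labels want infer cap Y ms t) \<le> t + length (filter want ms)"
proof (induction ms arbitrary: t)
  case (Cons m ms)
  show ?case using Cons[of t] Cons[of "Suc t"] by (auto simp: Let_def)
qed simp

text \<open>The cap never takes effect: all wanted labels together fit, so the counter is below
  \<open>cap\<close> whenever a label is wanted.\<close>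

lemma point_labels_correct:
  assumes "t + length (filter want ms) \<le> cap"
    and "\<And>m. m \<in> set ms \<Longrightarrow> \<not> want m \<Longrightarrow> infer m = Y m"
  shows "snd (point_labels want infer cap Y ms t) = map Y ms"
  using assms
proof (induction ms arbitrary: t)
  case (Cons m ms)
  have "snd (point_labels want infer cap Y ms (if want m \<and> t < cap then t + 1 else t)) = map Y ms"
    using Cons.prems by (intro Cons.IH) (auto split: if_splits)
  moreover have "want m \<Longrightarrow> t < cap" "\<not> want m \<Longrightarrow> infer m = Y m"
    using Cons.prems by auto
  ultimately show ?case by (auto simp: Let_def)
qed simp

definition wants_label :: "(nat \<Rightarrow> 'a) \<Rightarrow> (nat \<Rightarrow> 'a) \<Rightarrow> nat \<Rightarrow> 'a classifier set \<Rightarrow> nat \<Rightarrow> bool" where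
  "wants_label X w' k V m \<longleftrightarrow> 1 / 2 \<le> Delta_hat_point w' k m (X m) V"

definition inferred_label ::
    "(nat \<Rightarrow> 'a) \<Rightarrow> (nat \<Rightarrow> 'a) \<Rightarrow> nat \<Rightarrow> 'a classifier set \<Rightarrow> nat \<Rightarrow> bool" where
  "inferred_label X w' k V m = arg_max (\<lambda>y. Gamma_hat w' k m (X m) y V) (\<lambda>_. True)"

definition sample_length ::
    "nat \<Rightarrow> (nat \<Rightarrow> 'a) \<Rightarrow> (nat \<Rightarrow> 'a) \<Rightarrow> 'a classifier set \<Rightarrow> nat \<Rightarrow> nat" where
  "sample_length n w w' V k = nat \<lfloor>real n / (6 * 2 ^ k * Delta_hat w w' k (n div 3) V)\<rfloor>"

primrec round_labels ::
    "nat \<Rightarrow> 'a unlabeled \<Rightarrow> 'a classifier set \<Rightarrow> (nat \<Rightarrow> bool) \<Rightarrow> nat list \<Rightarrow> nat \<Rightarrow> nat \<times> bool list list" where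
  "round_labels n U V Y [] t = (t, [])"
| "round_labels n U V Y (k # ks) t =
     (case U of (X, w, w') \<Rightarrow>
       let r = point_labels (wants_label X w' k V) (inferred_label X w' k V) (2 * n div 3) Y
                 [n div 3 + 1..<n div 3 + sample_length n w w' V k + 1] t;
           rr = round_labels n U V Y ks (fst r)
       in (fst rr, snd r # snd rr))"

lemma length_round_labels [simp]: "length (snd (round_labels n U V Y ks t)) = length ks"
  by (induction ks arbitrary: t) (auto simp: Let_def split: prod.split)

lemma length_round_labels_nth:
  "i < length ks \<Longrightarrow> length (snd (round_labels n (X, w, w') V Y ks t) ! i) = sample_length n w w' V (ks ! i)"
  by (induction ks arbitrary: t i) (auto simp: Let_def nth_Cons split: nat.split)

lemma label_samples_Cons:
  "label_samples n (X, w, w') V (k # ks) t =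
     bind_query (label_points (wants_label X w' k V) (inferred_label X w' k V)
        (2 * n div 3) X [n div 3 + 1..<n div 3 + sample_length n w w' V k + 1] t [])
      (\<lambda>(t', L). bind_query (label_samples n (X, w, w') V ks t') (\<lambda>Ls. Return (L # Ls)))"
  by (simp add: Let_def sample_length_def wants_label_def[abs_def] inferred_label_def[abs_def])

lemma round_labels_Cons:
  fixes X w w' V n k Y
  defines "r \<equiv> point_labels (wants_label X w' k V) (inferred_label X w' k V) (2 * n div 3) Y
                 [n div 3 + 1..<n div 3 + sample_length n w w' V k + 1]"
  shows "round_labels n (X, w, w') V Y (k # ks) t =
    (fst (round_labels n (X, w, w') V Y ks (fst (r t))),
     snd (r t) # snd (round_labels n (X, w, w') V Y ks (fst (r t))))"
  by (simp add: r_def Let_def)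

lemma run_label_samples:
  "run Y (label_samples n (X, w, w') V ks t) =
     map2 (\<lambda>k bs. zip (map X [n div 3 + 1..<n div 3 + sample_length n w w' V k + 1]) bs)
       ks (snd (round_labels n (X, w, w') V Y ks t))"
proof (induction ks arbitrary: t)
  case (Cons k ks)
  show ?case
    unfolding label_samples_Cons round_labels_Cons run_bind_query run_label_points
    by (simp only: prod.case Cons.IH run_bind_query run.simps append_Nil zip_Cons_Cons list.map fst_conv snd_conv)
qed simp

lemma num_requests_label_samples:
  "num_requests Y (label_samples n (X, w, w') V ks t) + t = fst (round_labels n (X, w, w') V Y ks t)"
proof (induction ks arbitrary: t)
  case (Cons k ks)
  let ?ms = "[n div 3 + 1..<n div 3 + sample_length n w w' V k + 1]"
  let ?r = "point_labels (wants_label X w' k V) (inferred_label X w' k V) (2 * n div 3) Y ?ms"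
  have "num_requests Y (label_points (wants_label X w' k V) (inferred_label X w' k V) (2 * n div 3) X ?ms t [])
      + t = fst (?r t)"
    by (rule num_requests_label_points)
  moreover note Cons.IH[of "fst (?r t)"]
  ultimately show ?case
    unfolding label_samples_Cons round_labels_Cons num_requests_bind_query run_label_points prod.case
      num_requests.simps fst_conv
    by linarith
qed simp

lemma round_labels_le:
  "t \<le> 2 * n div 3 \<Longrightarrow> fst (round_labels n U V Y ks t) \<le> 2 * n div 3"
proof (induction ks arbitrary: t)
  case (Cons k ks)
  obtain X w w' where U: "U = (X, w, w')" by (cases U)
  show ?case
    unfolding U round_labels_Cons fst_conv by (rule Cons.IH[unfolded U], rule point_labels_le, rule Cons.prems)
qed simp

definition first_set :: "(nat \<Rightarrow> 'a) \<Rightarrow> nat \<Rightarrow> 'a set \<Rightarrow> nat \<Rightarrow> nat set" where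
  "first_set X u D l = {i. u < i \<and> X i \<in> D \<and> card {i'. u < i' \<and> i' < i \<and> X i' \<in> D} < l}"

text \<open>The number of earlier points in \<open>D\<close> is injective on
  \<open>first_set\<close> and below \<open>l\<close>. Finiteness matters because
  \<open>sorted_list_of_set\<close> lists the elements of finite sets only.\<close>

lemma finite_first_set: "finite (first_set X u D l)" and card_first_set_le: "card (first_set X u D l) \<le> l"
proof -
  let ?r = "\<lambda>i. card {i'. u < i' \<and> i' < i \<and> X i' \<in> D}"
  have less: "?r i < ?r j" if "i < j" "i \<in> first_set X u D l" for i j
    using that by (intro psubset_card_mono) (auto simp: first_set_def)
  have inj: "inj_on ?r (first_set X u D l)"
  proof (rule inj_onI)
    fix i j assume "i \<in> first_set X u D l" "j \<in> first_set X u D l" "?r i = ?r j"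
    then show "i = j"
      using less[of i j] less[of j i] by (cases i j rule: linorder_cases) simp_all
  qed
  have sub: "?r ` first_set X u D l \<subseteq> {..<l}"
    by (auto simp: first_set_def)
  show "finite (first_set X u D l)"
    using finite_subset[OF sub] by (rule finite_imageD[OF _ inj]) simp
  show "card (first_set X u D l) \<le> l"
    using card_inj_on_le[OF inj sub] by simp
qed

lemma first_points_eq: "first_points X u D l = sorted_list_of_set (first_set X u D l)"
  by (simp add: first_points_def first_set_def)

text \<open>If no point is found, the quotient is \<open>0 / 0 = 0\<close>, in agreement with the
  convention for the empty sample.\<close>

definition comparison :: "(nat \<Rightarrow> 'a) \<Rightarrow> (nat \<Rightarrow> bool) \<Rightarrow> nat \<Rightarrow> nat \<Rightarrow> 'a set \<Rightarrow> 'a classifier \<Rightarrow> real" where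
  "comparison X Y u l D h =
     real (card {i \<in> first_set X u D l. h (X i) \<noteq> Y i}) / real (card (first_set X u D l))"

definition comparison_size :: "nat \<Rightarrow> nat \<Rightarrow> nat \<Rightarrow> nat" where
  "comparison_size N m j = nat \<lfloor>real m / (real j * real (N - j) * ln (exp 1 * real N))\<rfloor>"

lemma run_compare_error:
  "run Y (compare_error h N m X u k j) =
     comparison X Y u (comparison_size N m j) {x. h j x \<noteq> h k x} (h k)"
proof -
  define F where "F = first_set X u {x. h j x \<noteq> h k x} (comparison_size N m j)"
  have fin: "finite F" by (simp add: F_def finite_first_set)
  have "length (filter (\<lambda>(x, y). h k x \<noteq> y) (zip (map X R) (map Y R)))
      = length (filter (\<lambda>i. h k (X i) \<noteq> Y i) R)" for R
    by (induction R) auto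
  moreover have "length (filter Q (sorted_list_of_set F)) = card {i \<in> F. Q i}" for Q
    using distinct_card[of "filter Q (sorted_list_of_set F)"] fin by simp
  ultimately show ?thesis
    unfolding compare_error_def comparison_size_def[symmetric] first_points_eq F_def[symmetric] Let_def
      comparison_def
    using fin by (simp add: run_bind_query run_request_labels emp_er_def)
qed

lemma num_requests_compare_error:
  "num_requests Y (compare_error h N m X u k j) \<le> comparison_size N m j"
  using card_first_set_le[of X u "{x. h j x \<noteq> h k x}" "comparison_size N m j"]
  unfolding compare_error_def comparison_size_def[symmetric] first_points_eq Let_def
  by (simp add: num_requests_bind_query num_requests_request_labels finite_first_set)

definition selected ::
    "(nat \<Rightarrow> 'a classifier) \<Rightarrow> nat \<Rightarrow> nat \<Rightarrow> (nat \<Rightarrow> 'a) \<Rightarrow> (nat \<Rightarrow> bool) \<Rightarrow> nat \<Rightarrow> nat" where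
  "selected h N m X Y u = Max {k \<in> {1..N}. \<forall>j\<in>{1..<k}.
     comparison X Y u (comparison_size N m j) {x. h j x \<noteq> h k x} (h k) \<le> 7 / 12}"

lemma run_active_select: "run Y (active_select h N m X u) = h (selected h N m X Y u)"
proof -
  have *: "{k \<in> {1..N}. \<forall>e\<in>set (map (\<lambda>k. map (\<lambda>j.
          comparison X Y u (comparison_size N m j) {x. h j x \<noteq> h k x} (h k)) [1..<k]) [1..<N + 1] ! (k - 1)). e \<le> 7 / 12}
    = {k \<in> {1..N}. \<forall>j\<in>{1..<k}. comparison X Y u (comparison_size N m j) {x. h j x \<noteq> h k x} (h k) \<le> 7 / 12}"
    (is "?A = ?B")
  proof (rule Collect_cong, rule conj_cong[OF refl])
    fix k assume "k \<in> {1..N}"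
    then show "(\<forall>e\<in>set (map (\<lambda>k. map (\<lambda>j.
          comparison X Y u (comparison_size N m j) {x. h j x \<noteq> h k x} (h k)) [1..<k]) [1..<N + 1] ! (k - 1)). e \<le> 7 / 12)
      \<longleftrightarrow> (\<forall>j\<in>{1..<k}. comparison X Y u (comparison_size N m j) {x. h j x \<noteq> h k x} (h k) \<le> 7 / 12)"
      by (subst nth_map) (auto simp del: upt_Suc)
  qed
  show ?thesis
    unfolding active_select_def selected_def run_bind_query run_map_requests run_compare_error run.simps *
    by (rule refl)
qed

definition initial_space :: "'a classifier set \<Rightarrow> nat \<Rightarrow> (nat \<Rightarrow> 'a) \<Rightarrow> (nat \<Rightarrow> bool) \<Rightarrow> 'a classifier set" where
  "initial_space C m X Y = version_space C (map (\<lambda>i. (X i, Y i)) [1..<m + 1])"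

definition round_lists ::
    "'a classifier set \<Rightarrow> nat \<Rightarrow> nat \<Rightarrow> 'a unlabeled \<Rightarrow> (nat \<Rightarrow> bool) \<Rightarrow> bool list list" where
  "round_lists C N n U Y =
     snd (round_labels n U (initial_space C (n div 3) (fst U) Y) Y [1..<N + 1] (n div 3))"

definition round_length :: "'a classifier set \<Rightarrow> nat \<Rightarrow> 'a unlabeled \<Rightarrow> (nat \<Rightarrow> bool) \<Rightarrow> nat \<Rightarrow> nat" where
  "round_length C n U Y =
     sample_length n (fst (snd U)) (snd (snd U)) (initial_space C (n div 3) (fst U) Y)"

text \<open>The sample is rebuilt from the list \<open>bs\<close> of its labels, whose length also
  fixes the indices of its points. There are countably many such lists, so measurability need only
  be checked for a fixed \<open>bs\<close>.\<close>

definition hypothesis ::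
    "('r, 'a) passive_alg \<Rightarrow> 'a classifier set \<Rightarrow> nat \<Rightarrow> nat \<Rightarrow> (nat \<Rightarrow> 'r) \<Rightarrow> 'a unlabeled \<Rightarrow>
     (nat \<Rightarrow> bool) \<Rightarrow> nat \<Rightarrow> 'a classifier" where
  "hypothesis A C N n s U Y k =
     (let bs = round_lists C N n U Y ! (k - 1) in
      plearn A (s k) (zip (map (fst U) [n div 3 + 1..<n div 3 + length bs + 1]) bs))"

definition select_start :: "'a classifier set \<Rightarrow> nat \<Rightarrow> nat \<Rightarrow> 'a unlabeled \<Rightarrow> (nat \<Rightarrow> bool) \<Rightarrow> nat" where
  "select_start C N n U Y = n div 3 + Max (round_length C n U Y ` {1..N})"

definition output_index ::
    "('r, 'a) passive_alg \<Rightarrow> 'a classifier set \<Rightarrow> nat \<Rightarrow> nat \<Rightarrow> (nat \<Rightarrow> 'r) \<Rightarrow> 'a unlabeled \<Rightarrow>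
     (nat \<Rightarrow> bool) \<Rightarrow> nat" where
  "output_index A C N n s U Y =
     selected (hypothesis A C N n s U Y) N (n div 3) (fst U) Y (select_start C N n U Y)"

lemma length_round_lists:
  assumes "k \<in> {1..N}"
  shows "length (round_lists C N n U Y ! (k - 1)) = round_length C n U Y k"
proof -
  obtain X w w' where U: "U = (X, w, w')" by (cases U)
  have "[1..<N + 1] ! (k - 1) = k" using assms by (subst nth_upt) auto
  then show ?thesis
    using length_round_labels_nth[of "k - 1" "[1..<N + 1]" n X w w' "initial_space C (n div 3) X Y" Y "n div 3"]
      assms
    by (auto simp add: round_lists_def round_length_def U del: upt_Suc)
qed

lemma selected_cong:
  assumes "\<And>k. k \<in> {1..N} \<Longrightarrow> h k = h' k"
  shows "selected h N m X Y u = selected h' N m X Y u"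
proof -
  have "{k \<in> {1..N}. \<forall>j\<in>{1..<k}. comparison X Y u (comparison_size N m j) {x. h j x \<noteq> h k x} (h k) \<le> 7 / 12}
    = {k \<in> {1..N}. \<forall>j\<in>{1..<k}. comparison X Y u (comparison_size N m j) {x. h' j x \<noteq> h' k x} (h' k) \<le> 7 / 12}"
    by (rule Collect_cong, rule conj_cong[OF refl], rule ball_cong[OF refl]) (simp add: assms)
  then show ?thesis by (simp only: selected_def)
qed

lemma selected_mem:
  assumes "1 \<le> N" shows "selected h N m X Y u \<in> {1..N}"
proof -
  let ?S = "{k \<in> {1..N}. \<forall>j\<in>{1..<k}. comparison X Y u (comparison_size N m j) {x. h j x \<noteq> h k x} (h k) \<le> 7 / 12}"
  have "1 \<in> ?S" using assms by simp
  then have "Max ?S \<in> ?S" by (intro Max_in) auto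
  then show ?thesis by (simp add: selected_def)
qed

lemma round_samples:
  fixes C :: "'a classifier set" and n N :: nat and X w w' :: "nat \<Rightarrow> 'a" and Y :: "nat \<Rightarrow> bool"
  assumes N: "1 \<le> N"
  defines "V \<equiv> initial_space C (n div 3) X Y"
  defines "Ls \<equiv> run Y (label_samples n (X, w, w') V [1..<N + 1] (n div 3))"
  shows "k \<in> {1..N} \<Longrightarrow> Ls ! (k - 1) =
      (let bs = round_lists C N n (X, w, w') Y ! (k - 1) in
        zip (map X [n div 3 + 1..<n div 3 + length bs + 1]) bs)"
    and "n div 3 + Max (set (map length Ls)) = select_start C N n (X, w, w') Y"
proof -
  have len: "length Ls = N"
    by (simp add: Ls_def run_label_samples del: upt_Suc)
  have nth: "Ls ! (k - 1) = (let bs = round_lists C N n (X, w, w') Y ! (k - 1) in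
        zip (map X [n div 3 + 1..<n div 3 + length bs + 1]) bs)" if "k \<in> {1..N}" for k
  proof -
    have "[1..<N + 1] ! (k - 1) = k" using that by (subst nth_upt) auto
    moreover have "length (round_lists C N n (X, w, w') Y ! (k - 1)) = sample_length n w w' V k"
      using length_round_lists[OF that, of C n "(X, w, w')" Y] by (simp add: round_length_def V_def)
    moreover have "k - 1 < length [1..<N + 1]"
      "k - 1 < length (snd (round_labels n (X, w, w') V Y [1..<N + 1] (n div 3)))"
      using that by auto
    ultimately show ?thesis
      unfolding Ls_def run_label_samples
      by (subst nth_map) (simp_all add: round_lists_def V_def Let_def del: upt_Suc)
  qed
  then show "k \<in> {1..N} \<Longrightarrow> Ls ! (k - 1) = (let bs = round_lists C N n (X, w, w') Y ! (k - 1) in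
        zip (map X [n div 3 + 1..<n div 3 + length bs + 1]) bs)" .
  have "length (Ls ! (k - 1)) = round_length C n (X, w, w') Y k" if "k \<in> {1..N}" for k
    using length_round_lists[OF that, of C n "(X, w, w')" Y] nth[OF that] by (simp add: Let_def)
  moreover have "map length Ls = map (\<lambda>k. length (Ls ! (k - 1))) [1..<N + 1]"
    by (rule nth_equalityI) (auto simp: len simp del: upt_Suc)
  ultimately have "set (map length Ls) = round_length C n (X, w, w') Y ` {1..N}"
    by (auto simp del: upt_Suc)
  then show "n div 3 + Max (set (map length Ls)) = select_start C N n (X, w, w') Y"
    by (simp add: select_start_def)
qed

lemma meta_algorithm1_alearn:
  fixes C :: "'a classifier set" and M :: "'a measure"
  defines "N \<equiv> the_enat (vc_dim M C) + 1"
  shows "alearn (meta_algorithm1 M C A) n s (X, w, w') =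
    bind_query (request_labels [1..<n div 3 + 1]) (\<lambda>ys.
      bind_query (label_samples n (X, w, w') {h \<in> C. \<forall>i\<in>{1..n div 3}. h (X i) = ys ! (i - 1)}
          [1..<N + 1] (n div 3)) (\<lambda>Ls.
        active_select (\<lambda>k. plearn A (s k) (Ls ! (k - 1))) N (n div 3) X
          (n div 3 + Max (set (map length Ls)))))"
  by (simp add: meta_algorithm1_def Let_def N_def del: upt_Suc)

lemma initial_space_eq:
  "{h \<in> C. \<forall>i\<in>{1..m}. h (X i) = map Y [1..<m + 1] ! (i - 1)} = initial_space C m X Y"
proof -
  have "map Y [1..<m + 1] ! (i - 1) = Y i" if "i \<in> {1..m}" for i
    using that by (subst nth_map) (auto simp del: upt_Suc)
  then show ?thesis by (auto simp: initial_space_def version_space_def simp del: upt_Suc)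
qed

lemma run_meta_algorithm1:
  fixes C :: "'a classifier set" and M :: "'a measure"
  defines "N \<equiv> the_enat (vc_dim M C) + 1"
  shows "run Y (alearn (meta_algorithm1 M C A) n s U) =
    hypothesis A C N n s U Y (output_index A C N n s U Y)"
proof -
  obtain X w w' where U: "U = (X, w, w')" by (cases U)
  have N: "1 \<le> N" by (simp add: N_def)
  let ?Ls = "run Y (label_samples n (X, w, w') (initial_space C (n div 3) X Y) [1..<N + 1] (n div 3))"
  let ?h = "\<lambda>k. plearn A (s k) (?Ls ! (k - 1))"
  have h: "?h k = hypothesis A C N n s U Y k" if "k \<in> {1..N}" for k
    unfolding round_samples(1)[OF N that] by (simp add: hypothesis_def U Let_def)
  have "run Y (alearn (meta_algorithm1 M C A) n s U) =
    ?h (selected ?h N (n div 3) X Y (n div 3 + Max (set (map length ?Ls))))"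
    unfolding U meta_algorithm1_alearn N_def[symmetric] run_bind_query run_request_labels initial_space_eq
      run_active_select by (rule refl)
  also have "selected ?h N (n div 3) X Y (n div 3 + Max (set (map length ?Ls))) = output_index A C N n s U Y"
    unfolding round_samples(2)[OF N] output_index_def U fst_conv using h
    by (intro selected_cong) (simp add: U)
  finally show ?thesis
    using h[OF selected_mem[OF N], of "hypothesis A C N n s U Y" "n div 3" "fst U" Y "select_start C N n U Y"]
    unfolding output_index_def by (rule trans)
qed

text \<open>After exchanging the sums each \<open>j\<close> occurs for \<open>N - j\<close> values
  of \<open>k\<close>, which cancels the factor \<open>N - j\<close> of the denominator. What
  remains is \<open>m\<close> times a harmonic sum divided by \<open>1 + ln N\<close>; this explains
  the shape of the comparison sizes.\<close>

lemma sum_comparison_size_le: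
  assumes "1 \<le> N"
  shows "(\<Sum>k = 1..N. \<Sum>j = 1..<k. comparison_size N m j) \<le> m"
proof -
  have "(\<Sum>k = 1..N. \<Sum>j = 1..<k. comparison_size N m j)
      = (\<Sum>j = 1..<N. (N - j) * comparison_size N m j)"
  proof -
    have "(\<Sum>k = 1..N. \<Sum>j = 1..<k. comparison_size N m j)
      = (\<Sum>(k, j)\<in>(SIGMA k:{1..N}. {1..<k}). comparison_size N m j)"
      by (rule sum.Sigma) auto
    also have "\<dots> = (\<Sum>(j, k)\<in>(SIGMA j:{1..<N}. {j<..N}). comparison_size N m j)"
      by (rule sum.reindex_bij_witness[of _ "\<lambda>(j, k). (k, j)" "\<lambda>(k, j). (j, k)"]) auto
    also have "\<dots> = (\<Sum>j = 1..<N. \<Sum>k\<in>{j<..N}. comparison_size N m j)"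
      by (rule sum.Sigma[symmetric]) auto
    finally show ?thesis by simp
  qed
  moreover have "real (\<Sum>j = 1..<N. (N - j) * comparison_size N m j) \<le> m"
  proof -
    have ln: "0 \<le> ln (real N)" "ln (exp 1 * real N) = 1 + ln (real N)"
      using assms by (auto simp: ln_mult)
    have "real ((N - j) * comparison_size N m j) \<le> real m / (1 + ln (real N)) * inverse (real j)"
      if "j \<in> {1..<N}" for j
    proof -
      have "real (comparison_size N m j) \<le> real m / (real j * real (N - j) * (1 + ln (real N)))"
        unfolding comparison_size_def ln using ln by (simp add: of_nat_nat)
      then have "real (N - j) * real (comparison_size N m j)
          \<le> real (N - j) * (real m / (real j * real (N - j) * (1 + ln (real N))))"
        by (intro mult_left_mono) auto
      also have "\<dots> = real m / (1 + ln (real N)) * inverse (real j)"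
        using that by (simp only: divide_inverse inverse_mult_distrib) simp
      finally show ?thesis by simp
    qed
    then have "real (\<Sum>j = 1..<N. (N - j) * comparison_size N m j)
        \<le> (\<Sum>j = 1..<N. real m / (1 + ln (real N)) * inverse (real j))"
      unfolding of_nat_sum by (rule sum_mono)
    also have "\<dots> = real m / (1 + ln (real N)) * (\<Sum>j = 1..<N. inverse (real j))"
      by (simp add: sum_distrib_left)
    also have "\<dots> \<le> real m / (1 + ln (real N)) * (1 + ln (real N))"
    proof (intro mult_left_mono)
      have "(\<Sum>j = 1..<N. inverse (real j)) \<le> harm N"
        unfolding harm_def by (intro sum_mono2) auto
      \<comment> \<open>\<open>harm N - ln N\<close> decreases in \<open>N\<close> and equals 1 at
        \<open>N = 1\<close>.\<close>
      also have "harm N - ln (real N) \<le> harm 1 - ln (real 1)"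
        using decseqD[OF decseq_harm_diff_ln, of 0 "N - 1"] assms by simp
      then have "harm N \<le> 1 + ln (real N)" by (simp add: harm_expand)
      finally show "(\<Sum>j = 1..<N. inverse (real j)) \<le> 1 + ln (real N)" .
    qed (use ln in auto)
    also have "\<dots> = m" using ln by simp
    finally show ?thesis .
  qed
  ultimately show ?thesis by (simp only: of_nat_le_iff)
qed

lemma num_requests_active_select:
  assumes "1 \<le> N"
  shows "num_requests Y (active_select h N m X u) \<le> m"
proof -
  have "num_requests Y (active_select h N m X u)
     = (\<Sum>k = 1..N. \<Sum>j = 1..<k. num_requests Y (compare_error h N m X u k j))"
    unfolding active_select_def num_requests_bind_query num_requests_map_requests num_requests.simps add_0_right
    by (simp only: sum_set_upt_conv_sum_list_nat[symmetric] Suc_eq_plus1[symmetric] atLeastLessThanSuc_atLeastAtMost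
       set_upt)
  also have "\<dots> \<le> (\<Sum>k = 1..N. \<Sum>j = 1..<k. comparison_size N m j)"
    by (intro sum_mono num_requests_compare_error)
  finally show ?thesis using sum_comparison_size_le[OF assms, of m] by simp
qed

text \<open>The counter of the labelling rounds starts at the \<open>n div 3\<close> initial labels
  and never exceeds \<open>2 * n div 3\<close>; the comparisons add at most
  \<open>n div 3\<close>.\<close>

lemma num_requests_meta_algorithm1:
  "num_requests Y (alearn (meta_algorithm1 M C A) n s U) \<le> n"
proof -
  obtain X w w' where U: "U = (X, w, w')" by (cases U)
  define N where "N = the_enat (vc_dim M C) + 1"
  let ?V = "initial_space C (n div 3) X Y"
  have "num_requests Y (label_samples n (X, w, w') ?V [1..<N + 1] (n div 3)) + n div 3 \<le> 2 * n div 3"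
    unfolding num_requests_label_samples by (rule round_labels_le) simp
  moreover have "num_requests Y (active_select h N (n div 3) X u) \<le> n div 3" for h u
    by (rule num_requests_active_select) (simp add: N_def)
  note this[of "\<lambda>k. plearn A (s k) (run Y (label_samples n (X, w, w') ?V [1..<N + 1] (n div 3)) ! (k - 1))"
      "n div 3 + Max (set (map length (run Y (label_samples n (X, w, w') ?V [1..<N + 1] (n div 3)))))"]
  ultimately show ?thesis
    unfolding U meta_algorithm1_alearn num_requests_bind_query run_request_labels initial_space_eq
      num_requests_request_labels N_def[symmetric] length_upt by linarith
qed

section \<open>Measurability\<close>

text \<open>On a tie the value is one fixed, unspecified label that does not vary with the data, so
  the inferred label is measurable.\<close>

lemma arg_max_bool:
  "arg_max g (\<lambda>_. True) = (if g False < g True then True else if g True < g False then False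
     else (SOME x. True))" for g :: "bool \<Rightarrow> real"
proof -
  have eq: "is_arg_max g (\<lambda>_. True) x \<longleftrightarrow> \<not> g x < g (\<not> x)" for x
    by (cases x) (simp_all add: is_arg_max_def ex_bool_eq)
  consider "g False < g True" | "g True < g False" | "g True = g False" by linarith
  then show ?thesis
  proof cases
    case 1
    have "is_arg_max g (\<lambda>_. True) = (\<lambda>x. x)" unfolding fun_eq_iff eq using 1 by (auto simp: all_bool_eq)
    then show ?thesis using 1 someI[of "\<lambda>x. x" True] by (simp add: arg_max_def)
  next
    case 2
    have "is_arg_max g (\<lambda>_. True) = (\<lambda>x. \<not> x)" unfolding fun_eq_iff eq using 2 by (auto simp: all_bool_eq)
    then show ?thesis using 2 someI[of "\<lambda>x. \<not> x" False] by (simp add: arg_max_def)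
  next
    case 3
    have "is_arg_max g (\<lambda>_. True) = (\<lambda>x. True)" unfolding fun_eq_iff eq using 3 by (auto simp: all_bool_eq)
    then show ?thesis using 3 by (simp add: arg_max_def)
  qed
qed

lemma measurable_point_labels:
  assumes "\<And>m. Measurable.pred \<Omega> (\<lambda>\<omega>. want \<omega> m)" "\<And>m. Measurable.pred \<Omega> (\<lambda>\<omega>. infer \<omega> m)"
    and "\<And>m. Measurable.pred \<Omega> (\<lambda>\<omega>. Y \<omega> m)" "t \<in> measurable \<Omega> (count_space UNIV)"
  shows "(\<lambda>\<omega>. point_labels (want \<omega>) (infer \<omega>) cap (Y \<omega>) ms (t \<omega>)) \<in> measurable \<Omega> (count_space UNIV)"
  using assms(4)
proof (induction ms arbitrary: t)
  case Nil
  show ?case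
    using measurable_compose[OF Nil, of "\<lambda>t. (t, [])" "count_space UNIV"] by simp
next
  case (Cons m ms)
  note [measurable] = assms(1-3) Cons.prems
  define q where "q = (\<lambda>\<omega>. want \<omega> m \<and> t \<omega> < cap)"
  define y where "y = (\<lambda>\<omega>. if q \<omega> then Y \<omega> m else infer \<omega> m)"
  define r where "r = (\<lambda>\<omega>. point_labels (want \<omega>) (infer \<omega>) cap (Y \<omega>) ms (if q \<omega> then t \<omega> + 1 else t \<omega>))"
  have [measurable]: "Measurable.pred \<Omega> q" unfolding q_def by measurable
  have y: "Measurable.pred \<Omega> y" unfolding y_def by measurable
  have r: "r \<in> measurable \<Omega> (count_space UNIV)"
    unfolding r_def by (rule Cons.IH) measurable
  \<comment> \<open>\<open>r\<close> takes countably many values, so it may be treated as constant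
    while the new label is prepended.\<close>
  have "(\<lambda>\<omega>. (fst (r \<omega>), y \<omega> # snd (r \<omega>))) \<in> measurable \<Omega> (count_space UNIV)"
    by (rule measurable_compose_countable[OF _ r], rule measurable_compose[OF y]) simp
  also have "(\<lambda>\<omega>. (fst (r \<omega>), y \<omega> # snd (r \<omega>))) =
      (\<lambda>\<omega>. point_labels (want \<omega>) (infer \<omega>) cap (Y \<omega>) (m # ms) (t \<omega>))"
    by (simp add: fun_eq_iff r_def y_def q_def Let_def)
  finally show ?case .
qed

text \<open>The answers \<open>Y\<close> are an arbitrary measurable sequence, because an active
  algorithm has to be measurable jointly in the data and in all possible answers. For the risk,
  \<open>Y\<close> is specialized to \<open>f\<close> applied to \<open>X\<close>.\<close>

locale data_source = concepts M C for M :: "'a measure" and C :: "'a classifier set" +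
  fixes \<Omega> :: "'w measure" and X w w' :: "'w \<Rightarrow> nat \<Rightarrow> 'a" and Y :: "'w \<Rightarrow> nat \<Rightarrow> bool"
  assumes X [measurable]: "\<And>i. (\<lambda>\<omega>. X \<omega> i) \<in> measurable \<Omega> M"
    and w [measurable]: "\<And>i. (\<lambda>\<omega>. w \<omega> i) \<in> measurable \<Omega> M"
    and w' [measurable]: "\<And>i. (\<lambda>\<omega>. w' \<omega> i) \<in> measurable \<Omega> M"
    and Y [measurable]: "\<And>i. Measurable.pred \<Omega> (\<lambda>\<omega>. Y \<omega> i)"
begin

lemma pred_shatters_block:
  assumes z [measurable]: "z \<in> measurable \<Omega> M"
  shows "Measurable.pred \<Omega> (\<lambda>\<omega>. shatters (initial_space C m (X \<omega>) (Y \<omega>)) (block (w' \<omega>) k i))"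
    and "Measurable.pred \<Omega> (\<lambda>\<omega>. shatters (initial_space C m (X \<omega>) (Y \<omega>)) (block (w' \<omega>) k i @ [z \<omega>]))"
    and "Measurable.pred \<Omega> (\<lambda>\<omega>. shatters (restrict_label (initial_space C m (X \<omega>) (Y \<omega>)) (z \<omega>) b)
           (block (w' \<omega>) k i))"
proof -
  let ?gs = "map (\<lambda>i. ((\<lambda>\<omega>. X \<omega> i), (\<lambda>\<omega>. Y \<omega> i))) [1..<m + 1]"
  let ?qs = "map (\<lambda>i \<omega>. w' \<omega> i) [1 + (i - 1) * (k - 1)..<i * (k - 1) + 1]"
  have gs: "g \<in> measurable \<Omega> M \<and> Measurable.pred \<Omega> y" if "(g, y) \<in> set ?gs" for g y
    using that X Y by auto
  have qs: "q \<in> measurable \<Omega> M" if "q \<in> set ?qs" for q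
    using that w' by auto
  have gs': "g \<in> measurable \<Omega> M \<and> Measurable.pred \<Omega> y" if "(g, y) \<in> set (?gs @ [(z, \<lambda>_. b)])" for g y
    using that gs[of g y] z unfolding set_append by (auto simp del: upt_Suc)
  have qs': "q \<in> measurable \<Omega> M" if "q \<in> set (?qs @ [z])" for q
    using that qs[of q] z unfolding set_append by (auto simp del: upt_Suc)
  have eqs: "initial_space C m (X \<omega>) (Y \<omega>) = version_space C (map (\<lambda>(g, y). (g \<omega>, y \<omega>)) ?gs)"
    "block (w' \<omega>) k i = map (\<lambda>q. q \<omega>) ?qs" for \<omega>
    by (simp_all add: initial_space_def block_def comp_def del: upt_Suc)
  show "Measurable.pred \<Omega> (\<lambda>\<omega>. shatters (initial_space C m (X \<omega>) (Y \<omega>)) (block (w' \<omega>) k i))"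
    using pred_shatters_version_space[of ?gs \<Omega> ?qs, OF gs qs] by (simp add: eqs)
  show "Measurable.pred \<Omega> (\<lambda>\<omega>. shatters (initial_space C m (X \<omega>) (Y \<omega>)) (block (w' \<omega>) k i @ [z \<omega>]))"
    using pred_shatters_version_space[of ?gs \<Omega> "?qs @ [z]", OF gs qs'] by (simp only: eqs map_append list.map)
  show "Measurable.pred \<Omega> (\<lambda>\<omega>. shatters (restrict_label (initial_space C m (X \<omega>) (Y \<omega>)) (z \<omega>) b)
           (block (w' \<omega>) k i))"
    using pred_shatters_version_space[of "?gs @ [(z, \<lambda>_. b)]" \<Omega> ?qs, OF gs' qs]
    by (simp only: eqs restrict_label_version_space map_append list.map prod.case)
qed

lemma measurable_estimators:
  assumes z: "z \<in> measurable \<Omega> M"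
  shows "(\<lambda>\<omega>. Delta_hat_point (w' \<omega>) k j (z \<omega>) (initial_space C m (X \<omega>) (Y \<omega>))) \<in> borel_measurable \<Omega>"
    and "(\<lambda>\<omega>. Gamma_hat (w' \<omega>) k j (z \<omega>) b (initial_space C m (X \<omega>) (Y \<omega>))) \<in> borel_measurable \<Omega>"
proof -
  note [measurable] = pred_shatters_block[OF z]
  have [measurable]: "Measurable.pred \<Omega> (\<lambda>\<omega>. z \<omega> \<in> DIS (initial_space C m (X \<omega>) (Y \<omega>)))"
    using pred_shatters_block(2)[OF z, of m 1] by (simp add: DIS_iff_shatters)
  have [measurable]: "Measurable.pred \<Omega> (\<lambda>\<omega>. \<forall>h\<in>initial_space C m (X \<omega>) (Y \<omega>). h (z \<omega>) = b)"
    using pred_shatters_block(3)[OF z, of m "\<not> b" 1] by (simp only: block_1 unanimous_iff_shatters One_nat_def) measurable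
  show "(\<lambda>\<omega>. Delta_hat_point (w' \<omega>) k j (z \<omega>) (initial_space C m (X \<omega>) (Y \<omega>))) \<in> borel_measurable \<Omega>"
    unfolding Delta_hat_point_def shatter_count_def by measurable
  show "(\<lambda>\<omega>. Gamma_hat (w' \<omega>) k j (z \<omega>) b (initial_space C m (X \<omega>) (Y \<omega>))) \<in> borel_measurable \<Omega>"
    unfolding Gamma_hat_def shatter_count_def by measurable
qed

lemma measurable_wants_label [measurable]:
  "Measurable.pred \<Omega> (\<lambda>\<omega>. wants_label (X \<omega>) (w' \<omega>) k (initial_space C m (X \<omega>) (Y \<omega>)) j)"
  unfolding wants_label_def using measurable_estimators(1)[OF X] by measurable

lemma measurable_inferred_label [measurable]:
  "Measurable.pred \<Omega> (\<lambda>\<omega>. inferred_label (X \<omega>) (w' \<omega>) k (initial_space C m (X \<omega>) (Y \<omega>)) j)"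
proof -
  note [measurable] = measurable_estimators(2)[OF X]
  show ?thesis unfolding inferred_label_def arg_max_bool by measurable
qed

lemma measurable_sample_length [measurable]:
  "(\<lambda>\<omega>. sample_length n (w \<omega>) (w' \<omega>) (initial_space C m (X \<omega>) (Y \<omega>)) k) \<in> measurable \<Omega> (count_space UNIV)"
proof -
  note [measurable] = measurable_estimators(1)[OF w]
  show ?thesis unfolding sample_length_def Delta_hat_def by measurable
qed

lemma measurable_round_labels:
  assumes "t \<in> measurable \<Omega> (count_space UNIV)"
  shows "(\<lambda>\<omega>. round_labels n (X \<omega>, w \<omega>, w' \<omega>) (initial_space C m (X \<omega>) (Y \<omega>)) (Y \<omega>) ks (t \<omega>))
    \<in> measurable \<Omega> (count_space UNIV)"
  using assms
proof (induction ks arbitrary: t)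
  case Nil
  show ?case
    using measurable_compose[OF Nil, of "\<lambda>t. (t, [])" "count_space UNIV"] by simp
next
  case (Cons k ks)
  let ?V = "\<lambda>\<omega>. initial_space C m (X \<omega>) (Y \<omega>)"
  define r where "r = (\<lambda>\<omega>. point_labels (wants_label (X \<omega>) (w' \<omega>) k (?V \<omega>)) (inferred_label (X \<omega>) (w' \<omega>) k (?V \<omega>))
     (2 * n div 3) (Y \<omega>) [n div 3 + 1..<n div 3 + sample_length n (w \<omega>) (w' \<omega>) (?V \<omega>) k + 1] (t \<omega>))"
  have r: "r \<in> measurable \<Omega> (count_space UNIV)"
    unfolding r_def
    by (rule measurable_compose_countable[OF _ measurable_sample_length[of n m k]], rule measurable_point_labels)
      (use Cons.prems in measurable)
  define rr where "rr = (\<lambda>\<omega>. round_labels n (X \<omega>, w \<omega>, w' \<omega>) (?V \<omega>) (Y \<omega>) ks (fst (r \<omega>)))"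
  have rr: "rr \<in> measurable \<Omega> (count_space UNIV)"
    unfolding rr_def by (rule Cons.IH, rule measurable_compose[OF r]) simp
  have "(\<lambda>\<omega>. (fst (rr \<omega>), snd (r \<omega>) # snd (rr \<omega>))) \<in> measurable \<Omega> (count_space UNIV)"
    by (rule measurable_compose_countable[OF _ rr], rule measurable_compose[OF r]) simp
  then show ?case unfolding round_labels_Cons rr_def r_def .
qed

lemma measurable_round_lists:
  "(\<lambda>\<omega>. round_lists C N n (X \<omega>, w \<omega>, w' \<omega>) (Y \<omega>)) \<in> measurable \<Omega> (count_space UNIV)"
  unfolding round_lists_def fst_conv
  by (rule measurable_compose[OF measurable_round_labels]) auto

lemma measurable_round_length [measurable]:
  "(\<lambda>\<omega>. round_length C n (X \<omega>, w \<omega>, w' \<omega>) (Y \<omega>) k) \<in> measurable \<Omega> (count_space UNIV)"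
  unfolding round_length_def fst_conv snd_conv by (rule measurable_sample_length)

lemma measurable_select_start [measurable]:
  "(\<lambda>\<omega>. select_start C N n (X \<omega>, w \<omega>, w' \<omega>) (Y \<omega>)) \<in> measurable \<Omega> (count_space UNIV)"
proof -
  have *: "round_length C n (X \<omega>, w \<omega>, w' \<omega>) (Y \<omega>) ` {1..N}
      = {l. \<exists>k\<in>{1..N}. round_length C n (X \<omega>, w \<omega>, w' \<omega>) (Y \<omega>) k = l}" for \<omega>
    by auto
  show ?thesis unfolding select_start_def * by measurable
qed

lemma measurable_comparison:
  assumes h: "\<And>j z. j \<in> {1..N} \<Longrightarrow> z \<in> measurable \<Omega> M \<Longrightarrow> Measurable.pred \<Omega> (\<lambda>\<omega>. h \<omega> j (z \<omega>))"
    and [measurable]: "u \<in> measurable \<Omega> (count_space UNIV)" and jk: "j \<in> {1..N}" "k \<in> {1..N}"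
  shows "(\<lambda>\<omega>. comparison (X \<omega>) (Y \<omega>) (u \<omega>) l {x. h \<omega> j x \<noteq> h \<omega> k x} (h \<omega> k)) \<in> borel_measurable \<Omega>"
proof -
  have [measurable]: "Measurable.pred \<Omega> (\<lambda>\<omega>. h \<omega> j (X \<omega> i))" "Measurable.pred \<Omega> (\<lambda>\<omega>. h \<omega> k (X \<omega> i))" for i
    using h jk by auto
  show ?thesis unfolding comparison_def first_set_def mem_Collect_eq by measurable
qed

lemma measurable_selected:
  assumes h: "\<And>j z. j \<in> {1..N} \<Longrightarrow> z \<in> measurable \<Omega> M \<Longrightarrow> Measurable.pred \<Omega> (\<lambda>\<omega>. h \<omega> j (z \<omega>))"
    and u: "u \<in> measurable \<Omega> (count_space UNIV)"
  shows "(\<lambda>\<omega>. selected (h \<omega>) N m (X \<omega>) (Y \<omega>) (u \<omega>)) \<in> measurable \<Omega> (count_space UNIV)"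
  unfolding selected_def
proof (rule measurable_Max_nat)
  fix k
  show "Measurable.pred \<Omega> (\<lambda>\<omega>. k \<in> {1..N} \<and> (\<forall>j\<in>{1..<k}.
      comparison (X \<omega>) (Y \<omega>) (u \<omega>) (comparison_size N m j) {x. h \<omega> j x \<noteq> h \<omega> k x} (h \<omega> k) \<le> 7 / 12))"
  proof (cases "k \<in> {1..N}")
    case True
    have [measurable]: "(\<lambda>\<omega>. comparison (X \<omega>) (Y \<omega>) (u \<omega>) l {x. h \<omega> j x \<noteq> h \<omega> k x} (h \<omega> k)) \<in> borel_measurable \<Omega>"
      if "j \<in> {1..<k}" for j l
      using True that by (intro measurable_comparison[OF h u]) auto
    show ?thesis
      by (intro pred_intros_logic pred_intros_finite) measurable
  next
    case False
    then show ?thesis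
      by (simp only: simp_thms) (rule measurable_const, simp)
  qed
qed

lemma measurable_hypothesis:
  assumes A: "passive_algorithm M A"
    and s: "\<And>k. k \<in> {1..N} \<Longrightarrow> (\<lambda>\<omega>. s \<omega> k) \<in> measurable \<Omega> (pseeds A)"
    and k: "k \<in> {1..N}" and z [measurable]: "z \<in> measurable \<Omega> M"
  shows "Measurable.pred \<Omega> (\<lambda>\<omega>. hypothesis A C N n (s \<omega>) (X \<omega>, w \<omega>, w' \<omega>) (Y \<omega>) k (z \<omega>))"
  unfolding hypothesis_def Let_def fst_conv
proof (rule measurable_compose_countable[where g = "\<lambda>\<omega>. round_lists C N n (X \<omega>, w \<omega>, w' \<omega>) (Y \<omega>) ! (k - 1)"])
  show "(\<lambda>\<omega>. round_lists C N n (X \<omega>, w \<omega>, w' \<omega>) (Y \<omega>) ! (k - 1)) \<in> measurable \<Omega> (count_space UNIV)"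
    by (rule measurable_compose[OF measurable_round_lists]) simp
next
  fix bs :: "bool list"
  define q where "q = length bs"
  let ?m = "n div 3 + 1"
  have 1: "(\<lambda>\<omega>. (s \<omega> k, (\<lambda>i\<in>{..<q}. (X \<omega> (?m + i), bs ! i)), z \<omega>))
      \<in> measurable \<Omega> (pseeds A \<Otimes>\<^sub>M PiM {..<q} (\<lambda>_. M \<Otimes>\<^sub>M count_space UNIV) \<Otimes>\<^sub>M M)"
    by (intro measurable_Pair measurable_restrict s[OF k] X z) simp
  have 2: "(\<lambda>(r, z, x). plearn A r (map z [0..<q]) x)
            \<in> measurable (pseeds A \<Otimes>\<^sub>M PiM {..<q} (\<lambda>_. M \<Otimes>\<^sub>M count_space UNIV) \<Otimes>\<^sub>M M) (count_space UNIV)"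
    using A by (simp add: passive_algorithm_def)
  have "map (\<lambda>i\<in>{..<q}. (X \<omega> (?m + i), bs ! i)) [0..<q]
      = zip (map (X \<omega>) [n div 3 + 1..<n div 3 + length bs + 1]) bs" for \<omega>
    by (rule nth_equalityI) (auto simp: q_def simp del: upt_Suc)
  then show "Measurable.pred \<Omega> (\<lambda>\<omega>. plearn A (s \<omega> k) (zip (map (X \<omega>) [n div 3 + 1..<n div 3 + length bs + 1]) bs) (z \<omega>))"
    using measurable_compose[OF 1 2] by (simp del: upt_Suc)
qed

lemma measurable_output_index:
  assumes A: "passive_algorithm M A"
    and s: "\<And>k. k \<in> {1..N} \<Longrightarrow> (\<lambda>\<omega>. s \<omega> k) \<in> measurable \<Omega> (pseeds A)"
  shows "(\<lambda>\<omega>. output_index A C N n (s \<omega>) (X \<omega>, w \<omega>, w' \<omega>) (Y \<omega>)) \<in> measurable \<Omega> (count_space UNIV)"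
  unfolding output_index_def fst_conv
  by (rule measurable_selected[OF measurable_hypothesis[OF A s]]) auto

lemma measurable_output:
  assumes A: "passive_algorithm M A" and "1 \<le> N"
    and s: "\<And>k. k \<in> {1..N} \<Longrightarrow> (\<lambda>\<omega>. s \<omega> k) \<in> measurable \<Omega> (pseeds A)"
    and z: "z \<in> measurable \<Omega> M"
  shows "Measurable.pred \<Omega> (\<lambda>\<omega>. hypothesis A C N n (s \<omega>) (X \<omega>, w \<omega>, w' \<omega>) (Y \<omega>)
    (output_index A C N n (s \<omega>) (X \<omega>, w \<omega>, w' \<omega>) (Y \<omega>)) (z \<omega>))"
proof -
  have "output_index A C N n (s \<omega>) (X \<omega>, w \<omega>, w' \<omega>) (Y \<omega>) \<in> {1..N}" for \<omega>
    unfolding output_index_def by (rule selected_mem) fact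
  then have eq: "hypothesis A C N n (s \<omega>) (X \<omega>, w \<omega>, w' \<omega>) (Y \<omega>)
    (output_index A C N n (s \<omega>) (X \<omega>, w \<omega>, w' \<omega>) (Y \<omega>)) (z \<omega>) \<longleftrightarrow>
      (\<exists>k\<in>{1..N}. output_index A C N n (s \<omega>) (X \<omega>, w \<omega>, w' \<omega>) (Y \<omega>) = k \<and>
        hypothesis A C N n (s \<omega>) (X \<omega>, w \<omega>, w' \<omega>) (Y \<omega>) k (z \<omega>))" for \<omega>
    by auto
  note [measurable] = measurable_output_index[OF A s]
  show ?thesis
    unfolding eq
    by (intro pred_intros_finite pred_intros_logic measurable_hypothesis[OF A s _ z]) auto
qed

end

context concepts
begin

lemma active_meta_algorithm:
  "active_meta_algorithm M (meta_algorithm1 M C :: ('r, 'a) passive_alg \<Rightarrow> (nat \<Rightarrow> 'r, 'a) active_alg)"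
  unfolding active_meta_algorithm_def
proof (intro allI impI)
  fix A :: "('r, 'a) passive_alg" assume A: "passive_algorithm M A"
  define N where "N = the_enat (vc_dim M C) + 1"
  have seeds: "aseeds (meta_algorithm1 M C A) = PiM {1..N} (\<lambda>_. pseeds A)"
    by (simp add: meta_algorithm1_def N_def Let_def)
  interpret S: prob_space "pseeds A" using A by (simp add: passive_algorithm_def)
  have prob: "prob_space (PiM {1..N} (\<lambda>_. pseeds A))"
    by (rule prob_space_PiM) (rule S.prob_space_axioms)
  let ?\<Omega> = "PiM {1..N} (\<lambda>_. pseeds A) \<Otimes>\<^sub>M unlabeled_data M \<Otimes>\<^sub>M
      sequences (count_space (UNIV :: bool set)) \<Otimes>\<^sub>M M"
  interpret data_source M C ?\<Omega> "\<lambda>(s, U, Y, x). fst U" "\<lambda>(s, U, Y, x). fst (snd U)"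
      "\<lambda>(s, U, Y, x). snd (snd U)" "\<lambda>(s, U, Y, x). Y"
    by unfold_locales (unfold unlabeled_data_def sequences_def split_beta', measurable)
  have "Measurable.pred ?\<Omega> (\<lambda>\<omega>. hypothesis A C N n ((\<lambda>(s, U, Y, x). s) \<omega>)
        ((\<lambda>(s, U, Y, x). fst U) \<omega>, (\<lambda>(s, U, Y, x). fst (snd U)) \<omega>, (\<lambda>(s, U, Y, x). snd (snd U)) \<omega>)
        ((\<lambda>(s, U, Y, x). Y) \<omega>)
        (output_index A C N n ((\<lambda>(s, U, Y, x). s) \<omega>)
          ((\<lambda>(s, U, Y, x). fst U) \<omega>, (\<lambda>(s, U, Y, x). fst (snd U)) \<omega>, (\<lambda>(s, U, Y, x). snd (snd U)) \<omega>)
          ((\<lambda>(s, U, Y, x). Y) \<omega>))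
        ((\<lambda>(s, U, Y, x). x) \<omega>))" for n
    by (rule measurable_output[OF A]) (auto simp: N_def split_beta')
  then have "(\<lambda>(s, U, Y, x). run Y (alearn (meta_algorithm1 M C A) n s U) x)
      \<in> measurable ?\<Omega> (count_space UNIV)" for n
    unfolding run_meta_algorithm1 N_def[symmetric] by (simp add: split_beta')
  then show "active_algorithm M (meta_algorithm1 M C A)"
    unfolding active_algorithm_def seeds using prob num_requests_meta_algorithm1 by blast
qed

end

section \<open>Probabilities of shattering\<close>

lemma initial_space_eq_shift:
  "initial_space C m X (\<lambda>i. f (X i))
     = version_space C (map (\<lambda>j. (shift 1 X j, f (shift 1 X j))) [0..<m])"
proof -
  have "map (\<lambda>i. (X i, f (X i))) [1..<m + 1] = map (\<lambda>j. (shift 1 X j, f (shift 1 X j))) [0..<m]"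
    by (rule nth_equalityI) (auto simp: shift_def simp del: upt_Suc)
  then show ?thesis by (simp only: initial_space_def)
qed

lemma initial_space_mono:
  "m \<le> m' \<Longrightarrow> initial_space C m' X Y \<subseteq> initial_space C m X Y"
  by (auto simp: initial_space_def version_space_def simp del: upt_Suc)

lemma initial_space_cong:
  "(\<And>i. i \<in> {1..m} \<Longrightarrow> X i = X' i \<and> Y i = Y' i) \<Longrightarrow> initial_space C m X Y = initial_space C m X' Y'"
  by (auto simp: initial_space_def version_space_def simp del: upt_Suc)

locale problem = concepts M C + distribution P
  for M :: "'a measure" and C :: "'a classifier set" and P :: "'a measure" +
  fixes f :: "'a classifier"
  assumes f: "f \<in> C" and sets_P: "sets P = sets M"
begin

lemma space_P: "space P = space M"
  by (rule sets_eq_imp_space_eq) (rule sets_P)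

lemma measurable_into_P: "measurable \<Omega> P = measurable \<Omega> M"
  by (rule measurable_cong_sets) (simp_all add: sets_P)

lemma coordinate_measurable [measurable]: "(\<lambda>w. w i) \<in> measurable Q M"
  using component_measurable by (simp add: measurable_into_P)

lemma f_measurable [measurable]: "Measurable.pred M f"
  using f classifiers by (auto simp: classifiers_def)

lemma space_Q_M: "w \<in> space Q \<Longrightarrow> w i \<in> space M"
  by (simp add: space_Q space_P)

text \<open>In use \<open>xs\<close> is empty or one further point. The value at \<open>[x]\<close>
  divided by the value at \<open>[]\<close> is the conditional probability that a shattered random
  tuple stays shattered when \<open>x\<close> is appended.\<close>

definition shatter_prob :: "nat \<Rightarrow> 'a classifier set \<Rightarrow> 'a list \<Rightarrow> real" where
  "shatter_prob k H xs = \<P>(w in Q. shatters H (map w [0..<k] @ xs))"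

abbreviation V :: "nat \<Rightarrow> (nat \<Rightarrow> 'a) \<Rightarrow> 'a classifier set" where
  "V m X \<equiv> initial_space C m X (\<lambda>i. f (X i))"

lemma f_in_V: "f \<in> V m X"
  using f by (auto simp: initial_space_def version_space_def simp del: upt_Suc)

lemma shatter_prob_nonneg: "0 \<le> shatter_prob k H xs" and shatter_prob_le_1: "shatter_prob k H xs \<le> 1"
  by (simp_all add: shatter_prob_def)

text \<open>Sets of classifiers carry no sigma-algebra here, so a random set is encoded by what
  determines it: a fixed number of measurable points with measurable labels whose version space it
  is. Shattering events of such sets are measurable, and the encoding is stable under restriction by
  a label, under composition and under fixing \<open>\<omega>\<close>.\<close>

definition realized :: "'w measure \<Rightarrow> ('w \<Rightarrow> 'a classifier set) \<Rightarrow> bool" where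
  "realized \<Omega> H \<longleftrightarrow> (\<exists>gs. (\<forall>(g, y)\<in>set gs. g \<in> measurable \<Omega> M \<and> Measurable.pred \<Omega> y) \<and>
     (\<forall>\<omega>. H \<omega> = version_space C (map (\<lambda>(g, y). (g \<omega>, y \<omega>)) gs)))"

lemma realized_initial_space:
  assumes "\<And>i. (\<lambda>\<omega>. X \<omega> i) \<in> measurable \<Omega> M" "\<And>i. Measurable.pred \<Omega> (\<lambda>\<omega>. Y \<omega> i)"
  shows "realized \<Omega> (\<lambda>\<omega>. initial_space C m (X \<omega>) (Y \<omega>))"
  unfolding realized_def
  by (rule exI[of _ "map (\<lambda>i. ((\<lambda>\<omega>. X \<omega> i), (\<lambda>\<omega>. Y \<omega> i))) [1..<m + 1]"])
     (use assms in \<open>auto simp: initial_space_def comp_def simp del: upt_Suc\<close>)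

lemma realized_V:
  assumes X [measurable]: "\<And>i. (\<lambda>\<omega>. X \<omega> i) \<in> measurable \<Omega> M"
  shows "realized \<Omega> (\<lambda>\<omega>. V m (X \<omega>))"
  by (rule realized_initial_space) measurable

lemma realized_restrict_label:
  assumes "realized \<Omega> H" "x \<in> measurable \<Omega> M" "Measurable.pred \<Omega> y"
  shows "realized \<Omega> (\<lambda>\<omega>. restrict_label (H \<omega>) (x \<omega>) (y \<omega>))"
proof -
  obtain gs where gs: "\<forall>(g, y)\<in>set gs. g \<in> measurable \<Omega> M \<and> Measurable.pred \<Omega> y"
      "\<And>\<omega>. H \<omega> = version_space C (map (\<lambda>(g, y). (g \<omega>, y \<omega>)) gs)"
    using assms(1) by (auto simp: realized_def)
  show ?thesis
    unfolding realized_def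
    by (rule exI[of _ "gs @ [(x, y)]"]) (use gs assms(2,3) in \<open>auto simp: restrict_label_version_space\<close>)
qed

text \<open>Conditioning on the data: once \<open>\<omega>\<close> is fixed, the random version
  space becomes a constant one on any other space.\<close>

lemma realized_const:
  assumes "realized \<Omega> H" "\<omega> \<in> space \<Omega>"
  shows "realized \<Omega>' (\<lambda>_. H \<omega>)"
proof -
  obtain gs where gs: "\<forall>(g, y)\<in>set gs. g \<in> measurable \<Omega> M \<and> Measurable.pred \<Omega> y"
      "\<And>\<omega>. H \<omega> = version_space C (map (\<lambda>(g, y). (g \<omega>, y \<omega>)) gs)"
    using assms(1) by (auto simp: realized_def)
  show ?thesis
    unfolding realized_def
    by (rule exI[of _ "map (\<lambda>(g, y). ((\<lambda>_. g \<omega>), (\<lambda>_. y \<omega>))) gs"])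
      (use gs assms(2) in \<open>auto simp: comp_def split_beta' dest!: bspec intro: measurable_space\<close>)
qed

lemma realized_compose:
  assumes "realized \<Omega> H" "g \<in> measurable \<Omega>' \<Omega>"
  shows "realized \<Omega>' (\<lambda>\<omega>. H (g \<omega>))"
proof -
  obtain gs where gs: "\<forall>(g, y)\<in>set gs. g \<in> measurable \<Omega> M \<and> Measurable.pred \<Omega> y"
      "\<And>\<omega>. H \<omega> = version_space C (map (\<lambda>(g, y). (g \<omega>, y \<omega>)) gs)"
    using assms(1) by (auto simp: realized_def)
  show ?thesis
    unfolding realized_def
    by (rule exI[of _ "map (\<lambda>(h, y). ((\<lambda>\<omega>. h (g \<omega>)), (\<lambda>\<omega>. y (g \<omega>)))) gs"])
      (use gs assms(2) in \<open>auto simp: comp_def split_beta' dest!: bspec intro: measurable_compose\<close>)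
qed

lemma pred_shatters_realized:
  assumes "realized \<Omega> H" "\<And>q. q \<in> set qs \<Longrightarrow> q \<in> measurable \<Omega> M"
  shows "Measurable.pred \<Omega> (\<lambda>\<omega>. shatters (H \<omega>) (map (\<lambda>q. q \<omega>) qs))"
proof -
  obtain gs where gs: "\<forall>(g, y)\<in>set gs. g \<in> measurable \<Omega> M \<and> Measurable.pred \<Omega> y"
      "\<And>\<omega>. H \<omega> = version_space C (map (\<lambda>(g, y). (g \<omega>, y \<omega>)) gs)"
    using assms(1) by (auto simp: realized_def)
  show ?thesis
    unfolding gs(2) by (rule pred_shatters_version_space) (use gs(1) assms(2) in auto)
qed

lemma pred_shatters_points:
  assumes "realized \<Omega> H" "\<And>i. (\<lambda>\<omega>. w \<omega> i) \<in> measurable \<Omega> M" "\<And>q. q \<in> set qs \<Longrightarrow> q \<in> measurable \<Omega> M"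
  shows "Measurable.pred \<Omega> (\<lambda>\<omega>. shatters (H \<omega>) (map (w \<omega>) is @ map (\<lambda>q. q \<omega>) qs))"
proof -
  have "Measurable.pred \<Omega> (\<lambda>\<omega>. shatters (H \<omega>) (map (\<lambda>q. q \<omega>) (map (\<lambda>i \<omega>. w \<omega> i) is @ qs)))"
    by (rule pred_shatters_realized) (use assms in auto)
  then show ?thesis by (simp add: comp_def)
qed

lemma pred_shatters_Q:
  assumes "realized (count_space UNIV :: unit measure) (\<lambda>_. H)" "set xs \<subseteq> space M"
  shows "Measurable.pred Q (\<lambda>w. shatters H (map w is @ xs))"
proof -
  have "realized Q (\<lambda>_. H)" using realized_const[OF assms(1), of "()" Q] by simp
  moreover have "q \<in> measurable Q M" if "q \<in> set (map (\<lambda>x _. x) xs)" for q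
    using that assms(2) by auto
  ultimately show ?thesis
    using pred_shatters_points[of Q "\<lambda>_. H" "\<lambda>w. w" "map (\<lambda>x _. x) xs" "is"] by (simp add: comp_def)
qed

lemma measurable_shatter_prob:
  assumes H: "realized \<Omega> H" and qs: "\<And>q. q \<in> set qs \<Longrightarrow> q \<in> measurable \<Omega> M"
  shows "(\<lambda>\<omega>. shatter_prob k (H \<omega>) (map (\<lambda>q. q \<omega>) qs)) \<in> borel_measurable \<Omega>"
proof -
  have *: "Measurable.pred (\<Omega> \<Otimes>\<^sub>M Q) (\<lambda>z. shatters (H (fst z)) (map (snd z) [0..<k] @ map (\<lambda>q. q z) (map (\<lambda>q z. q (fst z)) qs)))"
    by (rule pred_shatters_points[OF realized_compose[OF H]]) (use qs in auto)
  show ?thesis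
    unfolding shatter_prob_def
  proof (rule Q.measurable_measure)
    show "{z \<in> space (\<Omega> \<Otimes>\<^sub>M Q). snd z \<in> {w \<in> space Q. shatters (H (fst z)) (map w [0..<k] @ map (\<lambda>q. q (fst z)) qs)}}
        \<in> sets (\<Omega> \<Otimes>\<^sub>M Q)"
    proof -
      have "{z \<in> space (\<Omega> \<Otimes>\<^sub>M Q). snd z \<in> {w \<in> space Q. shatters (H (fst z)) (map w [0..<k] @ map (\<lambda>q. q (fst z)) qs)}}
        = {z \<in> space (\<Omega> \<Otimes>\<^sub>M Q). shatters (H (fst z)) (map (snd z) [0..<k] @ map (\<lambda>q. q z) (map (\<lambda>q z. q (fst z)) qs))}"
        by (auto simp: space_pair_measure comp_def)
      then show ?thesis using * by (simp only: pred_def)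
    qed
  qed auto
qed

text \<open>A deterministic version space, seen as a random one on the one-point space
  \<open>unit\<close>.\<close>

abbreviation fixed_space :: "'a classifier set \<Rightarrow> bool" where
  "fixed_space H \<equiv> realized (count_space UNIV :: unit measure) (\<lambda>_. H)"

lemma fixed_space_V: "X \<in> space Q \<Longrightarrow> fixed_space (V m X)"
  by (rule realized_const[OF realized_V[of "\<lambda>X. X" Q]]) auto

lemma fixed_space_restrict_V: "X \<in> space Q \<Longrightarrow> x \<in> space M \<Longrightarrow> fixed_space (restrict_label (V m X) x y)"
  by (rule realized_restrict_label[OF fixed_space_V]) auto

lemma fixed_space_on: "fixed_space H \<Longrightarrow> realized \<Omega> (\<lambda>_. H)"
  by (rule realized_const[of _ "\<lambda>_. H"]) auto

lemma shatter_prob_mono: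
  assumes "fixed_space H'" "set xs \<subseteq> space M" "H \<subseteq> H'"
  shows "shatter_prob k H xs \<le> shatter_prob k H' xs"
  unfolding shatter_prob_def
  by (rule Q.finite_measure_mono)
     (use pred_shatters_Q[OF assms(1,2), of "[0..<k]"] shatters_mono assms(3) in \<open>auto simp: pred_def\<close>)

lemma shatter_prob_Suc_le:
  assumes "fixed_space H"
  shows "shatter_prob (Suc k) H [] \<le> shatter_prob k H []"
  unfolding shatter_prob_def
  by (rule Q.finite_measure_mono)
     (use pred_shatters_Q[OF assms(1), of "[]" "[0..<k]"] in \<open>auto simp: pred_def dest: shatters_appendD\<close>)

lemma shatter_prob_antimono:
  assumes "fixed_space H" "k \<le> k'"
  shows "shatter_prob k' H [] \<le> shatter_prob k H []"
  using assms(2) by (induction rule: dec_induct) (auto intro: order_trans[OF shatter_prob_Suc_le[OF assms(1)]])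

lemma shatter_prob_0: "H \<noteq> {} \<Longrightarrow> shatter_prob 0 H [] = 1"
  by (simp add: shatter_prob_def Q.prob_space)

text \<open>Markov's inequality: by Fubini the mean of \<open>shatter_prob k H [x]\<close> over a
  random \<open>x\<close> is \<open>shatter_prob (Suc k) H []\<close>. It later bounds the share of
  points whose labels may be requested.\<close>

lemma shatter_prob_markov:
  assumes H: "fixed_space H" and r: "0 \<le> r"
  shows "r * \<P>(w in Q. r \<le> shatter_prob k H [w 0]) \<le> shatter_prob (Suc k) H []"
proof -
  have [measurable]: "(\<lambda>w. shatter_prob k H [w 0]) \<in> borel_measurable Q"
    using measurable_shatter_prob[OF fixed_space_on[OF H, of Q], of "[\<lambda>w. w 0]" k] by simp
  have [measurable]: "Measurable.pred Q (\<lambda>v. shatters H (map v [0..<Suc k]))"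
    using pred_shatters_Q[OF H, of "[]" "[0..<Suc k]"] by simp
  have meas1: "Measurable.pred Q (\<lambda>v. shatters H (map v [0..<k] @ [x]))" if "x \<in> space M" for x
    using pred_shatters_Q[OF H, of "[x]" "[0..<k]"] that by simp
  have "ennreal (r * \<P>(w in Q. r \<le> shatter_prob k H [w 0]))
      = (\<integral>\<^sup>+ w. ennreal r * (if r \<le> shatter_prob k H [w 0] then 1 else 0) \<partial>Q)"
    using r by (subst nn_integral_cmult, measurable) (simp add: ennreal_mult' measure_eq_nn_integral)
  also have "\<dots> \<le> (\<integral>\<^sup>+ w. ennreal (shatter_prob k H [w 0]) \<partial>Q)"
    by (intro nn_integral_mono) (auto intro: ennreal_leI)
  also have "\<dots> = (\<integral>\<^sup>+ w. \<integral>\<^sup>+ v. (if shatters H (map v [0..<k] @ [w 0]) then 1 else 0) \<partial>Q \<partial>Q)"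
    unfolding shatter_prob_def
    by (intro nn_integral_cong measure_eq_nn_integral meas1 space_Q_M)
  \<comment> \<open>After the exchange the \<open>k\<close> points are drawn first and the further
    point last, as in \<open>comb_seq k v w\<close>.\<close>
  also have "\<dots> = (\<integral>\<^sup>+ v. \<integral>\<^sup>+ w. (if shatters H (map v [0..<k] @ [w 0]) then 1 else 0) \<partial>Q \<partial>Q)"
  proof -
    interpret QQ: pair_sigma_finite Q Q ..
    have "Measurable.pred (Q \<Otimes>\<^sub>M Q) (\<lambda>z. shatters H (map (fst z) [0..<k] @ [snd z 0]))"
      using pred_shatters_points[OF fixed_space_on[OF H], of fst "Q \<Otimes>\<^sub>M Q" "[\<lambda>z. snd z 0]"] by simp
    then show ?thesis
      by (intro QQ.Fubini') (simp add: split_beta')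
  qed
  also have "\<dots> = (\<integral>\<^sup>+ v. \<integral>\<^sup>+ w. (if shatters H (map (comb_seq k v w) [0..<Suc k]) then 1 else 0) \<partial>Q \<partial>Q)"
  proof -
    have "map (comb_seq k v w) [0..<Suc k] = map v [0..<k] @ [w 0]" for v w :: "nat \<Rightarrow> 'a"
      by (auto simp: comb_seq_def)
    then show ?thesis by (simp only:)
  qed
  also have "\<dots> = (\<integral>\<^sup>+ v. (if shatters H (map v [0..<Suc k]) then 1 else 0) \<partial>Q)"
    by (rule nn_integral_comb_seq[symmetric]) measurable
  also have "\<dots> = ennreal (shatter_prob (Suc k) H [])"
    unfolding shatter_prob_def by (subst measure_eq_nn_integral) (simp_all del: upt_Suc)
  finally show ?thesis using shatter_prob_nonneg by (simp add: ennreal_le_iff)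
qed

section \<open>Limits of the shattering probabilities\<close>

text \<open>
  The essential infimum over all samples; it replaces the limit of the shattering probabilities of
  small balls around the target function.
\<close>

definition limit_prob :: "nat \<Rightarrow> real" where
  "limit_prob k = Inf {r. 0 \<le> r \<and> (\<exists>a. 0 < \<P>(X in Q. shatter_prob k (V a X) [] \<le> r))}"

lemma measurable_shatter_prob_V [measurable]:
  "(\<lambda>X. shatter_prob k (V a X) []) \<in> borel_measurable Q"
  using measurable_shatter_prob[OF realized_V[of "\<lambda>X. X" Q], of "[]"] by simp

lemma limit_prob_set:
  shows "bdd_below {r. 0 \<le> r \<and> (\<exists>a. 0 < \<P>(X in Q. shatter_prob k (V a X) [] \<le> r))}"
    and "1 \<in> {r. 0 \<le> r \<and> (\<exists>a. 0 < \<P>(X in Q. shatter_prob k (V a X) [] \<le> r))}"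
  by (auto intro!: bdd_belowI[of _ 0] simp: shatter_prob_le_1 Q.prob_space)

lemma limit_prob_nonneg: "0 \<le> limit_prob k"
  unfolding limit_prob_def using limit_prob_set(2) by (intro cInf_greatest) blast+

text \<open>By definition of the infimum, a nonnegative level below \<open>limit_prob k\<close> is
  reached only on a null set. The levels \<open>limit_prob k - inverse (Suc j)\<close> and the
  sample sizes \<open>a\<close> are countably many, so a single null set serves all of them.\<close>

lemma AE_limit_prob_le: "AE X in Q. \<forall>a. limit_prob k \<le> shatter_prob k (V a X) []"
  unfolding AE_all_countable
proof
  fix a
  have "AE X in Q. limit_prob k - inverse (real (Suc j)) < shatter_prob k (V a X) []" for j
  proof -
    define r where "r = limit_prob k - inverse (real (Suc j))"
    have "r < limit_prob k" by (simp add: r_def)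
    then have *: "\<not> (0 \<le> r \<and> 0 < \<P>(X in Q. shatter_prob k (V a X) [] \<le> r))"
      using cInf_lower[OF CollectI limit_prob_set(1), of r k] unfolding limit_prob_def[symmetric]
      by fastforce
    show ?thesis
    proof (cases "0 \<le> r")
      case True
      then have "\<P>(X in Q. shatter_prob k (V a X) [] \<le> r) = 0"
        using * by (simp add: zero_less_measure_iff)
      then have "AE X in Q. \<not> shatter_prob k (V a X) [] \<le> r"
        by (subst (asm) Q.prob_eq_0) auto
      then show ?thesis by (simp add: r_def not_le)
    next
      case False
      then show ?thesis
        using shatter_prob_nonneg by (intro AE_I2) (smt (verit) r_def)
    qed
  qed
  then have "AE X in Q. \<forall>j. limit_prob k - inverse (real (Suc j)) < shatter_prob k (V a X) []"
    by (simp add: AE_all_countable)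
  then show "AE X in Q. limit_prob k \<le> shatter_prob k (V a X) []"
  proof (rule AE_mp, intro AE_I2 impI)
    fix X assume *: "\<forall>j. limit_prob k - inverse (real (Suc j)) < shatter_prob k (V a X) []"
    show "limit_prob k \<le> shatter_prob k (V a X) []"
    proof (rule field_le_epsilon)
      fix e :: real assume "0 < e"
      then obtain j where "inverse (real (Suc j)) < e" using reals_Archimedean by blast
      then show "limit_prob k \<le> shatter_prob k (V a X) [] + e" using *[rule_format, of j] by simp
    qed
  qed
qed

text \<open>The empty tuple is shattered by every nonempty set, and \<open>f\<close> lies in every
  version space. Consequently the least \<open>k\<close> with \<open>limit_prob k = 0\<close> is
  positive.\<close>

lemma limit_prob_0: "0 < limit_prob 0"
proof -
  have "1 \<le> limit_prob 0"
    unfolding limit_prob_def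
  proof (rule cInf_greatest)
    fix r assume "r \<in> {r. 0 \<le> r \<and> (\<exists>a. 0 < \<P>(X in Q. shatter_prob 0 (V a X) [] \<le> r))}"
    then obtain a where *: "0 < \<P>(X in Q. shatter_prob 0 (V a X) [] \<le> r)" by auto
    have "shatter_prob 0 (V a X) [] = 1" for X
      using f_in_V by (intro shatter_prob_0) auto
    then show "1 \<le> r" using * by (cases "1 \<le> r") auto
  qed (use limit_prob_set(2) in blast)
  then show ?thesis by simp
qed

text \<open>The empty sample already gives the value 0: its version space is \<open>C\<close>, which
  shatters no \<open>d + 1\<close> points of the space.\<close>

lemma limit_prob_beyond_vc_dim:
  assumes "vc_dim M C = enat d"
  shows "limit_prob (Suc d) = 0"
proof -
  have "\<not> shatters (V 0 X) (map w [0..<Suc d])" if "w \<in> space Q" for w X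
  proof
    assume "shatters (V 0 X) (map w [0..<Suc d])"
    then have "shatters C (map w [0..<Suc d])"
      by (rule shatters_mono) (auto simp: initial_space_def version_space_def)
    moreover have "set (map w [0..<Suc d]) \<subseteq> space M"
      using space_Q_M[OF that] by auto
    ultimately have "enat (length (map w [0..<Suc d])) \<le> vc_dim M C"
      unfolding vc_dim_def by (intro Sup_upper) blast
    then show False using assms by simp
  qed
  then have "shatter_prob (Suc d) (V 0 X) [] = 0" for X
    unfolding shatter_prob_def by (simp del: upt_Suc) (metis (no_types, lifting) Collect_empty_eq measure_empty)
  then have "limit_prob (Suc d) \<le> 0"
    unfolding limit_prob_def
    by (intro cInf_lower limit_prob_set(1)) (auto intro!: exI[of _ 0] simp: Q.prob_space)
  then show ?thesis using limit_prob_nonneg[of "Suc d"] by simp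
qed

text \<open>
  A version space is contained in those of the blocks of \<open>a\<close> points of its sample, which are independent.
\<close>

lemma shatter_prob_tail:
  assumes "limit_prob k < r"
  obtains a q where "0 < a" "0 \<le> q" "q < 1"
    "\<And>m. \<P>(X in Q. r < shatter_prob k (V m X) []) \<le> q ^ (m div a)"
proof -
  obtain r' a0 where r': "r' < r" "0 < \<P>(X in Q. shatter_prob k (V a0 X) [] \<le> r')"
    using cInf_lessD[OF _ assms[unfolded limit_prob_def]] limit_prob_set(2) by blast
  \<comment> \<open>\<open>Suc\<close> makes the block length positive, so that
    \<open>m div a\<close> counts whole blocks. A larger sample only lowers the probability, so the
    level \<open>r\<close> is met with positive probability at size \<open>a\<close> as well, and
    \<open>q < 1\<close>.\<close>
  define a where "a = Suc a0"
  define q where "q = \<P>(X in Q. r < shatter_prob k (V a X) [])"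
  have "\<P>(X in Q. shatter_prob k (V a0 X) [] \<le> r')
      \<le> \<P>(X in Q. shatter_prob k (V a X) [] \<le> r)"
  proof (rule Q.finite_measure_mono)
    show "{X \<in> space Q. shatter_prob k (V a0 X) [] \<le> r'} \<subseteq> {X \<in> space Q. shatter_prob k (V a X) [] \<le> r}"
    proof safe
      fix X assume X: "X \<in> space Q" "shatter_prob k (V a0 X) [] \<le> r'"
      have "shatter_prob k (V a X) [] \<le> shatter_prob k (V a0 X) []"
        by (rule shatter_prob_mono[OF fixed_space_V[OF X(1)] _ initial_space_mono]) (auto simp: a_def)
      then show "shatter_prob k (V a X) [] \<le> r" using X r' by simp
    qed
  qed measurable
  then have "0 < \<P>(X in Q. shatter_prob k (V a X) [] \<le> r)" using r' by simp
  moreover have "q = 1 - \<P>(X in Q. shatter_prob k (V a X) [] \<le> r)"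
    unfolding q_def using Q.prob_neg[of "\<lambda>X. shatter_prob k (V a X) [] \<le> r"] by (simp add: not_le)
  ultimately have "q < 1" by simp
  define T where "T = (\<lambda>X. r < shatter_prob k (version_space C (map (\<lambda>j. (X j, f (X j))) [0..<a])) [])"
  have real_T: "realized Q (\<lambda>X. version_space C (map (\<lambda>j. (X j, f (X j))) [0..<a]))"
    unfolding realized_def
    by (rule exI[of _ "map (\<lambda>i. ((\<lambda>X. X i), (\<lambda>X. f (X i)))) [0..<a]"]) (auto simp: comp_def)
  have T [measurable]: "Measurable.pred Q T"
    unfolding T_def using measurable_shatter_prob[OF real_T, of "[]"] by simp
  have q_T: "q = \<P>(X in Q. T X)"
    unfolding q_def measure_shift[OF T, of 1, symmetric] by (simp add: T_def initial_space_eq_shift)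
  have "\<P>(X in Q. r < shatter_prob k (V m X) []) \<le> q ^ (m div a)" for m
  proof -
    have "\<P>(X in Q. r < shatter_prob k (V m X) []) \<le>
        \<P>(X in Q. \<forall>i<m div a. T (shift (i * a) (shift 1 X)))"
    proof (rule Q.finite_measure_mono)
      show "{X \<in> space Q. r < shatter_prob k (V m X) []} \<subseteq>
          {X \<in> space Q. \<forall>i<m div a. T (shift (i * a) (shift 1 X))}"
      proof safe
        fix X i assume X: "X \<in> space Q" "r < shatter_prob k (V m X) []" and i: "i < m div a"
        have "shift (i * a) (shift 1 X) \<in> space Q" using X by (auto simp: space_Q shift_def)
        then have fixed: "fixed_space (version_space C (map (\<lambda>j. (shift (i * a) (shift 1 X) j, f (shift (i * a) (shift 1 X) j))) [0..<a]))"
          by (rule realized_const[OF real_T])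
        have "i * a + a \<le> m"
          using i by (metis Suc_leI add.commute div_times_less_eq_dividend dual_order.trans mult_Suc mult_le_mono1)
        then have "V m X \<subseteq> version_space C (map (\<lambda>j. (shift (i * a) (shift 1 X) j, f (shift (i * a) (shift 1 X) j))) [0..<a])"
          by (auto simp: initial_space_def version_space_def shift_def simp del: upt_Suc)
        then show "T (shift (i * a) (shift 1 X))"
          unfolding T_def using shatter_prob_mono[OF fixed, of "[]" "V m X" k] X by simp
      qed
    qed measurable
    also have "\<dots> = \<P>(X in Q. \<forall>i<m div a. T (shift (i * a) X))"
      using measure_shift[of "\<lambda>X. \<forall>i<m div a. T (shift (i * a) X)" 1] by simp
    also have "\<dots> = q ^ (m div a)"
      unfolding q_T
    proof (rule measure_all_blocks[OF T])
      fix v w :: "nat \<Rightarrow> 'a" assume "\<And>j. j < a \<Longrightarrow> v j = w j"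
      then have "map (\<lambda>j. (v j, f (v j))) [0..<a] = map (\<lambda>j. (w j, f (w j))) [0..<a]" by simp
      then show "T v = T w" by (simp only: T_def)
    qed
    finally show ?thesis .
  qed
  then show thesis using that[of a q] \<open>q < 1\<close> by (simp add: a_def q_def)
qed

end

lemma length_filter_upt: "length (filter \<phi> [a + 1..<a + l + 1]) = card {j \<in> {a + 1..a + l}. \<phi> j}"
proof -
  have "set (filter \<phi> [a + 1..<a + l + 1]) = {j \<in> {a + 1..a + l}. \<phi> j}" by auto
  then show ?thesis by (metis distinct_card distinct_filter distinct_upt)
qed

text \<open>\<open>t'\<close> is the counter at the start of the round; each earlier round has
  raised it by at most the number of its wanted labels.\<close>

lemma round_labels_nth:
  assumes "i < length ks"
  shows "\<exists>t'\<le>t + (\<Sum>i'<i. card {j \<in> {n div 3 + 1..n div 3 + sample_length n w w' V (ks ! i')}. wants_label X w' (ks ! i') V j}).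
    snd (round_labels n (X, w, w') V Y ks t) ! i =
      snd (point_labels (wants_label X w' (ks ! i) V) (inferred_label X w' (ks ! i) V) (2 * n div 3) Y
        [n div 3 + 1..<n div 3 + sample_length n w w' V (ks ! i) + 1] t')"
  using assms
proof (induction ks arbitrary: t i)
  case (Cons k ks)
  define c where "c = (\<lambda>k. card {j \<in> {n div 3 + 1..n div 3 + sample_length n w w' V k}. wants_label X w' k V j})"
  define r where "r = point_labels (wants_label X w' k V) (inferred_label X w' k V) (2 * n div 3) Y
     [n div 3 + 1..<n div 3 + sample_length n w w' V k + 1] t"
  have r: "fst r \<le> t + c k"
    unfolding r_def c_def length_filter_upt[symmetric] by (rule point_labels_requests)
  show ?case
  proof (cases i)
    case 0
    then show ?thesis unfolding round_labels_Cons by (intro exI[of _ t]) simp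
  next
    case (Suc i')
    obtain t' where t': "t' \<le> fst r + (\<Sum>i<i'. c (ks ! i))"
      "snd (round_labels n (X, w, w') V Y ks (fst r)) ! i' =
      snd (point_labels (wants_label X w' (ks ! i') V) (inferred_label X w' (ks ! i') V) (2 * n div 3) Y
        [n div 3 + 1..<n div 3 + sample_length n w w' V (ks ! i') + 1] t')"
      using Cons.IH[of i' "fst r"] Cons.prems Suc unfolding c_def by auto
    have "(\<Sum>i<Suc i'. c ((k # ks) ! i)) = c k + (\<Sum>i<i'. c (ks ! i))"
      by (simp add: sum.lessThan_Suc_shift del: sum.lessThan_Suc)
    then have "t' \<le> t + (\<Sum>i<i. c ((k # ks) ! i))" using t'(1) r Suc by simp
    then show ?thesis
      unfolding round_labels_Cons c_def r_def[symmetric]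
      by (intro exI[of _ t']) (simp add: Suc t'(2))
  qed
qed simp

context problem
begin

section \<open>Concentration of the estimators\<close>

definition deviates :: "real \<Rightarrow> (nat \<Rightarrow> 'a) \<Rightarrow> nat \<Rightarrow> nat \<Rightarrow> 'a classifier set \<Rightarrow> 'a list \<Rightarrow> bool" where
  "deviates \<sigma> w' k N H xs \<longleftrightarrow>
     \<sigma> * N < \<bar>real (card {i \<in> {1..N}. shatters H (block w' k i @ xs)}) - shatter_prob (k - 1) H xs * N\<bar>"

text \<open>\<open>H\<close> and \<open>xs\<close> are fixed here. In use they depend only on
  \<open>X\<close> and \<open>w\<close>, which are independent of \<open>w'\<close>, so Hoeffding's
  bound applies conditionally; this takes the place of a bound uniform in \<open>H\<close>.\<close>

lemma prob_deviates:
  assumes H: "fixed_space H" and xs: "set xs \<subseteq> space M" and "0 < \<sigma>"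
  shows "measure Q {w' \<in> space Q. deviates \<sigma> w' k N H xs} \<le> 2 * exp (- 2 * \<sigma>\<^sup>2 * N)"
proof -
  let ?T = "\<lambda>w. shatters H (map w [0..<k - 1] @ xs)"
  have T [measurable]: "Measurable.pred Q ?T" by (rule pred_shatters_Q[OF H xs])
  have dep: "?T v = ?T w" if "\<And>j. j < k - 1 \<Longrightarrow> v j = w j" for v w
  proof -
    have "map v [0..<k - 1] = map w [0..<k - 1]" using that by simp
    then show ?thesis by (simp only:)
  qed
  have eq: "deviates \<sigma> w' k N H xs \<longleftrightarrow> \<sigma> * N < \<bar>real (card {i \<in> {..<N}. ?T (shift (i * (k - 1)) (shift 1 w'))})
      - \<P>(w in Q. ?T w) * N\<bar>" for w'
    unfolding deviates_def card_blocks_eq[where \<phi> = "\<lambda>l. shatters H (l @ xs)"] shatter_prob_def by (rule refl)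
  let ?\<phi> = "\<lambda>w'. \<sigma> * N < \<bar>real (card {i \<in> {..<N}. ?T (shift (i * (k - 1)) w')})
      - \<P>(w in Q. ?T w) * N\<bar>"
  have "measure Q {w' \<in> space Q. ?\<phi> (shift 1 w')} = measure Q {w' \<in> space Q. ?\<phi> w'}"
    by (rule measure_shift) measurable
  also have "\<dots> \<le> 2 * exp (- 2 * \<sigma>\<^sup>2 * N)"
    by (rule hoeffding_blocks[OF T dep \<open>0 < \<sigma>\<close>])
  finally show ?thesis unfolding eq .
qed

lemma pred_deviates:
  assumes H: "realized \<Omega> H" and w': "\<And>i. (\<lambda>\<omega>. w' \<omega> i) \<in> measurable \<Omega> M"
    and qs: "\<And>q. q \<in> set qs \<Longrightarrow> q \<in> measurable \<Omega> M"
  shows "Measurable.pred \<Omega> (\<lambda>\<omega>. deviates \<sigma> (w' \<omega>) k N (H \<omega>) (map (\<lambda>q. q \<omega>) qs))"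
proof -
  note [measurable] = measurable_shatter_prob[OF H qs]
  have [measurable]: "Measurable.pred \<Omega> (\<lambda>\<omega>. shatters (H \<omega>) (block (w' \<omega>) k i @ map (\<lambda>q. q \<omega>) qs))" for i
    unfolding block_def by (rule pred_shatters_points[OF H w' qs])
  show ?thesis unfolding deviates_def by measurable
qed

text \<open>A lower bound \<open>c\<close> on the conditional probability that a shattered
  \<open>(k - 1)\<close>-tuple stays shattered with \<open>x\<close> appended, stated without
  division. The thresholds \<open>1 / 2\<close> and \<open>1 / 8\<close> of the algorithm are
  compared with it at \<open>c = 1 / 4\<close> and \<open>c = 1 / 16\<close>.\<close>

definition big :: "real \<Rightarrow> nat \<Rightarrow> 'a classifier set \<Rightarrow> 'a \<Rightarrow> bool" where
  "big c k H x \<longleftrightarrow> c * shatter_prob (k - 1) H [] \<le> shatter_prob (k - 1) H [x]"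

definition big_prob :: "real \<Rightarrow> nat \<Rightarrow> 'a classifier set \<Rightarrow> real" where
  "big_prob c k H = \<P>(w in Q. big c k H (w 0))"

lemma pred_big:
  assumes H: "realized \<Omega> H" and x: "x \<in> measurable \<Omega> M"
  shows "Measurable.pred \<Omega> (\<lambda>\<omega>. big c k (H \<omega>) (x \<omega>))"
proof -
  have [measurable]: "(\<lambda>\<omega>. shatter_prob (k - 1) (H \<omega>) []) \<in> borel_measurable \<Omega>"
    "(\<lambda>\<omega>. shatter_prob (k - 1) (H \<omega>) [x \<omega>]) \<in> borel_measurable \<Omega>"
    using measurable_shatter_prob[OF H, of "[]"] measurable_shatter_prob[OF H, of "[x]"] x by auto
  show ?thesis unfolding big_def by measurable
qed

lemma pred_big_Q: "fixed_space H \<Longrightarrow> Measurable.pred Q (\<lambda>w. big c k H (w i))"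
  using pred_big[OF fixed_space_on[of H Q], of "\<lambda>w. w i"] by simp

lemma measurable_big_prob:
  assumes H: "realized \<Omega> H"
  shows "(\<lambda>\<omega>. big_prob c k (H \<omega>)) \<in> borel_measurable \<Omega>"
  unfolding big_prob_def
proof (rule Q.measurable_measure)
  have "Measurable.pred (\<Omega> \<Otimes>\<^sub>M Q) (\<lambda>z. big c k (H (fst z)) (snd z 0))"
    by (rule pred_big[OF realized_compose[OF H]]) auto
  moreover have "{z \<in> space (\<Omega> \<Otimes>\<^sub>M Q). snd z \<in> {w \<in> space Q. big c k (H (fst z)) (w 0)}}
      = {z \<in> space (\<Omega> \<Otimes>\<^sub>M Q). big c k (H (fst z)) (snd z 0)}"
    by (auto simp: space_pair_measure)
  ultimately show "{z \<in> space (\<Omega> \<Otimes>\<^sub>M Q). snd z \<in> {w \<in> space Q. big c k (H (fst z)) (w 0)}} \<in> sets (\<Omega> \<Otimes>\<^sub>M Q)"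
    by (simp only: pred_def)
qed auto

text \<open>The tolerance \<open>1 / m\<close> is half of the summand \<open>2 / m\<close> in
  \<open>Delta_hat\<close>, which absorbs it; with \<open>m ^ 3\<close> points it still has a
  failure probability exponential in \<open>m\<close>.\<close>

definition misestimates :: "real \<Rightarrow> (nat \<Rightarrow> 'a) \<Rightarrow> nat \<Rightarrow> nat \<Rightarrow> 'a classifier set \<Rightarrow> bool" where
  "misestimates c w k m H \<longleftrightarrow>
     1 / real m * real (m ^ 3) < \<bar>real (card {i \<in> {1..m ^ 3}. big c k H (w i)}) - big_prob c k H * real (m ^ 3)\<bar>"

lemma card_points_eq:
  "card {i \<in> {m + 1..m + N}. \<phi> (w i)} = card {i \<in> {..<N}. \<phi> (shift (i * 1) (shift (m + 1) w) 0)}"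
proof -
  have "{i \<in> {m + 1..m + N}. \<phi> (w i)} = (\<lambda>i. m + 1 + i) ` {i \<in> {..<N}. \<phi> (w (m + 1 + i))}"
  proof (intro set_eqI iffI)
    fix i assume "i \<in> {i \<in> {m + 1..m + N}. \<phi> (w i)}"
    then show "i \<in> (\<lambda>i. m + 1 + i) ` {i \<in> {..<N}. \<phi> (w (m + 1 + i))}"
      by (intro image_eqI[of _ _ "i - (m + 1)"]) auto
  qed auto
  then show ?thesis
    by (simp add: card_image inj_on_def shift_def del: lessThan_iff)
qed

lemma prob_misestimates:
  assumes H: "fixed_space H" and "1 \<le> m"
  shows "\<P>(w in Q. misestimates c w k m H) \<le> 2 * exp (- 2 * real m)"
proof -
  let ?T = "\<lambda>w :: nat \<Rightarrow> 'a. big c k H (w 0)"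
  have T [measurable]: "Measurable.pred Q ?T" by (rule pred_big_Q[OF H])
  have eq: "misestimates c w k m H \<longleftrightarrow> 1 / real m * real (m ^ 3) <
      \<bar>real (card {i \<in> {..<m ^ 3}. ?T (shift (i * 1) (shift 1 w))}) - \<P>(w in Q. ?T w) * real (m ^ 3)\<bar>" for w
    using card_points_eq[of 0 "m ^ 3" "big c k H" w]
    unfolding misestimates_def big_prob_def by (simp only: add_0)
  have pos: "0 < 1 / real m" using assms by simp
  let ?\<phi> = "\<lambda>w. 1 / real m * real (m ^ 3) <
      \<bar>real (card {i \<in> {..<m ^ 3}. ?T (shift (i * 1) w)}) - \<P>(w in Q. ?T w) * real (m ^ 3)\<bar>"
  have "\<P>(w in Q. misestimates c w k m H) = \<P>(w in Q. ?\<phi> w)"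
    unfolding eq by (rule measure_shift) measurable
  also have "\<dots> \<le> 2 * exp (- 2 * (1 / real m)\<^sup>2 * real (m ^ 3))"
    by (rule hoeffding_blocks[where T = ?T and b = 1]) (rule T, simp, rule pos)
  also have "2 * exp (- 2 * (1 / real m)\<^sup>2 * real (m ^ 3)) = 2 * exp (- 2 * real m)"
    using assms by (simp add: power2_eq_square power3_eq_cube)
  finally show ?thesis .
qed

lemma pred_misestimates:
  assumes H: "realized \<Omega> H" and w: "\<And>i. (\<lambda>\<omega>. w \<omega> i) \<in> measurable \<Omega> M"
  shows "Measurable.pred \<Omega> (\<lambda>\<omega>. misestimates c (w \<omega>) k m (H \<omega>))"
proof -
  note [measurable] = pred_big[OF H w] measurable_big_prob[OF H]
  show ?thesis unfolding misestimates_def by measurable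
qed

text \<open>Up to \<open>n * n\<close> points are examined while \<open>\<mu>\<close> is of order
  \<open>n\<close>. A deviation by \<open>\<mu>\<close> is then only of the order of the square root
  of the number of points, where Hoeffding's bound is not small; hence the multiplicative bound at
  \<open>2 * \<mu>\<close>. The first conjunct belongs to the event because \<open>big_prob\<close>
  is itself random.\<close>

definition overfull :: "real \<Rightarrow> nat \<Rightarrow> nat \<Rightarrow> nat \<Rightarrow> (nat \<Rightarrow> 'a) \<Rightarrow> bool" where
  "overfull \<mu> k m l X \<longleftrightarrow> big_prob (1 / 4) k (V m X) * real l \<le> \<mu> \<and>
     2 * \<mu> \<le> real (card {j \<in> {m + 1..m + l}. big (1 / 4) k (V m X) (X j)})"

lemma V_comb_seq: "V m (comb_seq (m + 1) v w) = V m v"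
  by (rule initial_space_cong) (simp add: comb_seq_less)

lemma pred_overfull:
  assumes X: "\<And>i. (\<lambda>\<omega>. X \<omega> i) \<in> measurable \<Omega> M"
  shows "Measurable.pred \<Omega> (\<lambda>\<omega>. overfull \<mu> k m l (X \<omega>))"
proof -
  note H = realized_V[of X, OF X]
  note [measurable] = pred_big[OF H X] measurable_big_prob[OF H]
  show ?thesis unfolding overfull_def by measurable
qed

text \<open>Given the first \<open>m + 1\<close> coordinates, \<open>V m X\<close> is fixed and the
  points counted are fresh, so Chernoff's bound applies with the constant stopping time
  \<open>m + 1\<close>.\<close>

lemma prob_overfull: "\<P>(X in Q. overfull \<mu> k m l X) \<le> exp (- \<mu> / 3)"
proof (rule measure_strong_markov[where \<tau> = "\<lambda>_. m + 1"])
  show "Measurable.pred Q (overfull \<mu> k m l)"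
    using pred_overfull[of "\<lambda>X. X" Q] by simp
next
  fix v assume v: "v \<in> space Q"
  have H: "fixed_space (V m v)" by (rule fixed_space_V[OF v])
  let ?T = "\<lambda>w :: nat \<Rightarrow> 'a. big (1 / 4) k (V m v) (w 0)"
  have T [measurable]: "Measurable.pred Q ?T" by (rule pred_big_Q[OF H])
  have sh: "shift (m + 1) (comb_seq (m + 1) v w) = w" for w
    using shift_comb_seq[of 0 "m + 1" v w] by simp
  have eq: "overfull \<mu> k m l (comb_seq (m + 1) v w) \<longleftrightarrow> big_prob (1 / 4) k (V m v) * real l \<le> \<mu> \<and>
     2 * \<mu> \<le> real (card {i \<in> {..<l}. ?T (shift (i * 1) w)})" for w
    unfolding overfull_def V_comb_seq card_points_eq sh by (rule refl)
  show "\<P>(w in Q. overfull \<mu> k m l (comb_seq (m + 1) v w)) \<le> exp (- \<mu> / 3)"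
  proof (cases "big_prob (1 / 4) k (V m v) * real l \<le> \<mu>")
    case True
    have "\<P>(w in Q. 2 * \<mu> \<le> real (card {i \<in> {..<l}. ?T (shift (i * 1) w)})) \<le> exp (- \<mu> / 3)"
      by (rule chernoff_blocks[where T = ?T and b = 1]) (rule T, simp, rule True[unfolded big_prob_def])
    then show ?thesis using True by (simp only: eq simp_thms)
  next
    case False
    then show ?thesis by (simp only: eq simp_thms) simp
  qed
qed auto

section \<open>Typical data\<close>

text \<open>Both counts are within \<open>\<sigma> * j ^ 3\<close> of their means. The three
  implications hold once the shattering probability is at least \<open>6 * \<sigma>\<close>,
  \<open>9 * \<sigma>\<close> and \<open>18 * \<sigma>\<close> respectively; the factor 20 covers
  them all.\<close>

lemma Delta_hat_point_bounds:
  assumes j: "1 \<le> j" and H: "H \<noteq> {}"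
    and dA: "\<not> deviates \<sigma> w' k (j ^ 3) H []" and dD: "\<not> deviates \<sigma> w' k (j ^ 3) H [x]"
    and pos: "0 < \<sigma>" and s: "20 * \<sigma> \<le> shatter_prob (k - 1) H []"
  shows "1 / 2 \<le> Delta_hat_point w' k j x H \<Longrightarrow> big (1 / 4) k H x"
    and "big (1 / 4) k H x \<Longrightarrow> 1 / 8 \<le> Delta_hat_point w' k j x H"
    and "1 / 8 \<le> Delta_hat_point w' k j x H \<Longrightarrow> big (1 / 16) k H x"
    and "real (shatter_count w' k j H) = real (card {i \<in> {1..j ^ 3}. shatters H (block w' k i)})"
    and "0 < real (card {i \<in> {1..j ^ 3}. shatters H (block w' k i)})"
proof -
  define N where "N = real (j ^ 3)"
  define A where "A = real (card {i \<in> {1..j ^ 3}. shatters H (block w' k i)})"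
  define D where "D = real (card {i \<in> {1..j ^ 3}. shatters H (block w' k i @ [x])})"
  let ?s = "shatter_prob (k - 1) H []" and ?x = "shatter_prob (k - 1) H [x]"
  have N: "0 < N" using j by (simp add: N_def)
  have A1: "(?s - \<sigma>) * N \<le> A" and A2: "A \<le> (?s + \<sigma>) * N"
    using dA by (auto simp: deviates_def A_def N_def algebra_simps abs_if split: if_splits)
  have D1: "(?x - \<sigma>) * N \<le> D" and D2: "D \<le> (?x + \<sigma>) * N"
    using dD by (auto simp: deviates_def D_def N_def algebra_simps abs_if split: if_splits)
  have "0 < (?s - \<sigma>) * N" using N pos s by (intro mult_pos_pos) auto
  then have A: "0 < A" using A1 by simp
  then show "0 < real (card {i \<in> {1..j ^ 3}. shatters H (block w' k i)})" by (simp add: A_def)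
  show count: "real (shatter_count w' k j H) = real (card {i \<in> {1..j ^ 3}. shatters H (block w' k i)})"
    using A unfolding A_def shatter_count_def by simp
  have eq: "Delta_hat_point w' k j x H = D / A"
    unfolding Delta_hat_point_eq[OF j H] count A_def D_def by (rule refl)
  have sN: "20 * \<sigma> * N \<le> ?s * N" "0 < \<sigma> * N" using s N pos by simp_all
  show "big (1 / 4) k H x" if "1 / 2 \<le> Delta_hat_point w' k j x H"
  proof -
    have "A \<le> 2 * D" using that A unfolding eq by (simp add: field_simps)
    then have "(1 / 4 * ?s) * N \<le> ?x * N"
      using A1 D2 sN by (simp add: algebra_simps)
    then show ?thesis unfolding big_def using N by simp
  qed
  show "1 / 8 \<le> Delta_hat_point w' k j x H" if "big (1 / 4) k H x"
  proof -
    have "(1 / 4 * ?s) * N \<le> ?x * N" using that N unfolding big_def by (intro mult_right_mono) auto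
    then have "A \<le> 8 * D" using A2 D1 sN by (simp add: algebra_simps)
    then show ?thesis unfolding eq using A by (simp add: field_simps)
  qed
  show "big (1 / 16) k H x" if "1 / 8 \<le> Delta_hat_point w' k j x H"
  proof -
    have "A \<le> 8 * D" using that A unfolding eq by (simp add: field_simps)
    then have "(1 / 16 * ?s) * N \<le> ?x * N"
      using A1 D2 sN by (simp add: algebra_simps)
    then show ?thesis unfolding big_def using N by simp
  qed
qed

text \<open>More than three quarters of the shattered tuples survive the correct label, by
  \<open>B\<close> and \<open>s'\<close>, and fewer than half survive both labels, as no label is
  wanted. By inclusion and exclusion fewer than three quarters survive the wrong label, and
  \<open>Gamma_hat\<close> prefers the label whose opposite leaves fewer tuples.\<close>

lemma inferred_label_correct:
  assumes j: "1 \<le> j" and H: "H \<noteq> {}"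
    and dA: "\<not> deviates \<sigma> w' k (j ^ 3) H []"
    and dB: "\<not> deviates \<sigma> w' k (j ^ 3) (restrict_label H (X j) (f (X j))) []"
    and dD: "\<not> deviates \<sigma> w' k (j ^ 3) H [X j]"
    and pos: "0 < \<sigma>" and s: "20 * \<sigma> \<le> shatter_prob (k - 1) H []"
    and s': "shatter_prob (k - 1) H [] \<le> 22 * \<sigma>"
    and B: "20 * \<sigma> \<le> shatter_prob (k - 1) (restrict_label H (X j) (f (X j))) []"
    and want: "\<not> wants_label X w' k H j"
  shows "inferred_label X w' k H j = f (X j)"
proof -
  define x where "x = X j"
  define N where "N = real (j ^ 3)"
  define A where "A = {i \<in> {1..j ^ 3}. shatters H (block w' k i)}"
  define S where "S = (\<lambda>y. {i \<in> {1..j ^ 3}. shatters (restrict_label H x y) (block w' k i)})"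
  define D where "D = {i \<in> {1..j ^ 3}. shatters H (block w' k i @ [x])}"
  note bounds = Delta_hat_point_bounds[OF j H dA dD pos s]
  have N: "0 < N" using j by (simp add: N_def)
  have fin: "finite A" "finite (S y)" for y by (auto simp: A_def S_def)
  have sub: "S y \<subseteq> A" for y
    unfolding A_def S_def by (auto elim!: shatters_mono simp: restrict_label_def)
  have D_eq: "D = S (f x) \<inter> S (\<not> f x)"
    unfolding D_def S_def shatters_snoc by (cases "f x") auto
  have "real (card A) \<le> (shatter_prob (k - 1) H [] + \<sigma>) * N"
    using dA by (auto simp: deviates_def A_def N_def algebra_simps abs_if split: if_splits)
  also have "\<dots> \<le> 23 * (\<sigma> * N)" using s' N by (simp add: mult_right_mono)
  finally have cA: "real (card A) \<le> 23 * (\<sigma> * N)" .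
  have "19 * (\<sigma> * N) \<le> (shatter_prob (k - 1) (restrict_label H x (f x)) [] - \<sigma>) * N"
    using B N by (simp add: x_def mult_right_mono)
  also have "\<dots> \<le> real (card (S (f x)))"
    using dB by (auto simp: deviates_def S_def N_def x_def algebra_simps abs_if split: if_splits)
  finally have cB: "19 * (\<sigma> * N) \<le> real (card (S (f x)))" .
  have "0 < \<sigma> * N" using pos N by simp
  \<comment> \<open>The bounds \<open>20 * \<sigma>\<close> and \<open>22 * \<sigma>\<close>, with
    an error \<open>\<sigma>\<close> each, give the ratio \<open>19 / 23\<close>, which exceeds
    \<open>3 / 4\<close>.\<close>
  then have AB: "3 * real (card A) < 4 * real (card (S (f x)))" using cA cB by linarith
  have A: "0 < real (card A)" using bounds(5) by (simp add: A_def)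
  have "Delta_hat_point w' k j x H < 1 / 2" using want by (simp add: wants_label_def x_def)
  then have D: "2 * real (card D) < real (card A)"
    using A unfolding Delta_hat_point_eq[OF j H] bounds(4) A_def[symmetric] D_def[symmetric]
    by (simp add: field_simps)
  have "card (S (f x) \<union> S (\<not> f x)) + card D = card (S (f x)) + card (S (\<not> f x))"
    unfolding D_eq using card_Un_Int[OF fin(2) fin(2)] by simp
  moreover have "card (S (f x) \<union> S (\<not> f x)) \<le> card A"
    using sub fin by (intro card_mono) auto
  ultimately have un: "card (S (f x)) + card (S (\<not> f x)) \<le> card A + card D" by simp
  have G: "Gamma_hat w' k j x y H = (real (card A) - real (card (S (\<not> y)))) / real (card A)" for y
  proof -
    have "{i \<in> {1..j ^ 3}. shatters H (block w' k i) \<and> \<not> shatters (restrict_label H x (\<not> y)) (block w' k i)}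
        = A - S (\<not> y)"
      by (auto simp: A_def S_def)
    moreover have "real (card (A - S (\<not> y))) = real (card A) - real (card (S (\<not> y)))"
      using card_Diff_subset[OF fin(2) sub] card_mono[OF fin(1) sub] by simp
    ultimately show ?thesis
      unfolding Gamma_hat_eq[OF j H] bounds(4) A_def[symmetric] by simp
  qed
  have "Gamma_hat w' k j x (\<not> f x) H < Gamma_hat w' k j x (f x) H"
    unfolding G using A AB D un by (intro divide_strict_right_mono) auto
  then show ?thesis
    unfolding inferred_label_def arg_max_bool x_def[symmetric] by (cases "f x") auto
qed

text \<open>
  This is used for the least \<open>K\<close> with \<open>limit_prob K = 0\<close>, for \<open>20 * \<sigma> = limit_prob (K - 1)\<close> and for
  a small \<open>\<tau>\<close>.
\<close>

definition typical :: "nat \<Rightarrow> real \<Rightarrow> real \<Rightarrow> nat \<Rightarrow> (nat \<Rightarrow> 'a) \<Rightarrow> (nat \<Rightarrow> 'a) \<Rightarrow> (nat \<Rightarrow> 'a) \<Rightarrow> bool" where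
  "typical K \<sigma> \<tau> n X w w' \<longleftrightarrow>
     (let m = n div 3; H = V m X in
       (\<forall>a. 20 * \<sigma> \<le> shatter_prob (K - 1) (V a X) []) \<and>
       shatter_prob (K - 1) H [] \<le> 22 * \<sigma> \<and> shatter_prob K H [] \<le> \<tau> \<and>
       (\<forall>k\<in>{1..K}.
          (\<forall>j\<in>{m + 1..m + n * n}. \<not> deviates \<sigma> w' k (j ^ 3) H [] \<and> \<not> deviates \<sigma> w' k (j ^ 3) H [X j] \<and>
             \<not> deviates \<sigma> w' k (j ^ 3) (restrict_label H (X j) (f (X j))) []) \<and>
          \<not> deviates \<sigma> w' k (m ^ 3) H [] \<and> (\<forall>i\<in>{1..m ^ 3}. \<not> deviates \<sigma> w' k (m ^ 3) H [w i]) \<and>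
          \<not> misestimates (1 / 4) w k m H \<and> \<not> misestimates (1 / 16) w k m H \<and>
          (\<forall>l\<in>{..n * n}. \<not> overfull (real n / (6 * 2 ^ k)) k m l X)))"

context
  fixes K n :: nat and \<sigma> \<tau> :: real and X w w' :: "nat \<Rightarrow> 'a" and m :: nat and H :: "'a classifier set"
  assumes typical: "typical K \<sigma> \<tau> n X w w'" and K: "1 \<le> K" and \<sigma>: "0 < \<sigma>" and n: "3 \<le> n"
    and X: "X \<in> space Q"
  defines "m \<equiv> n div 3" and "H \<equiv> V m X"
begin

lemma m_ge_1: "1 \<le> m" using n by (simp add: m_def)

lemma H_nonempty: "H \<noteq> {}" using f_in_V by (auto simp: H_def)

lemma typical_prob_ge: "20 * \<sigma> \<le> shatter_prob (K - 1) (V a X) []"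
  using typical by (simp add: typical_def Let_def)

text \<open>Shorter tuples are shattered with larger probability, so the lower bound for round
  \<open>K\<close> covers all earlier rounds.\<close>

lemma typical_space_ge: "k \<in> {1..K} \<Longrightarrow> 20 * \<sigma> \<le> shatter_prob (k - 1) H []"
  using typical_prob_ge[of m] shatter_prob_antimono[OF fixed_space_V[OF X, of m], of "k - 1" "K - 1"]
  unfolding H_def[symmetric] by fastforce

lemma typical_unfold:
  assumes "k \<in> {1..K}"
  shows "j \<in> {m + 1..m + n * n} \<Longrightarrow> \<not> deviates \<sigma> w' k (j ^ 3) H []"
    and "j \<in> {m + 1..m + n * n} \<Longrightarrow> \<not> deviates \<sigma> w' k (j ^ 3) H [X j]"
    and "j \<in> {m + 1..m + n * n} \<Longrightarrow> \<not> deviates \<sigma> w' k (j ^ 3) (restrict_label H (X j) (f (X j))) []"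
    and "\<not> deviates \<sigma> w' k (m ^ 3) H []"
    and "i \<in> {1..m ^ 3} \<Longrightarrow> \<not> deviates \<sigma> w' k (m ^ 3) H [w i]"
    and "\<not> misestimates (1 / 4) w k m H" and "\<not> misestimates (1 / 16) w k m H"
    and "l \<le> n * n \<Longrightarrow> \<not> overfull (real n / (6 * 2 ^ k)) k m l X"
    and "shatter_prob (K - 1) H [] \<le> 22 * \<sigma>" and "shatter_prob K H [] \<le> \<tau>"
  using typical assms unfolding typical_def Let_def H_def[symmetric] m_def[symmetric] by auto

lemma Delta_hat_ge: "2 / real m \<le> Delta_hat w w' k m H"
  by (simp add: Delta_hat_def)

text \<open>The points counted by \<open>Delta_hat\<close> include the \<open>big (1 / 4)\<close>
  ones and are among the \<open>big (1 / 16)\<close> ones, whose frequencies are correct up to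
  \<open>1 / m\<close>. The summand \<open>2 / m\<close> outweighs this error, so
  \<open>Delta_hat\<close> never falls below \<open>big_prob (1 / 4)\<close>.\<close>

lemma Delta_hat_bounds:
  assumes k: "k \<in> {1..K}"
  shows "big_prob (1 / 4) k H \<le> Delta_hat w w' k m H"
    and "Delta_hat w w' k m H \<le> 3 / real m + big_prob (1 / 16) k H"
proof -
  define N where "N = real (m ^ 3)"
  define d where "d = real (card {i \<in> {1..m ^ 3}. Delta_hat_point w' k m (w i) H \<ge> 1 / 8})"
  let ?b = "\<lambda>c. real (card {i \<in> {1..m ^ 3}. big c k H (w i)})"
  have N: "0 < N" using m_ge_1 by (simp add: N_def)
  note bounds = Delta_hat_point_bounds[OF m_ge_1 H_nonempty typical_unfold(4)[OF k] typical_unfold(5)[OF k] \<sigma>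
      typical_space_ge[OF k]]
  have "?b (1 / 4) \<le> d"
    unfolding d_def of_nat_le_iff using bounds(2) by (intro card_mono) auto
  moreover have "big_prob (1 / 4) k H * N - 1 / real m * N \<le> ?b (1 / 4)"
    using typical_unfold(6)[OF k] unfolding misestimates_def N_def by linarith
  ultimately have 1: "big_prob (1 / 4) k H * N - 1 / real m * N \<le> d" by simp
  have "d \<le> ?b (1 / 16)"
    unfolding d_def of_nat_le_iff using bounds(3) by (intro card_mono) auto
  moreover have "?b (1 / 16) \<le> big_prob (1 / 16) k H * N + 1 / real m * N"
    using typical_unfold(7)[OF k] unfolding misestimates_def N_def by linarith
  ultimately have 2: "d \<le> big_prob (1 / 16) k H * N + 1 / real m * N" by simp
  have eq: "Delta_hat w w' k m H = 2 / real m + d / N"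
    by (simp add: Delta_hat_def d_def N_def)
  have "(big_prob (1 / 4) k H - 1 / real m) * N \<le> d" using 1 by (simp add: algebra_simps)
  then have "big_prob (1 / 4) k H - 1 / real m \<le> d / N" using N by (simp add: pos_le_divide_eq)
  then show "big_prob (1 / 4) k H \<le> Delta_hat w w' k m H"
    unfolding eq by (smt (verit, best) divide_nonneg_nonneg of_nat_0_le_iff add_divide_distrib)
  have "d \<le> (big_prob (1 / 16) k H + 1 / real m) * N" using 2 by (simp add: algebra_simps)
  then have "d / N \<le> big_prob (1 / 16) k H + 1 / real m" using N by (simp add: pos_divide_le_eq)
  then show "Delta_hat w w' k m H \<le> 3 / real m + big_prob (1 / 16) k H"
    unfolding eq by (smt (verit, best) add_divide_distrib)
qed

text \<open>Since \<open>Delta_hat\<close> is at least \<open>2 / m\<close>, no round is longer than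
  \<open>n * n\<close>. Hence the conditions in \<open>typical\<close> range over polynomially many
  indices only.\<close>

lemma sample_length_le:
  "real (sample_length n w w' H k) * Delta_hat w w' k m H \<le> real n / (6 * 2 ^ k)"
  "sample_length n w w' H k \<le> n * n"
proof -
  let ?D = "Delta_hat w w' k m H"
  have m: "0 < real m" using m_ge_1 by simp
  have D: "0 < ?D" using Delta_hat_ge[of k] m by (smt (verit) divide_pos_pos)
  have le: "real (sample_length n w w' H k) \<le> real n / (6 * 2 ^ k * ?D)"
    unfolding sample_length_def m_def[symmetric] using D by (simp add: of_nat_nat)
  then have "real (sample_length n w w' H k) * ?D \<le> real n / (6 * 2 ^ k * ?D) * ?D"
    using D by (intro mult_right_mono) auto
  then show *: "real (sample_length n w w' H k) * ?D \<le> real n / (6 * 2 ^ k)"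
    using D by simp
  have "real (sample_length n w w' H k) * (2 / real m) \<le> real (sample_length n w w' H k) * ?D"
    using Delta_hat_ge[of k] by (intro mult_left_mono) auto
  also have "\<dots> \<le> real n / (6 * 2 ^ k)" by (rule *)
  also have "\<dots> \<le> real n" 
  proof -
    have "(1::real) \<le> 2 ^ k" by simp
    then have "(1::real) \<le> 6 * 2 ^ k" by linarith
    then show ?thesis using divide_left_mono[of 1 "6 * 2 ^ k" "real n"] by simp
  qed
  finally have "2 * real (sample_length n w w' H k) \<le> real n * real m" using m by (simp add: field_simps)
  also have "\<dots> \<le> real n * real n" by (intro mult_left_mono) (auto simp: m_def)
  finally have "real (sample_length n w w' H k) \<le> real (n * n)" by simp
  then show "sample_length n w w' H k \<le> n * n" by (simp only: of_nat_le_iff)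
qed

text \<open>A wanted label belongs to a \<open>big (1 / 4)\<close> point, and the round is so short
  that at most \<open>n / (6 * 2 ^ k)\<close> such points are expected; twice as many are excluded
  by the round not being \<open>overfull\<close>.\<close>

lemma requests_less:
  assumes k: "k \<in> {1..K}"
  shows "real (card {j \<in> {m + 1..m + sample_length n w w' H k}. wants_label X w' k H j}) \<le> real n / (3 * 2 ^ k)"
proof -
  let ?l = "sample_length n w w' H k"
  have "big (1 / 4) k H (X j)" if "j \<in> {m + 1..m + ?l}" "wants_label X w' k H j" for j
  proof -
    have j: "j \<in> {m + 1..m + n * n}" using that sample_length_le(2)[of k] by auto
    show ?thesis
      using Delta_hat_point_bounds(1)[OF _ H_nonempty typical_unfold(1)[OF k j] typical_unfold(2)[OF k j] \<sigma>
        typical_space_ge[OF k]] that by (auto simp: wants_label_def)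
  qed
  then have "real (card {j \<in> {m + 1..m + ?l}. wants_label X w' k H j})
      \<le> real (card {j \<in> {m + 1..m + ?l}. big (1 / 4) k H (X j)})"
    unfolding of_nat_le_iff by (intro card_mono) auto
  moreover have "big_prob (1 / 4) k H * real ?l \<le> real n / (6 * 2 ^ k)"
    using sample_length_le(1)[of k] Delta_hat_bounds(1)[OF k]
    by (smt (verit) mult.commute mult_right_mono of_nat_0_le_iff)
  then have "real (card {j \<in> {m + 1..m + ?l}. big (1 / 4) k H (X j)}) < 2 * (real n / (6 * 2 ^ k))"
    using typical_unfold(8)[OF k sample_length_le(2)[of k]] unfolding overfull_def H_def[symmetric] by simp
  ultimately show ?thesis by simp
qed

text \<open>The rounds up to \<open>K\<close> want at most the sum of \<open>n / (3 * 2 ^ k)\<close>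
  labels, which stays below \<open>n / 3\<close>, so the cap is not reached before round
  \<open>K\<close> is complete. The labels of this round that are not requested are inferred
  correctly.\<close>

lemma typical_labels:
  assumes n': "3 * 2 ^ K \<le> n" and N: "K \<le> N"
  shows "round_lists C N n (X, w, w') (\<lambda>i. f (X i)) ! (K - 1)
    = map (\<lambda>i. f (X i)) [m + 1..<m + sample_length n w w' H K + 1]"
proof -
  have geometric: "(\<Sum>i<K. real n / (3 * 2 ^ Suc i)) = real n / 3 - real n / (3 * 2 ^ K)" for K
    by (induction K) (auto simp: field_simps)
  let ?c = "\<lambda>k. card {j \<in> {m + 1..m + sample_length n w w' H k}. wants_label X w' k H j}"
  have nth: "[1..<N + 1] ! i = Suc i" if "i < N" for i
    using that by (subst nth_upt) auto
  have sum: "(\<Sum>i<K - 1. ?c ([1..<N + 1] ! i)) = (\<Sum>i<K - 1. ?c (Suc i))"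
    using N by (intro sum.cong refl arg_cong[of _ _ ?c] nth) auto
  have K': "[1..<N + 1] ! (K - 1) = K" using nth[of "K - 1"] K N by simp
  have "K - 1 < length [1..<N + 1]" using K N by auto
  from round_labels_nth[OF this, of m n w w' H X "\<lambda>i. f (X i)"]
  obtain t' where t': "t' \<le> m + (\<Sum>i<K - 1. ?c (Suc i))"
    and labels: "snd (round_labels n (X, w, w') H (\<lambda>i. f (X i)) [1..<N + 1] m) ! (K - 1) =
      snd (point_labels (wants_label X w' K H) (inferred_label X w' K H) (2 * n div 3) (\<lambda>i. f (X i))
        [m + 1..<m + sample_length n w w' H K + 1] t')"
    unfolding m_def[symmetric] K' sum by blast
  have "(\<Sum>i<K - 1. ?c (Suc i)) + ?c K = (\<Sum>i<K. ?c (Suc i))"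
    using K by (cases K) auto
  then have "real (\<Sum>i<K - 1. ?c (Suc i)) + real (?c K) = real (\<Sum>i<K. ?c (Suc i))"
    by (simp only: of_nat_add[symmetric])
  moreover have "real (\<Sum>i<K. ?c (Suc i)) \<le> (\<Sum>i<K. real n / (3 * 2 ^ Suc i))"
    unfolding of_nat_sum by (intro sum_mono requests_less) auto
  moreover have "(\<Sum>i<K. real n / (3 * 2 ^ Suc i)) = real n / 3 - real n / (3 * 2 ^ K)"
    by (rule geometric)
  \<comment> \<open>This unit, left over by the geometric sum, makes up for rounding down in
    \<open>2 * n div 3\<close>.\<close>
  moreover have "1 \<le> real n / (3 * 2 ^ K)"
  proof -
    have "real (3 * 2 ^ K) \<le> real n" using n' by (simp only: of_nat_le_iff)
    then show ?thesis by simp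
  qed
  moreover have "real t' \<le> real m + real (\<Sum>i<K - 1. ?c (Suc i))" using t' by linarith
  moreover have "real m \<le> real n / 3" by (simp add: m_def)
  ultimately have "real t' + real (?c K) \<le> 2 * real n / 3 - 1" by linarith
  then have "real (t' + ?c K) \<le> 2 * real n / 3 - 1" by (simp only: of_nat_add)
  moreover have "2 * real n / 3 - 1 < real (2 * n div 3)" by linarith
  ultimately have cap: "t' + ?c K \<le> 2 * n div 3" by linarith
  have "snd (point_labels (wants_label X w' K H) (inferred_label X w' K H) (2 * n div 3) (\<lambda>i. f (X i))
        [m + 1..<m + sample_length n w w' H K + 1] t')
      = map (\<lambda>i. f (X i)) [m + 1..<m + sample_length n w w' H K + 1]"
  proof (rule point_labels_correct)
    show "t' + length (filter (wants_label X w' K H) [m + 1..<m + sample_length n w w' H K + 1]) \<le> 2 * n div 3"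
      unfolding length_filter_upt by (rule cap)
  next
    fix j assume "j \<in> set [m + 1..<m + sample_length n w w' H K + 1]" and want: "\<not> wants_label X w' K H j"
    then have j: "j \<in> {m + 1..m + n * n}" using sample_length_le(2)[of K] by auto
    \<comment> \<open>As \<open>m < j\<close>, the point \<open>X j\<close> with its true label
      belongs to the sample of size \<open>j\<close>. The lower bound in \<open>typical\<close>
      holds for all sample sizes at once, so it can be used at size \<open>j\<close>.\<close>
    have "V j X \<subseteq> restrict_label H (X j) (f (X j))"
      using j unfolding H_def
      by (auto simp: initial_space_def version_space_def restrict_label_def simp del: upt_Suc)
    then have "shatter_prob (K - 1) (V j X) [] \<le> shatter_prob (K - 1) (restrict_label H (X j) (f (X j))) []"
      unfolding H_def by (intro shatter_prob_mono fixed_space_restrict_V X space_Q_M) auto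
    then have B: "20 * \<sigma> \<le> shatter_prob (K - 1) (restrict_label H (X j) (f (X j))) []"
      using typical_prob_ge[of j] by simp
    have kK: "K \<in> {1..K}" using K by simp
    show "inferred_label X w' K H j = f (X j)"
      by (rule inferred_label_correct[OF _ H_nonempty typical_unfold(1)[OF kK j] typical_unfold(3)[OF kK j]
          typical_unfold(2)[OF kK j] \<sigma> typical_space_ge[OF kK] typical_unfold(9)[OF kK] B want])
        (use j in auto)
  qed
  then show ?thesis
    unfolding round_lists_def fst_conv m_def[symmetric] H_def[symmetric] labels .
qed

text \<open>By \<open>shatter_prob_markov\<close>, at \<open>1 / 16\<close> of the shattering
  probability, the share of \<open>big\<close> points is at most \<open>16 * \<tau>\<close> over
  \<open>20 * \<sigma>\<close>, hence at most \<open>\<tau> / \<sigma>\<close>. As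
  \<open>\<tau>\<close> may be small compared with \<open>\<sigma>\<close>, the length exceeds any
  given multiple of \<open>n\<close> for large \<open>n\<close>.\<close>

lemma typical_length:
  "real n / (6 * 2 ^ K * (3 / real m + \<tau> / \<sigma>)) - 1 \<le> real (sample_length n w w' H K)"
proof -
  let ?D = "Delta_hat w w' K m H" and ?s = "shatter_prob (K - 1) H []"
  have kK: "K \<in> {1..K}" using K by simp
  have s: "20 * \<sigma> \<le> ?s" by (rule typical_space_ge[OF kK])
  have \<tau>: "0 \<le> \<tau>" using typical_unfold(10)[OF kK] shatter_prob_nonneg[of K H "[]"] by simp
  have "(1 / 16 * ?s) * big_prob (1 / 16) K H \<le> \<tau>"
    using shatter_prob_markov[OF fixed_space_V[OF X, of m], of "1 / 16 * ?s" "K - 1"] s \<sigma> K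
      typical_unfold(10)[OF kK]
    unfolding H_def[symmetric] big_prob_def big_def by auto
  moreover have "\<sigma> * big_prob (1 / 16) K H \<le> (1 / 16 * ?s) * big_prob (1 / 16) K H"
    using s \<sigma> by (intro mult_right_mono) (auto simp: big_prob_def)
  ultimately have "\<sigma> * big_prob (1 / 16) K H \<le> \<tau>" by linarith
  then have "big_prob (1 / 16) K H \<le> \<tau> / \<sigma>" using \<sigma> by (simp add: pos_le_divide_eq mult.commute)
  then have le: "?D \<le> 3 / real m + \<tau> / \<sigma>" using Delta_hat_bounds(2)[OF kK] by simp
  have m: "0 < real m" using m_ge_1 by simp
  have D: "0 < ?D" using Delta_hat_ge[of K] m by (smt (verit) divide_pos_pos)
  have "real n / (6 * 2 ^ K * (3 / real m + \<tau> / \<sigma>)) \<le> real n / (6 * 2 ^ K * ?D)"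
    using le D by (intro divide_left_mono mult_left_mono mult_pos_pos) auto
  also have "\<dots> \<le> real (sample_length n w w' H K) + 1"
    unfolding sample_length_def m_def[symmetric] using D by (simp add: of_nat_nat)
  finally show ?thesis by simp
qed

end

end

section \<open>Pairwise comparisons\<close>

definition lead_set :: "(nat \<Rightarrow> 'a) \<Rightarrow> ('a \<Rightarrow> bool) \<Rightarrow> nat \<Rightarrow> nat set" where
  "lead_set w D l = {i. D (w i) \<and> card {i'. i' < i \<and> D (w i')} < l}"

text \<open>
  Points that are missing because fewer than \<open>l\<close> points satisfy \<open>D\<close> count as satisfying \<open>B\<close>.
\<close>

definition lead_count :: "('a \<Rightarrow> bool) \<Rightarrow> ('a \<Rightarrow> bool) \<Rightarrow> nat \<Rightarrow> (nat \<Rightarrow> 'a) \<Rightarrow> nat" where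
  "lead_count D B l w = card {i \<in> lead_set w D l. B (w i)} + (l - card (lead_set w D l))"

lemma first_set_eq_lead_set:
  "first_set X u {x. D x} l = (\<lambda>i. u + 1 + i) ` lead_set (shift (u + 1) X) D l"
proof (intro set_eqI iffI)
  have card: "card {i'. u < i' \<and> i' < u + 1 + i \<and> D (X i')} = card {i'. i' < i \<and> D (shift (u + 1) X i')}" for i
  proof -
    have "{i'. u < i' \<and> i' < u + 1 + i \<and> D (X i')} = (\<lambda>i. u + 1 + i) ` {i'. i' < i \<and> D (shift (u + 1) X i')}"
    proof (intro set_eqI iffI)
      fix i' assume "i' \<in> {i'. u < i' \<and> i' < u + 1 + i \<and> D (X i')}"
      then show "i' \<in> (\<lambda>i. u + 1 + i) ` {i'. i' < i \<and> D (shift (u + 1) X i')}"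
        by (intro image_eqI[of _ _ "i' - (u + 1)"]) (auto simp: shift_def)
    qed (auto simp: shift_def)
    then show ?thesis by (simp add: card_image inj_on_def)
  qed
  fix i
  { assume i: "i \<in> first_set X u {x. D x} l"
    then obtain i' where "i = u + 1 + i'" by (auto simp: first_set_def dest!: less_imp_Suc_add)
    then show "i \<in> (\<lambda>i. u + 1 + i) ` lead_set (shift (u + 1) X) D l"
      using i card[of i'] by (auto simp: first_set_def lead_set_def shift_def) }
  { assume "i \<in> (\<lambda>i. u + 1 + i) ` lead_set (shift (u + 1) X) D l"
    then show "i \<in> first_set X u {x. D x} l"
      using card by (auto simp: first_set_def lead_set_def shift_def) }
qed

lemma card_first_set:
  "card (first_set X u {x. D x} l) = card (lead_set (shift (u + 1) X) D l)"
  "card {i \<in> first_set X u {x. D x} l. B (X i)} = card {i \<in> lead_set (shift (u + 1) X) D l. B (shift (u + 1) X i)}"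
proof -
  have inj: "inj_on (\<lambda>i. u + 1 + i) A" for A by (simp add: inj_on_def)
  show "card (first_set X u {x. D x} l) = card (lead_set (shift (u + 1) X) D l)"
    unfolding first_set_eq_lead_set by (rule card_image[OF inj])
  have "{i \<in> first_set X u {x. D x} l. B (X i)}
      = (\<lambda>i. u + 1 + i) ` {i \<in> lead_set (shift (u + 1) X) D l. B (shift (u + 1) X i)}"
    unfolding first_set_eq_lead_set by (auto simp: shift_def)
  then show "card {i \<in> first_set X u {x. D x} l. B (X i)} = card {i \<in> lead_set (shift (u + 1) X) D l. B (shift (u + 1) X i)}"
    by (simp only: card_image[OF inj])
qed

lemma lead_set_finite: "finite (lead_set w D l)" and card_lead_set_le: "card (lead_set w D l) \<le> l"
proof -
  \<comment> \<open>A dummy entry in front moves the sequence to the indices from 1 on, where the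
    facts on \<open>first_set\<close> apply.\<close>
  have eq: "first_set (case_nat undefined w) 0 {x. D x} l = (\<lambda>i. 0 + 1 + i) ` lead_set w D l"
    unfolding first_set_eq_lead_set by (simp add: shift_def)
  have inj: "inj_on (\<lambda>i. 0 + 1 + i) (lead_set w D l)" by (simp add: inj_on_def)
  show "finite (lead_set w D l)"
    using finite_first_set[of "case_nat undefined w" 0 "{x. D x}" l] unfolding eq by (rule finite_imageD[OF _ inj])
  show "card (lead_set w D l) \<le> l"
    using card_first_set_le[of "case_nat undefined w" 0 "{x. D x}" l] unfolding eq card_image[OF inj] .
qed

lemma lead_count_le: "lead_count D B l w \<le> l"
proof -
  have "card {i \<in> lead_set w D l. B (w i)} \<le> card (lead_set w D l)"
    by (intro card_mono lead_set_finite) auto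
  then show ?thesis using card_lead_set_le[of w D l] by (simp add: lead_count_def)
qed

lemma lead_count_0 [simp]: "lead_count D B 0 w = 0"
  using lead_count_le[of D B 0 w] by simp

lemma card_less_Suc_case_nat:
  "card {i'. i' < Suc i \<and> D (case_nat x w i')} = of_bool (D x) + card {i'. i' < i \<and> D (w i')}"
proof -
  have eq: "{i'. i' < Suc i \<and> D (case_nat x w i')} =
      (if D x then {0} else {}) \<union> Suc ` {i'. i' < i \<and> D (w i')}"
  proof (rule set_eqI)
    fix j show "j \<in> {i'. i' < Suc i \<and> D (case_nat x w i')} \<longleftrightarrow>
      j \<in> (if D x then {0} else {}) \<union> Suc ` {i'. i' < i \<and> D (w i')}"
      by (cases j) auto
  qed
  show ?thesis unfolding eq
    by (subst card_Un_disjoint) (auto simp: card_image)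
qed

lemma lead_set_case_nat:
  "lead_set (case_nat x w) D (Suc l) =
     (if D x then insert 0 (Suc ` lead_set w D l) else Suc ` lead_set w D (Suc l))"
proof (intro set_eqI)
  fix i
  show "i \<in> lead_set (case_nat x w) D (Suc l) \<longleftrightarrow>
     i \<in> (if D x then insert 0 (Suc ` lead_set w D l) else Suc ` lead_set w D (Suc l))"
    by (cases i) (auto simp: lead_set_def card_less_Suc_case_nat)
qed

text \<open>A first point in \<open>D\<close> uses up one of the \<open>Suc l\<close> places; any
  other first point is skipped and leaves the number of places unchanged.\<close>

lemma lead_count_case_nat:
  "lead_count D B (Suc l) (case_nat x w) =
     (if D x then of_bool (B x) + lead_count D B l w else lead_count D B (Suc l) w)"
proof -
  have inj: "inj_on Suc A" for A by simp
  have im: "{i \<in> Suc ` A. B (case_nat x w i)} = Suc ` {i \<in> A. B (w i)}" for A by auto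
  show ?thesis
  proof (cases "D x")
    case True
    have "{i \<in> insert 0 (Suc ` lead_set w D l). B (case_nat x w i)}
        = (if B x then {0} else {}) \<union> Suc ` {i \<in> lead_set w D l. B (w i)}"
      by auto
    moreover have "card ((if B x then {0} else {}) \<union> Suc ` {i \<in> lead_set w D l. B (w i)})
        = of_bool (B x) + card {i \<in> lead_set w D l. B (w i)}"
      by (subst card_Un_disjoint) (auto simp: card_image lead_set_finite)
    moreover have "card (insert 0 (Suc ` lead_set w D l)) = Suc (card (lead_set w D l))"
      by (subst card_insert_disjoint) (auto simp: card_image lead_set_finite)
    ultimately show ?thesis using True by (simp add: lead_count_def lead_set_case_nat)
  next
    case False
    then show ?thesis by (simp add: lead_count_def lead_set_case_nat im card_image)
  qed
qed

context distribution
begin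

lemma measurable_lead_count:
  assumes [measurable]: "Measurable.pred P D" "Measurable.pred P B"
  shows "lead_count D B l \<in> measurable Q (count_space UNIV)"
  unfolding lead_count_def[abs_def] lead_set_def mem_Collect_eq by measurable

text \<open>
  Conditioning on the first point gives a recursion in \<open>l\<close>, which avoids conditional distributions
  and stopping times.
\<close>

lemma lead_count_moment:
  fixes c :: real
  assumes D [measurable]: "Measurable.pred P D" and B [measurable]: "Measurable.pred P B"
    and pos: "0 < \<P>(x in P. D x)"
    and r: "\<P>(x in P. D x \<and> B x) \<le> r * \<P>(x in P. D x)" and "0 \<le> r" "1 \<le> c"
  shows "(\<integral>\<^sup>+ w. ennreal (c ^ lead_count D B l w) \<partial>Q) \<le> ennreal ((1 + (c - 1) * r) ^ l)"
proof (induction l)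
  case 0
  show ?case by (simp add: Q.emeasure_space_1)
next
  case (Suc l)
  note [measurable] = measurable_lead_count[OF D B]
  define p where "p = \<P>(x in P. D x)"
  define b where "b = \<P>(x in P. D x \<and> B x)"
  define \<phi> where "\<phi> = (\<lambda>l. Q.expectation (\<lambda>w. c ^ lead_count D B l w))"
  \<comment> \<open>\<open>lead_count\<close> is at most \<open>l\<close>, so the moments are finite
    and can be subtracted in an equation.\<close>
  have int: "integrable Q (\<lambda>w. c ^ lead_count D B l w)" for l
  proof (rule Q.integrable_const_bound[where B = "c ^ l"])
    show "AE w in Q. norm (c ^ lead_count D B l w) \<le> c ^ l"
      using \<open>1 \<le> c\<close> by (intro AE_I2) (simp add: power_increasing lead_count_le)
  qed measurable
  have \<phi>: "(\<integral>\<^sup>+ w. ennreal (c ^ lead_count D B l w) \<partial>Q) = ennreal (\<phi> l)" for l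
    unfolding \<phi>_def using \<open>1 \<le> c\<close> by (intro nn_integral_eq_integral int) auto
  have \<phi>_nonneg: "0 \<le> \<phi> l" for l unfolding \<phi>_def using \<open>1 \<le> c\<close> by (intro Bochner_Integration.integral_nonneg) auto
  have "ennreal (\<phi> (Suc l)) = (\<integral>\<^sup>+ x. \<integral>\<^sup>+ w. ennreal (c ^ lead_count D B (Suc l) (case_nat x w)) \<partial>Q \<partial>P)"
    unfolding \<phi>[symmetric] by (rule nn_integral_case_nat) measurable
  also have "\<dots> = (\<integral>\<^sup>+ x. ennreal ((if D x then (if B x then c else 1) * \<phi> l else \<phi> (Suc l))) \<partial>P)"
  proof (rule nn_integral_cong)
    fix x
    have "(\<integral>\<^sup>+ w. ennreal (c * c ^ lead_count D B l w) \<partial>Q) = ennreal (c * \<phi> l)"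
      using \<open>1 \<le> c\<close> by (simp add: ennreal_mult' nn_integral_cmult \<phi>)
    then show "(\<integral>\<^sup>+ w. ennreal (c ^ lead_count D B (Suc l) (case_nat x w)) \<partial>Q)
        = ennreal ((if D x then (if B x then c else 1) * \<phi> l else \<phi> (Suc l)))"
      by (simp add: lead_count_case_nat \<phi>)
  qed
  also have "\<dots> = ennreal (\<integral> x. (if D x then (if B x then c else 1) * \<phi> l else \<phi> (Suc l)) \<partial>P)"
  proof (rule nn_integral_eq_integral)
    show "integrable P (\<lambda>x. if D x then (if B x then c else 1) * \<phi> l else \<phi> (Suc l))"
    proof (rule integrable_const_bound[where B = "c * \<phi> l + \<phi> (Suc l)"])
      have "1 * \<phi> l \<le> c * \<phi> l" using \<open>1 \<le> c\<close> \<phi>_nonneg by (intro mult_right_mono) auto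
      then show "AE x in P. norm (if D x then (if B x then c else 1) * \<phi> l else \<phi> (Suc l)) \<le> c * \<phi> l + \<phi> (Suc l)"
        using \<open>1 \<le> c\<close> \<phi>_nonneg[of l] \<phi>_nonneg[of "Suc l"] by (intro AE_I2) auto
    qed measurable
  qed (use \<open>1 \<le> c\<close> \<phi>_nonneg in auto)
  also have "(\<integral> x. (if D x then (if B x then c else 1) * \<phi> l else \<phi> (Suc l)) \<partial>P)
      = (\<integral> x. \<phi> l * indicator {x \<in> space P. D x} x + (c - 1) * \<phi> l * indicator {x \<in> space P. D x \<and> B x} x
          + \<phi> (Suc l) * (1 - indicator {x \<in> space P. D x} x) \<partial>P)"
    by (intro Bochner_Integration.integral_cong) (auto simp: algebra_simps)
  also have "\<dots> = \<phi> l * p + (c - 1) * \<phi> l * b + \<phi> (Suc l) * (1 - p)"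
  proof -
    define A1 where "A1 = {x \<in> space P. D x}"
    define A2 where "A2 = {x \<in> space P. D x \<and> B x}"
    have A: "A1 \<in> sets P" "A2 \<in> sets P" unfolding A1_def A2_def by measurable
    have "integrable P (indicator A1 :: 'a \<Rightarrow> real)" "integrable P (indicator A2 :: 'a \<Rightarrow> real)"
      using A by (simp_all add: integrable_real_indicator emeasure_eq_measure)
    then show ?thesis
      unfolding p_def b_def A1_def[symmetric] A2_def[symmetric]
      using A by (simp add: prob_space sets.Int_space_eq2)
  qed
  finally have "\<phi> (Suc l) = \<phi> l * p + (c - 1) * \<phi> l * b + \<phi> (Suc l) * (1 - p)"
    using \<phi>_nonneg \<open>1 \<le> c\<close> by (subst (asm) ennreal_inj) (auto simp: p_def b_def)
  \<comment> \<open>\<open>\<phi> (Suc l)\<close> occurs on both sides, with weight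
    \<open>1 - p\<close> on the right for a skipped point; as \<open>p\<close> is positive, the
    equation can be solved for it.\<close>
  then have "\<phi> (Suc l) * p = \<phi> l * (p + (c - 1) * b)" by (simp add: algebra_simps)
  also have "\<dots> \<le> \<phi> l * (p + (c - 1) * (r * p))"
    using r \<open>1 \<le> c\<close> \<phi>_nonneg by (intro mult_left_mono add_left_mono) (auto simp: p_def b_def)
  also have "\<dots> = \<phi> l * (1 + (c - 1) * r) * p" by (simp add: algebra_simps)
  finally have "\<phi> (Suc l) \<le> \<phi> l * (1 + (c - 1) * r)"
    using pos by (simp add: p_def)
  also have "\<dots> \<le> (1 + (c - 1) * r) ^ l * (1 + (c - 1) * r)"
    using Suc \<open>1 \<le> c\<close> \<open>0 \<le> r\<close> unfolding \<phi> by (intro mult_right_mono) (auto simp: ennreal_le_iff)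
  finally show ?case unfolding \<phi> by (intro ennreal_leI) (simp add: mult.commute)
qed

text \<open>Exponential Markov inequality at base \<open>c\<close>: each of the \<open>l\<close>
  places contributes at most \<open>1 + (c - 1) * r\<close> to the moment and
  \<open>c powr \<theta>\<close> to the threshold, and \<open>\<rho>\<close> bounds the
  quotient.\<close>

lemma prob_lead_count:
  fixes c :: real
  assumes D [measurable]: "Measurable.pred P D" and B [measurable]: "Measurable.pred P B"
    and pos: "0 < \<P>(x in P. D x)"
    and r: "\<P>(x in P. D x \<and> B x) \<le> r * \<P>(x in P. D x)" and "0 \<le> r" "1 \<le> c"
    and \<rho>: "1 + (c - 1) * r \<le> \<rho> * c powr \<theta>" "0 \<le> \<rho>"
  shows "\<P>(w in Q. \<theta> * real l \<le> real (lead_count D B l w)) \<le> \<rho> ^ l"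
proof -
  note [measurable] = measurable_lead_count[OF D B]
  have "0 < c" using \<open>1 \<le> c\<close> by simp
  define G where "G = (\<lambda>w. ennreal (c powr (- (\<theta> * real l))) * ennreal (c ^ lead_count D B l w))"
  show ?thesis
  proof (rule measure_le_nn_integral[where G = G])
    fix w assume *: "\<theta> * real l \<le> real (lead_count D B l w)"
    have "1 \<le> c powr (- (\<theta> * real l) + real (lead_count D B l w))"
      using * \<open>1 \<le> c\<close> by (intro ge_one_powr_ge_zero) auto
    also have "\<dots> = c powr (- (\<theta> * real l)) * c ^ lead_count D B l w"
      by (simp only: powr_add powr_realpow[OF \<open>0 < c\<close>])
    finally show "1 \<le> G w"
      unfolding G_def using \<open>0 < c\<close> by (simp add: ennreal_mult'[symmetric])
  next
    have "(\<integral>\<^sup>+ w. G w \<partial>Q) = ennreal (c powr (- (\<theta> * real l))) * (\<integral>\<^sup>+ w. ennreal (c ^ lead_count D B l w) \<partial>Q)"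
      unfolding G_def by (rule nn_integral_cmult) measurable
    also have "\<dots> \<le> ennreal (c powr (- (\<theta> * real l))) * ennreal ((1 + (c - 1) * r) ^ l)"
      by (intro mult_left_mono lead_count_moment[OF D B pos r]) (use assms in auto)
    also have "\<dots> = ennreal (c powr (- (\<theta> * real l)) * (1 + (c - 1) * r) ^ l)"
      by (simp add: ennreal_mult')
    also have "\<dots> \<le> ennreal (\<rho> ^ l)"
    proof (rule ennreal_leI)
      have "c powr (- (\<theta> * real l)) * (1 + (c - 1) * r) ^ l \<le> c powr (- (\<theta> * real l)) * (\<rho> * c powr \<theta>) ^ l"
        using \<rho> \<open>1 \<le> c\<close> \<open>0 \<le> r\<close> by (intro mult_left_mono power_mono) auto
      also have "(\<rho> * c powr \<theta>) ^ l = \<rho> ^ l * c powr (\<theta> * real l)"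
        using \<open>0 < c\<close> by (simp add: power_mult_distrib powr_powr[symmetric] powr_realpow)
      also have "c powr (- (\<theta> * real l)) * (\<rho> ^ l * c powr (\<theta> * real l)) = \<rho> ^ l"
        using \<open>0 < c\<close> by (simp add: powr_minus field_simps)
      finally show "c powr (- (\<theta> * real l)) * (1 + (c - 1) * r) ^ l \<le> \<rho> ^ l" .
    qed
    finally show "(\<integral>\<^sup>+ w. G w \<partial>Q) \<le> ennreal (\<rho> ^ l)" .
  next
    show "G \<in> borel_measurable Q" unfolding G_def by measurable
  qed (use \<rho> in \<open>measurable, simp\<close>)
qed

end

text \<open>From the exponential moments with base \<open>7 / 5\<close> at the error rates \<open>1 / 2\<close> and \<open>1 / 3\<close>.\<close>

definition select_rate :: real where
  "select_rate = max ((6 / 5) / (7 / 5) powr (7 / 12)) ((17 / 15) / (7 / 5) powr (5 / 12))"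

lemma select_rate:
  "1 + (7 / 5 - 1) * (1 / 2) \<le> select_rate * (7 / 5) powr (7 / 12)"
  "1 + (7 / 5 - 1) * (1 / 3) \<le> select_rate * (7 / 5) powr (5 / 12)"
  "0 < select_rate" "select_rate < 1"
proof -
  have 1: "(6 / 5) / (7 / 5) powr (7 / 12) \<le> select_rate"
    and 2: "(17 / 15) / (7 / 5) powr (5 / 12) \<le> select_rate"
    by (simp_all add: select_rate_def)
  show "1 + (7 / 5 - 1) * (1 / 2) \<le> select_rate * (7 / 5) powr (7 / 12)"
    using 1 by (simp add: pos_divide_le_eq)
  show "1 + (7 / 5 - 1) * (1 / 3) \<le> select_rate * (7 / 5) powr (5 / 12)"
    using 2 by (simp add: pos_divide_le_eq)
  show "0 < select_rate" by (simp add: select_rate_def less_max_iff_disj)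
  \<comment> \<open>Twelfth powers reduce the claim to the rational inequalities
    \<open>(6 / 5) ^ 12 < (7 / 5) ^ 7\<close> and
    \<open>(17 / 15) ^ 12 < (7 / 5) ^ 5\<close>.\<close>
  have pw: "x < y powr (a / 12)" if "x ^ 12 < y ^ a" "0 < y" for x y :: real and a :: nat
  proof (rule power_less_imp_less_base)
    have "(y powr (a / 12)) ^ 12 = y powr ((a / 12) * real 12)"
      using that by (simp only: powr_powr[symmetric]) (simp add: powr_realpow)
    also have "\<dots> = y ^ a" using that by (simp add: powr_realpow)
    finally show "x ^ 12 < (y powr (a / 12)) ^ 12" using that by simp
  qed simp
  have "6 / 5 < (7 / 5 :: real) powr (7 / 12)" using pw[of "6 / 5" "7 / 5" 7] by (simp add: power_divide)
  moreover have "17 / 15 < (7 / 5 :: real) powr (5 / 12)" using pw[of "17 / 15" "7 / 5" 5] by (simp add: power_divide)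
  ultimately show "select_rate < 1" by (simp add: select_rate_def)
qed

context problem
begin

definition error_prob :: "('a \<Rightarrow> bool) \<Rightarrow> 'a classifier \<Rightarrow> real" where
  "error_prob D h = \<P>(x in P. D x \<and> h x \<noteq> f x)"

text \<open>The threshold \<open>7 / 12\<close> lies halfway between \<open>1 / 2\<close> and
  \<open>2 / 3\<close>: a hypothesis wrong on at most half of the disagreement region should pass,
  one wrong on more than two thirds should not, and in between either outcome is harmless.
  Multiplied out, the conditions also make sense for \<open>p = 0\<close>.\<close>

definition misleads :: "(nat \<Rightarrow> 'a classifier) \<Rightarrow> (nat \<Rightarrow> 'a) \<Rightarrow> nat \<Rightarrow> nat \<Rightarrow> nat \<Rightarrow> nat \<Rightarrow> bool" where
  "misleads h X u l j k \<longleftrightarrow>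
     (let p = \<P>(x in P. h j x \<noteq> h k x); e = error_prob (\<lambda>x. h j x \<noteq> h k x) (h k);
          c = comparison X (\<lambda>i. f (X i)) u l {x. h j x \<noteq> h k x} (h k)
      in 2 * e \<le> p \<and> 7 / 12 < c \<or> 2 * p < 3 * e \<and> c \<le> 7 / 12)"

lemma pred_P_iff: "Measurable.pred P D = Measurable.pred M D"
  by (simp add: measurable_cong_sets[OF sets_P refl])

text \<open>The points compared are the first fresh ones in the region \<open>D\<close>, with error
  rate \<open>e / p\<close>. Wrong rejection is an upward deviation of the number of errors, from a
  rate of at most \<open>1 / 2\<close> to \<open>7 / 12\<close>; wrong acceptance is one of the
  number of correct points, from at most \<open>1 / 3\<close> to \<open>5 / 12\<close>. If fewer
  than \<open>l\<close> points are found, counting the missing ones as hits keeps these inclusions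
  valid.\<close>

lemma prob_misleads:
  assumes h: "h j \<in> classifiers M" "h k \<in> classifiers M" and v: "v \<in> space Q"
  shows "\<P>(w in Q. misleads h (comb_seq (u + 1) v w) u l j k) \<le> select_rate ^ l"
proof -
  have [measurable]: "Measurable.pred P (h j)" "Measurable.pred P (h k)" "Measurable.pred P f"
    using h f_measurable by (simp_all add: classifiers_def pred_P_iff)
  define D where "D = (\<lambda>x. h j x \<noteq> h k x)"
  define B where "B = (\<lambda>x. h k x \<noteq> f x)"
  have D [measurable]: "Measurable.pred P D" and B [measurable]: "Measurable.pred P B"
    unfolding D_def B_def by measurable
  have B' [measurable]: "Measurable.pred P (\<lambda>x. \<not> B x)" by measurable
  define p where "p = \<P>(x in P. D x)"
  define e where "e = error_prob D (h k)"
  have e: "e = \<P>(x in P. D x \<and> B x)" by (simp add: e_def error_prob_def B_def)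
  have e_le: "e \<le> p" unfolding e p_def by (rule finite_measure_mono) auto
  define \<kappa> where "\<kappa> = (\<lambda>w. comparison (comb_seq (u + 1) v w) (\<lambda>i. f (comb_seq (u + 1) v w i)) u l {x. D x} (h k))"
  have \<kappa>: "\<kappa> w = real (card {i \<in> lead_set w D l. B (w i)}) / real (card (lead_set w D l))" for w
  proof -
    have "shift (u + 1) (comb_seq (u + 1) v w) = w" using shift_comb_seq[of 0 "u + 1" v w] by simp
    then show ?thesis
      unfolding \<kappa>_def comparison_def
      using card_first_set(1)[of "comb_seq (u + 1) v w" u D l]
        card_first_set(2)[of "comb_seq (u + 1) v w" u D l B] by (simp only: B_def)
  qed
  have mis: "misleads h (comb_seq (u + 1) v w) u l j k \<longleftrightarrow> 2 * e \<le> p \<and> 7 / 12 < \<kappa> w \<or> 2 * p < 3 * e \<and> \<kappa> w \<le> 7 / 12" for w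
    unfolding misleads_def Let_def p_def e_def \<kappa>_def D_def by (rule refl)
  have le: "card {i \<in> lead_set w D l. B (w i)} \<le> card (lead_set w D l)" "card (lead_set w D l) \<le> l" for w
    by (auto intro!: card_mono lead_set_finite card_lead_set_le)
  consider "2 * e \<le> p" "p = 0" | "2 * e \<le> p" "0 < p" | "2 * p < 3 * e" | "\<not> 2 * e \<le> p" "\<not> 2 * p < 3 * e"
    using measure_nonneg[of P "{x \<in> space P. D x}"] unfolding p_def by linarith
  then show ?thesis
  proof cases
    case 1
    \<comment> \<open>A null region almost surely contains no point of the sequence, and the
      comparison is then \<open>0 / 0 = 0\<close>.\<close>
    have "AE x in P. \<not> D x"
      using 1 prob_eq_0[of "{x \<in> space P. D x}"] unfolding p_def by auto
    then have "AE w in Q. \<not> D (w i)" for i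
      unfolding sequences_def by (rule S.AE_component[OF UNIV_I])
    then have "AE w in Q. \<forall>i. \<not> D (w i)" by (simp add: AE_all_countable)
    then have "AE w in Q. \<not> misleads h (comb_seq (u + 1) v w) u l j k"
    proof (rule AE_mp, intro AE_I2 impI)
      fix w :: "nat \<Rightarrow> 'a" assume "\<forall>i. \<not> D (w i)"
      then have "\<kappa> w = 0" by (simp add: \<kappa> lead_set_def)
      then show "\<not> misleads h (comb_seq (u + 1) v w) u l j k" unfolding mis using 1 e_le by simp
    qed
    then obtain N where "{w \<in> space Q. \<not> \<not> misleads h (comb_seq (u + 1) v w) u l j k} \<subseteq> N"
        "emeasure Q N = 0" "N \<in> sets Q"
      by (rule AE_E)
    then have "emeasure Q {w \<in> space Q. misleads h (comb_seq (u + 1) v w) u l j k} = 0"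
      using emeasure_mono[of _ N Q] by (metis (no_types, lifting) le_zero_eq not_not)
    then show ?thesis using select_rate(3) by (simp add: measure_def)
  next
    case 2
    have "\<P>(w in Q. misleads h (comb_seq (u + 1) v w) u l j k)
        \<le> \<P>(w in Q. 7 / 12 * real l \<le> real (lead_count D B l w))"
    proof (rule Q.finite_measure_mono)
      show "{w \<in> space Q. misleads h (comb_seq (u + 1) v w) u l j k}
        \<subseteq> {w \<in> space Q. 7 / 12 * real l \<le> real (lead_count D B l w)}"
      proof safe
        fix w assume "misleads h (comb_seq (u + 1) v w) u l j k"
        then have k: "7 / 12 < \<kappa> w" using 2 unfolding mis by auto
        then have "0 < real (card (lead_set w D l))" unfolding \<kappa> by (cases "card (lead_set w D l) = 0") simp_all
        then have "7 / 12 * real (card (lead_set w D l)) \<le> real (card {i \<in> lead_set w D l. B (w i)})"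
          using k by (simp add: \<kappa> field_simps)
        then show "7 / 12 * real l \<le> real (lead_count D B l w)"
          using le[of w] by (simp add: lead_count_def of_nat_diff)
      qed
    qed (use measurable_lead_count[OF D B] in measurable)
    also have "\<dots> \<le> select_rate ^ l"
      by (rule prob_lead_count[OF D B, where r = "1 / 2" and c = "7 / 5"])
        (use 2 select_rate in \<open>auto simp: p_def e\<close>)
    finally show ?thesis .
  next
    case 3
    have p: "0 < p" using 3 e_le measure_nonneg[of P "{x \<in> space P. D x}"] unfolding p_def by linarith
    have "\<P>(x in P. D x \<and> \<not> B x) = p - e"
    proof -
      have "{x \<in> space P. D x \<and> \<not> B x} = {x \<in> space P. D x} - {x \<in> space P. D x \<and> B x}" by auto
      moreover have "{x \<in> space P. D x \<and> B x} \<subseteq> {x \<in> space P. D x}" by auto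
      ultimately show ?thesis by (simp add: p_def e finite_measure_Diff)
    qed
    then have r: "\<P>(x in P. D x \<and> \<not> B x) \<le> 1 / 3 * \<P>(x in P. D x)"
      using 3 by (simp add: p_def)
    have "\<P>(w in Q. misleads h (comb_seq (u + 1) v w) u l j k)
        \<le> \<P>(w in Q. 5 / 12 * real l \<le> real (lead_count D (\<lambda>x. \<not> B x) l w))"
    proof (rule Q.finite_measure_mono)
      show "{w \<in> space Q. misleads h (comb_seq (u + 1) v w) u l j k}
        \<subseteq> {w \<in> space Q. 5 / 12 * real l \<le> real (lead_count D (\<lambda>x. \<not> B x) l w)}"
      proof safe
        fix w assume "misleads h (comb_seq (u + 1) v w) u l j k"
        then have k: "\<kappa> w \<le> 7 / 12" using 3 p unfolding mis by auto
        have "real (card {i \<in> lead_set w D l. B (w i)}) \<le> 7 / 12 * real (card (lead_set w D l))"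
        proof (cases "card (lead_set w D l) = 0")
          case True
          then show ?thesis using le(1)[of w] by simp
        next
          case False
          then show ?thesis using k by (simp add: \<kappa> field_simps)
        qed
        moreover have "{i \<in> lead_set w D l. \<not> B (w i)} = lead_set w D l - {i \<in> lead_set w D l. B (w i)}" by auto
        then have "card {i \<in> lead_set w D l. \<not> B (w i)} = card (lead_set w D l) - card {i \<in> lead_set w D l. B (w i)}"
          using lead_set_finite[of w D l] by (simp add: card_Diff_subset)
        ultimately show "5 / 12 * real l \<le> real (lead_count D (\<lambda>x. \<not> B x) l w)"
          using le[of w] by (simp add: lead_count_def of_nat_diff)
      qed
    qed (use measurable_lead_count[OF D B'] in measurable)
    also have "\<dots> \<le> select_rate ^ l"
      by (rule prob_lead_count[OF D B' _ r, where c = "7 / 5"])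
        (use p select_rate in \<open>auto simp: p_def\<close>)
    finally show ?thesis .
  next
    case 4
    then show ?thesis unfolding mis using select_rate(3) by simp
  qed
qed

lemma er_decompose:
  assumes [measurable]: "Measurable.pred P D" and h: "h \<in> classifiers M"
  shows "er P f h = error_prob D h + error_prob (\<lambda>x. \<not> D x) h"
proof -
  have [measurable]: "Measurable.pred P h" "Measurable.pred P f"
    using h f_measurable by (simp_all add: classifiers_def pred_P_iff)
  have "{x \<in> space P. h x \<noteq> f x} = {x \<in> space P. D x \<and> h x \<noteq> f x} \<union> {x \<in> space P. \<not> D x \<and> h x \<noteq> f x}" by auto
  then show ?thesis
    unfolding er_def error_prob_def by (simp only:) (rule finite_measure_Union; auto)
qed

text \<open>Let \<open>k0\<close> have least error. Off a disagreement region the two hypotheses err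
  alike and on it exactly one errs, so \<open>k0\<close> is wrong on at most half of each region and
  passes all its tests. The selected \<open>k\<close> is at least \<open>k0\<close>. If it is
  larger, it has passed the test against \<open>k0\<close>, so it is wrong on at most two thirds of
  their region and \<open>k0\<close> on at least one third; this is the factor 2.\<close>

lemma er_selected_le:
  assumes h: "\<And>k. k \<in> {1..N} \<Longrightarrow> h k \<in> classifiers M"
    and mis: "\<And>j k. j \<in> {1..<k} \<Longrightarrow> k \<in> {1..N} \<Longrightarrow> \<not> misleads h X u (comparison_size N m j) j k"
    and q: "q \<in> {1..N}"
  shows "er P f (h (selected h N m X (\<lambda>i. f (X i)) u)) \<le> 2 * er P f (h q)"
proof -
  define c where "c = (\<lambda>j k. comparison X (\<lambda>i. f (X i)) u (comparison_size N m j) {x. h j x \<noteq> h k x} (h k))"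
  define S where "S = {k \<in> {1..N}. \<forall>j\<in>{1..<k}. c j k \<le> 7 / 12}"
  have sel: "selected h N m X (\<lambda>i. f (X i)) u = Max S" by (simp only: selected_def S_def c_def)
  define k0 where "k0 = arg_min_on (\<lambda>k. er P f (h k)) {1..N}"
  have k0: "k0 \<in> {1..N}" and min: "\<And>k. k \<in> {1..N} \<Longrightarrow> er P f (h k0) \<le> er P f (h k)"
    unfolding k0_def using q by (auto intro!: arg_min_least arg_min_if_finite(1)[of "{1..N}", simplified])
  have meas: "Measurable.pred P (h k)" if "k \<in> {1..N}" for k
    using h[OF that] by (simp add: classifiers_def pred_P_iff)
  have diff: "Measurable.pred P (\<lambda>x. h j x \<noteq> h k x)" if "j \<in> {1..N}" "k \<in> {1..N}" for j k
    using meas[OF that(1)] meas[OF that(2)] by measurable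
  have split: "error_prob (\<lambda>x. h j x \<noteq> h k x) (h j) + error_prob (\<lambda>x. h j x \<noteq> h k x) (h k)
      = \<P>(x in P. h j x \<noteq> h k x)"
    and same: "error_prob (\<lambda>x. \<not> h j x \<noteq> h k x) (h j) = error_prob (\<lambda>x. \<not> h j x \<noteq> h k x) (h k)"
    if jk: "j \<in> {1..N}" "k \<in> {1..N}" for j k
  proof -
    note [measurable] = meas[OF jk(1)] meas[OF jk(2)]
    have [measurable]: "Measurable.pred P f" using f_measurable by (simp add: pred_P_iff)
    have "{x \<in> space P. h j x \<noteq> h k x} = {x \<in> space P. h j x \<noteq> h k x \<and> h j x \<noteq> f x}
        \<union> {x \<in> space P. h j x \<noteq> h k x \<and> h k x \<noteq> f x}"
      by auto
    moreover have "measure P ({x \<in> space P. h j x \<noteq> h k x \<and> h j x \<noteq> f x}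
        \<union> {x \<in> space P. h j x \<noteq> h k x \<and> h k x \<noteq> f x})
      = error_prob (\<lambda>x. h j x \<noteq> h k x) (h j) + error_prob (\<lambda>x. h j x \<noteq> h k x) (h k)"
      unfolding error_prob_def by (rule finite_measure_Union) auto
    ultimately show "error_prob (\<lambda>x. h j x \<noteq> h k x) (h j) + error_prob (\<lambda>x. h j x \<noteq> h k x) (h k)
      = \<P>(x in P. h j x \<noteq> h k x)" by simp
    show "error_prob (\<lambda>x. \<not> h j x \<noteq> h k x) (h j) = error_prob (\<lambda>x. \<not> h j x \<noteq> h k x) (h k)"
      unfolding error_prob_def by (rule arg_cong[where f = "measure P"]) auto
  qed
  have "c j k0 \<le> 7 / 12" if j: "j \<in> {1..<k0}" for j
  proof -
    have j': "j \<in> {1..N}" using j k0 by auto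
    have "er P f (h k0) \<le> er P f (h j)" by (rule min[OF j'])
    then have "2 * error_prob (\<lambda>x. h j x \<noteq> h k0 x) (h k0) \<le> \<P>(x in P. h j x \<noteq> h k0 x)"
      using er_decompose[OF diff[OF j' k0] h[OF k0]] er_decompose[OF diff[OF j' k0] h[OF j']]
        split[OF j' k0] same[OF j' k0] by linarith
    then show ?thesis using mis[OF j k0] by (auto simp: misleads_def Let_def c_def)
  qed
  then have k0S: "k0 \<in> S" using k0 by (auto simp: S_def)
  have "finite S" by (simp add: S_def)
  define k where "k = Max S"
  have kS: "k \<in> S" and k0k: "k0 \<le> k"
    unfolding k_def using \<open>finite S\<close> k0S by (auto intro: Max_in)
  have k: "k \<in> {1..N}" using kS by (simp add: S_def)
  have "er P f (h k) \<le> 2 * er P f (h k0)"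
  proof (cases "k = k0")
    case True
    then show ?thesis by (simp add: er_def)
  next
    case False
    then have j: "k0 \<in> {1..<k}" using k0k k0 by simp
    then have "c k0 k \<le> 7 / 12" using kS by (simp add: S_def)
    then have "\<not> 2 * \<P>(x in P. h k0 x \<noteq> h k x) < 3 * error_prob (\<lambda>x. h k0 x \<noteq> h k x) (h k)"
      using mis[OF j k] by (auto simp: misleads_def Let_def c_def)
    moreover have "0 \<le> error_prob (\<lambda>x. \<not> h k0 x \<noteq> h k x) (h k)" by (simp add: error_prob_def)
    ultimately show ?thesis
      using er_decompose[OF diff[OF k0 k] h[OF k]] er_decompose[OF diff[OF k0 k] h[OF k0]]
        split[OF k0 k] same[OF k0 k] by linarith
  qed
  also have "\<dots> \<le> 2 * er P f (h q)" using min[OF q] by simp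
  finally show ?thesis by (simp add: sel k_def)
qed

end

section \<open>Exponentially small quantities\<close>

definition exponentially_small :: "(nat \<Rightarrow> real) \<Rightarrow> bool" where
  "exponentially_small \<delta> \<longleftrightarrow> (\<exists>c>0. \<forall>\<^sub>F n in sequentially. \<delta> n \<le> exp (- c * real n))"

lemma exponentially_small_mono:
  assumes "exponentially_small \<delta>'" "\<forall>\<^sub>F n in sequentially. \<delta> n \<le> \<delta>' n"
  shows "exponentially_small \<delta>"
proof -
  obtain c where c: "0 < c" "\<forall>\<^sub>F n in sequentially. \<delta>' n \<le> exp (- c * real n)"
    using assms(1) by (auto simp: exponentially_small_def)
  have "\<forall>\<^sub>F n in sequentially. \<delta> n \<le> exp (- c * real n)"
    using c(2) assms(2) by eventually_elim simp
  then show ?thesis using c(1) by (auto simp: exponentially_small_def)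
qed

lemma exponentially_small_add:
  assumes "exponentially_small \<delta>" "exponentially_small \<delta>'"
  shows "exponentially_small (\<lambda>n. \<delta> n + \<delta>' n)"
proof -
  obtain c where c: "0 < c" "\<forall>\<^sub>F n in sequentially. \<delta> n \<le> exp (- c * real n)"
    using assms(1) by (auto simp: exponentially_small_def)
  obtain c' where c': "0 < c'" "\<forall>\<^sub>F n in sequentially. \<delta>' n \<le> exp (- c' * real n)"
    using assms(2) by (auto simp: exponentially_small_def)
  define b where "b = min c c'"
  have b: "0 < b" using c c' by (simp add: b_def)
  have "\<forall>\<^sub>F n in sequentially. 2 * exp (- b * real n) \<le> exp (- (b / 2) * real n)"
    using b by real_asymp
  then have "\<forall>\<^sub>F n in sequentially. \<delta> n + \<delta>' n \<le> exp (- (b / 2) * real n)"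
    using c(2) c'(2)
  proof eventually_elim
    case (elim n)
    have "exp (- c * real n) \<le> exp (- b * real n)" "exp (- c' * real n) \<le> exp (- b * real n)"
      by (auto simp: b_def mult_right_mono)
    then show ?case using elim by linarith
  qed
  then show ?thesis using b unfolding exponentially_small_def by (intro exI[of _ "b / 2"]) simp
qed

text \<open>The cube comes from union bounds over polynomially many events, the integer division
  from sample sizes that are fractions of \<open>n\<close>.\<close>

lemma exponentially_small_div:
  assumes "0 < c" "0 < b"
  shows "exponentially_small (\<lambda>n. a * real n ^ 3 * exp (- c * real (n div b)))"
proof -
  define d where "d = c / real b"
  have d: "0 < d" using assms by (simp add: d_def)
  \<comment> \<open>The factor \<open>exp c\<close> compensates for rounding down in
    \<open>n div b\<close>; adding 1 makes \<open>e\<close> positive.\<close>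
  define e where "e = \<bar>a\<bar> * exp c + 1"
  have e: "0 < e" by (simp add: e_def add_pos_pos add_nonneg_pos)
  have "\<forall>\<^sub>F n in sequentially. e * real n ^ 3 * exp (- d * real n) \<le> exp (- (d / 2) * real n)"
    using d e by real_asymp
  then have "\<forall>\<^sub>F n in sequentially. a * real n ^ 3 * exp (- c * real (n div b)) \<le> exp (- (d / 2) * real n)"
  proof eventually_elim
    case (elim n)
    have "real n / real b - 1 \<le> real (n div b)"
    proof -
      have "n \<le> b * (n div b + 1)"
        using dividend_less_times_div[OF assms(2), of n] by simp
      then have "real n \<le> real b * (real (n div b) + 1)"
        by (metis of_nat_1 of_nat_add of_nat_le_iff of_nat_mult)
      then show ?thesis using assms(2) by (simp add: divide_le_eq mult.commute diff_le_eq)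
    qed
    then have "c * (real n / real b - 1) \<le> c * real (n div b)" using assms(1) by (intro mult_left_mono) auto
    then have "exp (- c * real (n div b)) \<le> exp (c + - d * real n)"
      by (simp add: d_def algebra_simps)
    then have "\<bar>a\<bar> * real n ^ 3 * exp (- c * real (n div b)) \<le> \<bar>a\<bar> * real n ^ 3 * exp (c + - d * real n)"
      by (intro mult_left_mono) auto
    moreover have "a * real n ^ 3 * exp (- c * real (n div b)) \<le> \<bar>a\<bar> * real n ^ 3 * exp (- c * real (n div b))"
      by (intro mult_right_mono) auto
    moreover have "\<bar>a\<bar> * real n ^ 3 * exp (c + - d * real n) = (\<bar>a\<bar> * exp c) * (real n ^ 3 * exp (- d * real n))"
      by (simp only: exp_add mult_ac)
    moreover have "(\<bar>a\<bar> * exp c) * (real n ^ 3 * exp (- d * real n)) \<le> e * (real n ^ 3 * exp (- d * real n))"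
      unfolding e_def by (intro mult_right_mono) auto
    ultimately show ?case using elim by (simp only: mult.assoc)
  qed
  then show ?thesis using d unfolding exponentially_small_def by (intro exI[of _ "d / 2"]) simp
qed

lemma exponentially_small_power_div:
  fixes q :: real
  assumes "0 \<le> q" "q < 1" "0 < b"
  shows "exponentially_small (\<lambda>n. a * q ^ (n div b))"
proof (rule exponentially_small_mono)
  \<comment> \<open>The rate \<open>- ln q'\<close> needs a positive base, whereas
    \<open>q = 0\<close> is possible.\<close>
  define q' where "q' = max q (1 / 2)"
  have q': "0 < q'" "q' < 1" "q \<le> q'" using assms by (auto simp: q'_def)
  show "exponentially_small (\<lambda>n. \<bar>a\<bar> * real n ^ 3 * exp (- (- ln q') * real (n div b)))"
    using q' assms by (intro exponentially_small_div) auto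
  show "\<forall>\<^sub>F n in sequentially. a * q ^ (n div b) \<le> \<bar>a\<bar> * real n ^ 3 * exp (- (- ln q') * real (n div b))"
    using eventually_ge_at_top[of "1::nat"]
  proof eventually_elim
    case (elim n)
    have "a * q ^ (n div b) \<le> \<bar>a\<bar> * q ^ (n div b)" using assms by (intro mult_right_mono) auto
    also have "\<dots> \<le> \<bar>a\<bar> * q' ^ (n div b)" using assms q' by (intro mult_left_mono power_mono) auto
    also have "\<dots> \<le> (\<bar>a\<bar> * real n ^ 3) * q' ^ (n div b)"
      using elim q' by (intro mult_right_mono) (auto simp: mult_le_cancel_left1 one_le_power)
    also have "q' ^ (n div b) = exp (- (- ln q') * real (n div b))"
      using q' by (simp add: exp_of_nat2_mult)
    finally show ?case .
  qed
qed

section \<open>Sections of product measures\<close>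

lemma prob_pair_le:
  assumes "prob_space M1" "prob_space M2" and \<phi>: "Measurable.pred (M1 \<Otimes>\<^sub>M M2) \<phi>" and "0 \<le> \<delta>"
    and le: "\<And>x. x \<in> space M1 \<Longrightarrow> measure M2 {y \<in> space M2. \<phi> (x, y)} \<le> \<delta>"
  shows "measure (M1 \<Otimes>\<^sub>M M2) {z \<in> space (M1 \<Otimes>\<^sub>M M2). \<phi> z} \<le> \<delta>"
proof -
  interpret M1: prob_space M1 by fact
  interpret M2: prob_space M2 by fact
  interpret pair_prob_space M1 M2 ..
  have "emeasure (M1 \<Otimes>\<^sub>M M2) {z \<in> space (M1 \<Otimes>\<^sub>M M2). \<phi> z}
      = (\<integral>\<^sup>+ x. emeasure M2 (Pair x -` {z \<in> space (M1 \<Otimes>\<^sub>M M2). \<phi> z}) \<partial>M1)"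
    using \<phi> by (intro M2.emeasure_pair_measure_alt) (simp add: pred_def)
  also have "\<dots> \<le> (\<integral>\<^sup>+ x. ennreal \<delta> \<partial>M1)"
  proof (rule nn_integral_mono)
    fix x assume x: "x \<in> space M1"
    then have "Pair x -` {z \<in> space (M1 \<Otimes>\<^sub>M M2). \<phi> z} = {y \<in> space M2. \<phi> (x, y)}"
      by (auto simp: space_pair_measure)
    then show "emeasure M2 (Pair x -` {z \<in> space (M1 \<Otimes>\<^sub>M M2). \<phi> z}) \<le> ennreal \<delta>"
      using le[OF x] by (simp add: M2.emeasure_eq_measure ennreal_leI)
  qed
  also have "\<dots> = ennreal \<delta>" by (simp add: M1.emeasure_space_1)
  finally show ?thesis using \<open>0 \<le> \<delta>\<close> by (simp add: emeasure_eq_measure)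
qed

lemma prob_pair_le_swap:
  assumes "prob_space M1" "prob_space M2" and \<phi>: "Measurable.pred (M1 \<Otimes>\<^sub>M M2) \<phi>" and "0 \<le> \<delta>"
    and le: "\<And>y. y \<in> space M2 \<Longrightarrow> measure M1 {x \<in> space M1. \<phi> (x, y)} \<le> \<delta>"
  shows "measure (M1 \<Otimes>\<^sub>M M2) {z \<in> space (M1 \<Otimes>\<^sub>M M2). \<phi> z} \<le> \<delta>"
proof -
  interpret M1: prob_space M1 by fact
  interpret M2: prob_space M2 by fact
  interpret pair_prob_space M1 M2 ..
  have "emeasure (M1 \<Otimes>\<^sub>M M2) {z \<in> space (M1 \<Otimes>\<^sub>M M2). \<phi> z}
      = (\<integral>\<^sup>+ y. emeasure M1 ((\<lambda>x. (x, y)) -` {z \<in> space (M1 \<Otimes>\<^sub>M M2). \<phi> z}) \<partial>M2)"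
    using \<phi> by (intro emeasure_pair_measure_alt2) (simp add: pred_def)
  also have "\<dots> \<le> (\<integral>\<^sup>+ y. ennreal \<delta> \<partial>M2)"
  proof (rule nn_integral_mono)
    fix y assume y: "y \<in> space M2"
    then have "(\<lambda>x. (x, y)) -` {z \<in> space (M1 \<Otimes>\<^sub>M M2). \<phi> z} = {x \<in> space M1. \<phi> (x, y)}"
      by (auto simp: space_pair_measure)
    then show "emeasure M1 ((\<lambda>x. (x, y)) -` {z \<in> space (M1 \<Otimes>\<^sub>M M2). \<phi> z}) \<le> ennreal \<delta>"
      using le[OF y] by (simp add: M1.emeasure_eq_measure ennreal_leI)
  qed
  also have "\<dots> = ennreal \<delta>" by (simp add: M2.emeasure_space_1)
  finally show ?thesis using \<open>0 \<le> \<delta>\<close> by (simp add: emeasure_eq_measure)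
qed

lemma prob_space_pair:
  assumes "prob_space M1" "prob_space M2" shows "prob_space (M1 \<Otimes>\<^sub>M M2)"
proof -
  interpret M1: prob_space M1 by fact
  interpret M2: prob_space M2 by fact
  interpret pair_prob_space M1 M2 ..
  show ?thesis by (rule P.prob_space_axioms)
qed

lemma (in prob_space) prob_Bex_le:
  assumes "finite I" "\<And>i. i \<in> I \<Longrightarrow> Measurable.pred M (\<phi> i)" "\<And>i. i \<in> I \<Longrightarrow> prob {x \<in> space M. \<phi> i x} \<le> b"
  shows "prob {x \<in> space M. \<exists>i\<in>I. \<phi> i x} \<le> real (card I) * b"
proof -
  have "{x \<in> space M. \<exists>i\<in>I. \<phi> i x} = (\<Union>i\<in>I. {x \<in> space M. \<phi> i x})" by auto
  then have "prob {x \<in> space M. \<exists>i\<in>I. \<phi> i x} \<le> (\<Sum>i\<in>I. prob {x \<in> space M. \<phi> i x})"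
    using finite_measure_subadditive_finite[OF assms(1), of "\<lambda>i. {x \<in> space M. \<phi> i x}"] assms(2)
    by (auto simp: pred_def)
  also have "\<dots> \<le> (\<Sum>i\<in>I. b)" by (intro sum_mono assms(3))
  finally show ?thesis by simp
qed

lemma (in prob_space) prob_disj_le:
  assumes "Measurable.pred M \<phi>" "Measurable.pred M \<psi>"
    "prob {x \<in> space M. \<phi> x} \<le> a" "prob {x \<in> space M. \<psi> x} \<le> b"
  shows "prob {x \<in> space M. \<phi> x \<or> \<psi> x} \<le> a + b"
proof -
  have "{x \<in> space M. \<phi> x \<or> \<psi> x} = {x \<in> space M. \<phi> x} \<union> {x \<in> space M. \<psi> x}" by auto
  then have "prob {x \<in> space M. \<phi> x \<or> \<psi> x} \<le> prob {x \<in> space M. \<phi> x} + prob {x \<in> space M. \<psi> x}"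
    using assms(1,2) by (simp only: pred_def measure_Un_le)
  then show ?thesis using assms(3,4) by simp
qed

context problem
begin

abbreviation "Q3 \<equiv> unlabeled_data P"

lemma prob_space_QQ: "prob_space (Q \<Otimes>\<^sub>M Q)"
  by (rule prob_space_pair) (rule Q.prob_space_axioms)+

lemma prob_space_Q3: "prob_space Q3"
  unfolding unlabeled_data_def by (rule prob_space_pair[OF Q.prob_space_axioms prob_space_QQ])

lemma Q3_measurable [measurable]:
  "fst \<in> measurable Q3 Q" "(\<lambda>U. fst (snd U)) \<in> measurable Q3 Q" "(\<lambda>U. snd (snd U)) \<in> measurable Q3 Q"
  unfolding unlabeled_data_def by measurable

lemma Q3_coordinates:
  "(\<lambda>U. fst U i) \<in> measurable Q3 M" "(\<lambda>U. fst (snd U) i) \<in> measurable Q3 M" "(\<lambda>U. snd (snd U) i) \<in> measurable Q3 M"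
  by measurable

text \<open>The three section lemmas freeze two of the three sequences. \<open>X\<close> stays
  random for \<open>overfull\<close> and for the bounds on version spaces, \<open>w\<close> for
  \<open>misestimates\<close> and \<open>w'\<close> for \<open>deviates\<close>.\<close>

lemma prob_section_X:
  assumes \<phi>: "Measurable.pred Q3 \<phi>" and "0 \<le> \<delta>"
    and le: "\<And>w w'. w \<in> space Q \<Longrightarrow> w' \<in> space Q \<Longrightarrow> \<P>(X in Q. \<phi> (X, w, w')) \<le> \<delta>"
  shows "\<P>(U in Q3. \<phi> U) \<le> \<delta>"
  unfolding unlabeled_data_def
  by (rule prob_pair_le_swap[OF Q.prob_space_axioms prob_space_QQ])
     (use assms in \<open>auto simp: unlabeled_data_def space_pair_measure\<close>)

lemma Pair_measurable_Q3:
  assumes "X \<in> space Q" shows "Pair X \<in> measurable (Q \<Otimes>\<^sub>M Q) Q3"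
  unfolding unlabeled_data_def using assms by (rule measurable_Pair1')

lemma prob_section_w:
  assumes \<phi>: "Measurable.pred Q3 \<phi>" and "0 \<le> \<delta>"
    and le: "\<And>X w'. X \<in> space Q \<Longrightarrow> w' \<in> space Q \<Longrightarrow> \<P>(w in Q. \<phi> (X, w, w')) \<le> \<delta>"
  shows "\<P>(U in Q3. \<phi> U) \<le> \<delta>"
  unfolding unlabeled_data_def
proof (rule prob_pair_le[OF Q.prob_space_axioms prob_space_QQ])
  fix X assume X: "X \<in> space Q"
  show "measure (Q \<Otimes>\<^sub>M Q) {y \<in> space (Q \<Otimes>\<^sub>M Q). \<phi> (X, y)} \<le> \<delta>"
    by (rule prob_pair_le_swap[OF Q.prob_space_axioms Q.prob_space_axioms])
      (use assms X measurable_compose[OF Pair_measurable_Q3[OF X] \<phi>] in auto)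
qed (use assms in \<open>auto simp: unlabeled_data_def\<close>)

lemma prob_section_w':
  assumes \<phi>: "Measurable.pred Q3 \<phi>" and "0 \<le> \<delta>"
    and le: "\<And>X w. X \<in> space Q \<Longrightarrow> w \<in> space Q \<Longrightarrow> measure Q {w' \<in> space Q. \<phi> (X, w, w')} \<le> \<delta>"
  shows "\<P>(U in Q3. \<phi> U) \<le> \<delta>"
  unfolding unlabeled_data_def
proof (rule prob_pair_le[OF Q.prob_space_axioms prob_space_QQ])
  fix X assume X: "X \<in> space Q"
  show "measure (Q \<Otimes>\<^sub>M Q) {y \<in> space (Q \<Otimes>\<^sub>M Q). \<phi> (X, y)} \<le> \<delta>"
    by (rule prob_pair_le[OF Q.prob_space_axioms Q.prob_space_axioms])
      (use assms X measurable_compose[OF Pair_measurable_Q3[OF X] \<phi>] in auto)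
qed (use assms in \<open>auto simp: unlabeled_data_def\<close>)

section \<open>Atypical data are exponentially unlikely\<close>

context
  fixes K n :: nat and \<sigma> c :: real
  assumes \<sigma>: "0 < \<sigma>" and n: "3 \<le> n"
    and c: "c \<le> 2 * \<sigma>\<^sup>2" "c \<le> 2" "c \<le> 1 / (6 * 2 ^ K)"
begin

lemma deviation_rate:
  assumes "n div 3 \<le> j" shows "2 * exp (- 2 * \<sigma>\<^sup>2 * real (j ^ 3)) \<le> 2 * exp (- c * real (n div 3))"
proof -
  have "1 \<le> n div 3" using n by simp
  then have "n div 3 \<le> j ^ 3" using assms self_le_power[of j 3] by linarith
  then have "real (n div 3) \<le> real (j ^ 3)" by (simp only: of_nat_le_iff)
  moreover have "c * real (n div 3) \<le> 2 * \<sigma>\<^sup>2 * real (n div 3)" using c by (intro mult_right_mono) auto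
  ultimately have "c * real (n div 3) \<le> 2 * \<sigma>\<^sup>2 * real (j ^ 3)"
    by (smt (verit) mult_left_mono zero_le_power2)
  then show ?thesis by simp
qed

text \<open>The failures of one round as a single disjunction, so that the union bound can be
  applied disjunct by disjunct.\<close>

definition atypical_round :: "nat \<Rightarrow> 'a unlabeled \<Rightarrow> bool" where
  "atypical_round k U \<longleftrightarrow>
     (let X = fst U; w = fst (snd U); w' = snd (snd U); m = n div 3; H = V m X in
       (\<exists>j\<in>{m + 1..m + n * n}. deviates \<sigma> w' k (j ^ 3) H [] \<or> deviates \<sigma> w' k (j ^ 3) H [X j] \<or>
             deviates \<sigma> w' k (j ^ 3) (restrict_label H (X j) (f (X j))) []) \<or>
       deviates \<sigma> w' k (m ^ 3) H [] \<or> (\<exists>i\<in>{1..m ^ 3}. deviates \<sigma> w' k (m ^ 3) H [w i]) \<or>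
       misestimates (1 / 4) w k m H \<or> misestimates (1 / 16) w k m H \<or>
       (\<exists>l\<in>{..n * n}. overfull (real n / (6 * 2 ^ k)) k m l X))"

text \<open>Union bound, each event having probability at most
  \<open>2 * exp (- c * (n div 3))\<close>: three deviations for each of \<open>n * n\<close>
  indices, one for \<open>H\<close> alone, \<open>(n div 3) ^ 3\<close> for the points of
  \<open>w\<close>, two misestimates, and \<open>n * n + 1\<close> lengths \<open>l\<close>.\<close>

lemma
  assumes k: "k \<in> {1..K}"
  shows pred_atypical_round: "Measurable.pred Q3 (atypical_round k)"
    and prob_atypical_round: "\<P>(U in Q3. atypical_round k U)
        \<le> (4 * real (n * n) + real ((n div 3) ^ 3) + 4) * (2 * exp (- c * real (n div 3)))"
proof -
  interpret Q3: prob_space Q3 by (rule prob_space_Q3)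
  define m where "m = n div 3"
  define e where "e = 2 * exp (- c * real m)"
  have e: "0 \<le> e" by (simp add: e_def)
  have m: "1 \<le> m" using n by (simp add: m_def)
  note realV = realized_V[of "\<lambda>U. fst U", OF Q3_coordinates(1)]
  have p1: "Measurable.pred Q3 (\<lambda>U. deviates \<sigma> (snd (snd U)) k N (V m (fst U)) [])" for N
    using pred_deviates[OF realV Q3_coordinates(3), of "[]"] by simp
  have p2: "Measurable.pred Q3 (\<lambda>U. deviates \<sigma> (snd (snd U)) k N (V m (fst U)) [fst U j])" for N j
    using pred_deviates[OF realV Q3_coordinates(3), of "[\<lambda>U. fst U j]"] Q3_coordinates by simp
  have p3: "Measurable.pred Q3 (\<lambda>U. deviates \<sigma> (snd (snd U)) k N (restrict_label (V m (fst U)) (fst U j) (f (fst U j))) [])" for N j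
    using pred_deviates[OF realized_restrict_label[OF realV Q3_coordinates(1)] Q3_coordinates(3), of _ "[]"] Q3_coordinates
    by simp
  have p4: "Measurable.pred Q3 (\<lambda>U. deviates \<sigma> (snd (snd U)) k N (V m (fst U)) [fst (snd U) j])" for N j
    using pred_deviates[OF realV Q3_coordinates(3), of "[\<lambda>U. fst (snd U) j]"] Q3_coordinates by simp
  have p5: "Measurable.pred Q3 (\<lambda>U. misestimates r (fst (snd U)) k m (V m (fst U)))" for r
    by (rule pred_misestimates[OF realV Q3_coordinates(2)])
  have p6: "Measurable.pred Q3 (\<lambda>U. overfull r k m l (fst U))" for r l
    by (rule pred_overfull) (rule Q3_coordinates)
  have dev: "measure Q {w' \<in> space Q. deviates \<sigma> w' k (j ^ 3) H xs} \<le> e"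
    if "m \<le> j" "fixed_space H" "set xs \<subseteq> space M" for j H xs
    using order_trans[OF prob_deviates[OF that(2,3) \<sigma>] deviation_rate] that(1) unfolding e_def m_def by blast
  have V: "fixed_space (V m X)" if "X \<in> space Q" for X by (rule fixed_space_V[OF that])
  have b1: "\<P>(U in Q3. deviates \<sigma> (snd (snd U)) k (j ^ 3) (V m (fst U)) []) \<le> e" if "m \<le> j" for j
    by (rule prob_section_w'[OF p1 e]) (simp add: dev[OF that] V)
  have b2: "\<P>(U in Q3. deviates \<sigma> (snd (snd U)) k (j ^ 3) (V m (fst U)) [fst U j]) \<le> e"
    if "m \<le> j" for j
    by (rule prob_section_w'[OF p2 e]) (simp add: dev[OF that] V space_Q_M)
  have b3: "\<P>(U in Q3. deviates \<sigma> (snd (snd U)) k (j ^ 3) (restrict_label (V m (fst U)) (fst U j) (f (fst U j))) []) \<le> e"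
    if "m \<le> j" for j
    by (rule prob_section_w'[OF p3 e]) (simp add: dev[OF that] fixed_space_restrict_V space_Q_M)
  have b4: "\<P>(U in Q3. deviates \<sigma> (snd (snd U)) k (m ^ 3) (V m (fst U)) [fst (snd U) i]) \<le> e" for i
    by (rule prob_section_w'[OF p4 e]) (simp add: dev V space_Q_M)
  have b5: "\<P>(U in Q3. misestimates r (fst (snd U)) k m (V m (fst U))) \<le> e" for r
  proof (rule prob_section_w[OF p5 e])
    fix X w' assume X: "X \<in> space Q"
    have "\<P>(w in Q. misestimates r w k m (V m X)) \<le> 2 * exp (- 2 * real m)"
      by (rule prob_misestimates[OF V[OF X] m])
    also have "\<dots> \<le> e" using c by (simp add: e_def mult_right_mono)
    finally show "\<P>(w in Q. misestimates r (fst (snd (X, w, w'))) k m (V m (fst (X, w, w')))) \<le> e"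
      by simp
  qed
  have b6: "\<P>(U in Q3. overfull (real n / (6 * 2 ^ k)) k m l (fst U)) \<le> e" for l
  proof (rule prob_section_X[OF p6 e])
    fix w w'
    have "(2::real) ^ k \<le> 2 ^ K" using k by (intro power_increasing) auto
    then have "1 / (6 * 2 ^ K) \<le> 1 / (6 * 2 ^ k :: real)" by (intro divide_left_mono) auto
    then have "c \<le> 1 / (6 * 2 ^ k)" using c by simp
    then have "c * real m \<le> 1 / (6 * 2 ^ k) * real m" by (rule mult_right_mono) simp
    also have "\<dots> \<le> 1 / (6 * 2 ^ k) * (real n / 3)" by (intro mult_left_mono) (auto simp: m_def)
    finally have "exp (- (real n / (6 * 2 ^ k)) / 3) \<le> exp (- c * real m)" by simp
    also have "\<dots> \<le> e" by (simp add: e_def)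
    finally show "\<P>(X in Q. overfull (real n / (6 * 2 ^ k)) k m l (fst (X, w, w'))) \<le> e"
      using prob_overfull[of "real n / (6 * 2 ^ k)" k m l] by simp
  qed
  have pA: "Measurable.pred Q3 (\<lambda>U. deviates \<sigma> (snd (snd U)) k (j ^ 3) (V m (fst U)) [] \<or>
      deviates \<sigma> (snd (snd U)) k (j ^ 3) (V m (fst U)) [fst U j] \<or>
      deviates \<sigma> (snd (snd U)) k (j ^ 3) (restrict_label (V m (fst U)) (fst U j) (f (fst U j))) [])" for j
    by (intro pred_intros_logic p1 p2 p3)
  have bA: "\<P>(U in Q3. deviates \<sigma> (snd (snd U)) k (j ^ 3) (V m (fst U)) [] \<or>
      deviates \<sigma> (snd (snd U)) k (j ^ 3) (V m (fst U)) [fst U j] \<or>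
      deviates \<sigma> (snd (snd U)) k (j ^ 3) (restrict_label (V m (fst U)) (fst U j) (f (fst U j))) []) \<le> e + (e + e)"
    if "m \<le> j" for j
    by (intro Q3.prob_disj_le b1 b2 b3 that p1 p2 p3 pred_intros_logic)
  have eq: "atypical_round k = (\<lambda>U.
       (\<exists>j\<in>{m + 1..m + n * n}. deviates \<sigma> (snd (snd U)) k (j ^ 3) (V m (fst U)) [] \<or>
          deviates \<sigma> (snd (snd U)) k (j ^ 3) (V m (fst U)) [fst U j] \<or>
          deviates \<sigma> (snd (snd U)) k (j ^ 3) (restrict_label (V m (fst U)) (fst U j) (f (fst U j))) []) \<or>
       deviates \<sigma> (snd (snd U)) k (m ^ 3) (V m (fst U)) [] \<or>
       (\<exists>i\<in>{1..m ^ 3}. deviates \<sigma> (snd (snd U)) k (m ^ 3) (V m (fst U)) [fst (snd U) i]) \<or>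
       misestimates (1 / 4) (fst (snd U)) k m (V m (fst U)) \<or> misestimates (1 / 16) (fst (snd U)) k m (V m (fst U)) \<or>
       (\<exists>l\<in>{..n * n}. overfull (real n / (6 * 2 ^ k)) k m l (fst U)))"
    unfolding fun_eq_iff atypical_round_def Let_def m_def by blast
  show "Measurable.pred Q3 (atypical_round k)"
    unfolding eq
    by (intro pred_intros_logic pred_intros_finite(4)[OF finite_atLeastAtMost] pred_intros_finite(4)[OF finite_atMost]
        pA p1 p4 p5 p6)
  have "\<P>(U in Q3. atypical_round k U)
      \<le> real (card {m + 1..m + n * n}) * (e + (e + e)) + (e + (real (card {1..m ^ 3}) * e + (e + (e + real (card {..n * n}) * e))))"
    unfolding eq
    by (intro Q3.prob_disj_le Q3.prob_Bex_le finite_atLeastAtMost finite_atMost bA b1 b4 b5 b6 order_refl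
        pred_intros_logic pred_intros_finite(4)[OF finite_atLeastAtMost] pred_intros_finite(4)[OF finite_atMost]
        pA p1 p4 p5 p6) auto
  also have "\<dots> = (4 * real (n * n) + real (m ^ 3) + 4) * e" by (simp add: algebra_simps)
  finally show "\<P>(U in Q3. atypical_round k U)
        \<le> (4 * real (n * n) + real ((n div 3) ^ 3) + 4) * (2 * exp (- c * real (n div 3)))"
    by (simp only: m_def e_def)
qed

lemma typical_iff:
  "typical K \<sigma> \<tau> n (fst U) (fst (snd U)) (snd (snd U)) \<longleftrightarrow>
     (\<forall>a. 20 * \<sigma> \<le> shatter_prob (K - 1) (V a (fst U)) []) \<and>
     shatter_prob (K - 1) (V (n div 3) (fst U)) [] \<le> 22 * \<sigma> \<and> shatter_prob K (V (n div 3) (fst U)) [] \<le> \<tau> \<and>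
     (\<forall>k\<in>{1..K}. \<not> atypical_round k U)"
  unfolding typical_def atypical_round_def Let_def by blast

end

lemma measurable_shatter_prob_V_Q3 [measurable]:
  "(\<lambda>U. shatter_prob k (V a (fst U)) []) \<in> borel_measurable Q3"
  using measurable_shatter_prob[OF realized_V[of "\<lambda>U. fst U", OF Q3_coordinates(1)], of "[]"] by simp

text \<open>One rate for the three kinds of failure: \<open>2 * \<sigma>\<^sup>2\<close> for the
  deviations, 2 for the misestimates, and \<open>1 / (6 * 2 ^ K)\<close> for overfull rounds, whose
  exponent \<open>n / (6 * 2 ^ k) / 3\<close> is to be at least
  \<open>c * (n div 3)\<close>.\<close>

lemma rate_exists:
  assumes "0 < \<sigma>"
  obtains c where "0 < c" "c \<le> 2 * \<sigma>\<^sup>2" "c \<le> 2" "c \<le> 1 / (6 * 2 ^ K :: real)"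
  by (rule that[of "min (min (2 * \<sigma>\<^sup>2) 2) (1 / (6 * 2 ^ K))"]) (use assms in auto)

lemma pred_typical:
  assumes "0 < \<sigma>" "3 \<le> n"
  shows "Measurable.pred Q3 (\<lambda>U. typical K \<sigma> \<tau> n (fst U) (fst (snd U)) (snd (snd U)))"
proof -
  obtain c where c: "0 < c" "c \<le> 2 * \<sigma>\<^sup>2" "c \<le> 2" "c \<le> 1 / (6 * 2 ^ K :: real)"
    using rate_exists[OF assms(1)] .
  have [measurable]: "Measurable.pred Q3 (atypical_round n \<sigma> k)" if "k \<in> {1..K}" for k
    by (rule pred_atypical_round[OF assms c(2-4) that])
  show ?thesis
    unfolding typical_iff[OF assms c(2-4)]
    by (intro pred_intros_logic pred_intros_finite(3)[OF finite_atLeastAtMost]) measurable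
qed

text \<open>The lower bound on the shattering probabilities holds almost surely. The two upper
  bounds lie strictly above the limits \<open>20 * \<sigma>\<close> and \<open>limit_prob K\<close>,
  so \<open>shatter_prob_tail\<close> applies to them; the other conditions are treated round by
  round.\<close>

lemma prob_not_typical:
  assumes K: "1 \<le> K" and \<sigma>: "0 < \<sigma>" and lim: "limit_prob (K - 1) = 20 * \<sigma>" "limit_prob K < \<tau>"
  shows "exponentially_small (\<lambda>n. \<P>(U in Q3. \<not> typical K \<sigma> \<tau> n (fst U) (fst (snd U)) (snd (snd U))))"
proof -
  interpret Q3: prob_space Q3 by (rule prob_space_Q3)
  obtain c where c: "0 < c" "c \<le> 2 * \<sigma>\<^sup>2" "c \<le> 2" "c \<le> 1 / (6 * 2 ^ K :: real)"
    using rate_exists[OF \<sigma>] .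
  obtain a1 q1 where 1: "0 < a1" "0 \<le> q1" "q1 < 1"
    "\<And>m. \<P>(X in Q. 22 * \<sigma> < shatter_prob (K - 1) (V m X) []) \<le> q1 ^ (m div a1)"
    using shatter_prob_tail[of "K - 1" "22 * \<sigma>"] lim(1) \<sigma> by auto
  obtain a2 q2 where 2: "0 < a2" "0 \<le> q2" "q2 < 1"
    "\<And>m. \<P>(X in Q. \<tau> < shatter_prob K (V m X) []) \<le> q2 ^ (m div a2)"
    using shatter_prob_tail[OF lim(2)] by auto
  \<comment> \<open>The constant is \<open>9 * 2\<close> for each of the \<open>K\<close> rounds, a
    round having at most \<open>9 * n ^ 3\<close> events when \<open>n\<close> is at least 3. The
    divisors \<open>3 * a1\<close> and \<open>3 * a2\<close> count blocks among the
    \<open>n div 3\<close> initial points.\<close>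
  have small: "exponentially_small (\<lambda>n. 1 * q1 ^ (n div (3 * a1)) + (1 * q2 ^ (n div (3 * a2)) +
      (18 * real K) * real n ^ 3 * exp (- c * real (n div 3))))"
    using 1 2 c by (intro exponentially_small_add exponentially_small_power_div exponentially_small_div) auto
  have le: "\<P>(U in Q3. \<not> typical K \<sigma> \<tau> n (fst U) (fst (snd U)) (snd (snd U)))
      \<le> 1 * q1 ^ (n div (3 * a1)) + (1 * q2 ^ (n div (3 * a2)) +
      (18 * real K) * real n ^ 3 * exp (- c * real (n div 3)))" if n: "3 \<le> n" for n
  proof -
    let ?e = "(4 * real (n * n) + real ((n div 3) ^ 3) + 4) * (2 * exp (- c * real (n div 3)))"
    have p: "Measurable.pred Q3 (atypical_round n \<sigma> k)" if "k \<in> {1..K}" for k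
      by (rule pred_atypical_round[OF \<sigma> n c(2-4) that])
    have b: "\<P>(U in Q3. atypical_round n \<sigma> k U) \<le> ?e" if "k \<in> {1..K}" for k
      by (rule prob_atypical_round[OF \<sigma> n c(2-4) that])
    have lower: "\<P>(U in Q3. \<not> (\<forall>a. 20 * \<sigma> \<le> shatter_prob (K - 1) (V a (fst U)) [])) \<le> 0"
    proof (rule prob_section_X)
      have "\<P>(X in Q. \<not> (\<forall>a. 20 * \<sigma> \<le> shatter_prob (K - 1) (V a X) [])) = 0"
      proof (subst Q.prob_eq_0)
        show "AE X in Q. X \<notin> {X \<in> space Q. \<not> (\<forall>a. 20 * \<sigma> \<le> shatter_prob (K - 1) (V a X) [])}"
          using AE_limit_prob_le[of "K - 1"] unfolding lim(1) by eventually_elim auto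
      qed measurable
      then show "\<P>(X in Q. \<not> (\<forall>a. 20 * \<sigma> \<le> shatter_prob (K - 1) (V a (fst (X, w, w'))) [])) \<le> 0" for w w'
        by simp
    qed measurable
    have u1: "\<P>(U in Q3. 22 * \<sigma> < shatter_prob (K - 1) (V (n div 3) (fst U)) []) \<le> q1 ^ (n div (3 * a1))"
      using 1 by (intro prob_section_X) (auto simp: div_mult2_eq)
    have u2: "\<P>(U in Q3. \<tau> < shatter_prob K (V (n div 3) (fst U)) []) \<le> q2 ^ (n div (3 * a2))"
      using 2 by (intro prob_section_X) (auto simp: div_mult2_eq)
    have eq: "\<not> typical K \<sigma> \<tau> n (fst U) (fst (snd U)) (snd (snd U)) \<longleftrightarrow>
        \<not> (\<forall>a. 20 * \<sigma> \<le> shatter_prob (K - 1) (V a (fst U)) []) \<or>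
        22 * \<sigma> < shatter_prob (K - 1) (V (n div 3) (fst U)) [] \<or> \<tau> < shatter_prob K (V (n div 3) (fst U)) [] \<or>
        (\<exists>k\<in>{1..K}. atypical_round n \<sigma> k U)" for U
      unfolding typical_iff[OF \<sigma> n c(2-4)] by (auto simp: not_le)
    have "\<P>(U in Q3. \<not> typical K \<sigma> \<tau> n (fst U) (fst (snd U)) (snd (snd U)))
        \<le> 0 + (q1 ^ (n div (3 * a1)) + (q2 ^ (n div (3 * a2)) + real (card {1..K}) * ?e))"
      unfolding eq
      by (intro Q3.prob_disj_le Q3.prob_Bex_le finite_atLeastAtMost lower u1 u2 p b
          pred_intros_logic pred_intros_finite(4)[OF finite_atLeastAtMost]) measurable
    moreover have "?e \<le> 18 * real n ^ 3 * exp (- c * real (n div 3))"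
    proof -
      have "real (n * n) \<le> real n ^ 3" "4 \<le> 4 * real n ^ 3" "real ((n div 3) ^ 3) \<le> real n ^ 3"
      proof -
        have 1: "1 \<le> real n ^ 3" using n by (intro one_le_power) simp
        then show "4 \<le> 4 * real n ^ 3" by simp
        have "real n * real n * 1 \<le> real n * real n * real n" using n by (intro mult_left_mono) auto
        then show "real (n * n) \<le> real n ^ 3" by (simp add: power3_eq_cube)
        show "real ((n div 3) ^ 3) \<le> real n ^ 3" unfolding of_nat_power by (intro power_mono) auto
      qed
      then have "4 * real (n * n) + real ((n div 3) ^ 3) + 4 \<le> 9 * real n ^ 3" by linarith
      then have "?e \<le> 9 * real n ^ 3 * (2 * exp (- c * real (n div 3)))" by (intro mult_right_mono) auto
      then show ?thesis by simp
    qed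
    then have "real K * ?e \<le> real K * (18 * real n ^ 3 * exp (- c * real (n div 3)))"
      by (rule mult_left_mono) simp
    ultimately show ?thesis by (simp add: algebra_simps)
  qed
  show ?thesis
    by (rule exponentially_small_mono[OF small]) (rule eventually_mono[OF eventually_ge_at_top le])
qed

end

section \<open>Risk of the meta-algorithm\<close>

lemma round_labels_cong:
  assumes "\<And>i. i \<in> {1..u} \<Longrightarrow> X i = X' i \<and> Y i = Y' i"
    and "\<And>k. k \<in> set ks \<Longrightarrow> n div 3 + sample_length n w w' V k \<le> u"
  shows "round_labels n (X, w, w') V Y ks t = round_labels n (X', w, w') V Y' ks t"
  using assms(2)
proof (induction ks arbitrary: t)
  case (Cons k ks)
  have "point_labels (wants_label X w' k V) (inferred_label X w' k V) (2 * n div 3) Y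
      [n div 3 + 1..<n div 3 + sample_length n w w' V k + 1] t
    = point_labels (wants_label X' w' k V) (inferred_label X' w' k V) (2 * n div 3) Y'
      [n div 3 + 1..<n div 3 + sample_length n w w' V k + 1] t"
  proof (rule point_labels_cong)
    fix m assume "m \<in> set [n div 3 + 1..<n div 3 + sample_length n w w' V k + 1]"
    then have "m \<in> {1..u}" using Cons.prems[of k] by auto
    then show "wants_label X w' k V m = wants_label X' w' k V m \<and>
        inferred_label X w' k V m = inferred_label X' w' k V m \<and> Y m = Y' m"
      using assms(1)[of m] by (simp add: wants_label_def inferred_label_def)
  qed
  moreover have "round_labels n (X, w, w') V Y ks t = round_labels n (X', w, w') V Y' ks t" for t
    using Cons.prems by (intro Cons.IH) simp
  ultimately show ?case unfolding round_labels_Cons by simp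
qed simp

lemma round_length_le_select_start:
  "k \<in> {1..N} \<Longrightarrow> n div 3 + round_length C n U Y k \<le> select_start C N n U Y"
  unfolding select_start_def by simp

lemma round_length_cong:
  assumes "\<And>i. i \<in> {1..n div 3} \<Longrightarrow> X i = X' i \<and> Y i = Y' i"
  shows "round_length C n (X, w, w') Y = round_length C n (X', w, w') Y'"
  using initial_space_cong[of "n div 3" X X' Y Y' C] assms by (simp add: round_length_def)

text \<open>As \<open>select_start\<close> is at least \<open>n div 3\<close>, this makes it a
  stopping time for the sequence \<open>X\<close>.\<close>

lemma select_start_cong:
  assumes "\<And>i. i \<in> {1..n div 3} \<Longrightarrow> X i = X' i \<and> Y i = Y' i"
  shows "select_start C N n (X, w, w') Y = select_start C N n (X', w, w') Y'"
  using round_length_cong[of n X X' Y Y' C w w'] assms by (simp add: select_start_def)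

text \<open>No round uses a point beyond \<open>select_start\<close>, so the hypotheses are
  determined by the data up to this stopping time and the points of the comparisons are
  fresh.\<close>

lemma hypothesis_cong:
  assumes "\<And>i. i \<in> {1..select_start C N n (X, w, w') Y} \<Longrightarrow> X i = X' i \<and> Y i = Y' i" and k: "k \<in> {1..N}"
  shows "hypothesis A C N n s (X, w, w') Y k = hypothesis A C N n s (X', w, w') Y' k"
proof -
  let ?u = "select_start C N n (X, w, w') Y"
  have m: "n div 3 \<le> ?u" by (simp add: select_start_def)
  have V: "initial_space C (n div 3) X Y = initial_space C (n div 3) X' Y'"
    by (rule initial_space_cong) (use assms(1) m in auto)
  have "round_lists C N n (X, w, w') Y = round_lists C N n (X', w, w') Y'"
    unfolding round_lists_def fst_conv V[symmetric]
  proof (rule arg_cong[where f = snd], rule round_labels_cong[where u = ?u])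
    fix k assume "k \<in> set [1..<N + 1]"
    then show "n div 3 + sample_length n w w' (initial_space C (n div 3) X Y) k \<le> ?u"
      using round_length_le_select_start[of k N n C "(X, w, w')" Y] by (auto simp: round_length_def)
  qed (rule assms(1))
  moreover have "map X [n div 3 + 1..<n div 3 + length (round_lists C N n (X, w, w') Y ! (k - 1)) + 1]
      = map X' [n div 3 + 1..<n div 3 + length (round_lists C N n (X, w, w') Y ! (k - 1)) + 1]"
    using length_round_lists[OF k, of C n "(X, w, w')" Y] round_length_le_select_start[OF k, of n C "(X, w, w')" Y]
    by (intro map_cong refl conjunct1[OF assms(1)]) auto
  ultimately show ?thesis unfolding hypothesis_def Let_def fst_conv by (simp only:)
qed

text \<open>Each factor of the denominator is at most \<open>N\<close>, the logarithm because of
  \<open>1 + ln N \<le> N\<close>. The failure probabilities of the comparisons are therefore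
  exponential in \<open>m\<close>.\<close>

lemma comparison_size_ge:
  assumes "1 \<le> j" "j < N"
  shows "m div N ^ 3 \<le> comparison_size N m j"
proof -
  have N: "0 < real N" using assms by simp
  have ln: "ln (exp 1 * real N) = 1 + ln (real N)" "0 \<le> ln (real N)" "1 + ln (real N) \<le> real N"
    using N assms ln_le_minus_one[of "real N"] by (auto simp: ln_mult)
  have pos: "0 < 1 + ln (real N)" using ln(2) by linarith
  have "real j * real (N - j) * ln (exp 1 * real N) \<le> real N * real N * real N"
    unfolding ln(1) using assms ln by (intro mult_mono) auto
  then have "real m / (real N ^ 3) \<le> real m / (real j * real (N - j) * ln (exp 1 * real N))"
    using assms ln(1) pos by (intro divide_left_mono) (auto simp: power3_eq_cube intro!: mult_pos_pos)
  moreover have "real (m div N ^ 3) \<le> real m / real (N ^ 3)"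
    by (rule of_nat_div_le_of_nat)
  ultimately show ?thesis
    unfolding comparison_size_def by (intro le_nat_floor) simp
qed

locale learning = problem M C P f
  for M :: "'a measure" and C :: "'a classifier set" and P :: "'a measure" and f :: "'a classifier" +
  fixes A :: "('r, 'a) passive_alg" and N :: nat
  assumes passive_A: "passive_algorithm M A" and N: "1 \<le> N"
begin

abbreviation Sd :: "(nat \<Rightarrow> 'r) measure" where "Sd \<equiv> PiM {1..N} (\<lambda>_. pseeds A)"

abbreviation \<Omega> :: "((nat \<Rightarrow> 'r) \<times> 'a unlabeled) measure" where "\<Omega> \<equiv> Sd \<Otimes>\<^sub>M Q3"

lemma prob_space_pseeds: "prob_space (pseeds A)"
  using passive_A by (simp add: passive_algorithm_def)

lemma prob_space_Sd: "prob_space Sd"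
  by (rule prob_space_PiM) (rule prob_space_pseeds)

lemma prob_space_\<Omega>: "prob_space \<Omega>"
  by (rule prob_space_pair[OF prob_space_Sd prob_space_Q3])

lemma seed_measurable: "k \<in> {1..N} \<Longrightarrow> (\<lambda>\<omega>. fst \<omega> k) \<in> measurable \<Omega> (pseeds A)"
  by (rule measurable_compose[OF measurable_fst measurable_component_singleton])

lemma \<Omega>_measurable [measurable]:
  "(\<lambda>\<omega>. fst (snd \<omega>)) \<in> measurable \<Omega> Q"
  "(\<lambda>\<omega>. fst (snd (snd \<omega>))) \<in> measurable \<Omega> Q"
  "(\<lambda>\<omega>. snd (snd (snd \<omega>))) \<in> measurable \<Omega> Q"
  by (rule measurable_compose[OF measurable_snd Q3_measurable(1)]
        measurable_compose[OF measurable_snd Q3_measurable(2)]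
        measurable_compose[OF measurable_snd Q3_measurable(3)])+

text \<open>The map \<open>g\<close> allows other base spaces: products with \<open>P\<close> for
  the measurability of errors, and the space of \<open>X\<close> alone when seeds and auxiliary
  sequences are frozen.\<close>

lemma data_source_\<Omega>:
  assumes g: "g \<in> measurable \<Omega>' \<Omega>"
  shows "data_source M C \<Omega>' (\<lambda>\<omega>. fst (snd (g \<omega>))) (\<lambda>\<omega>. fst (snd (snd (g \<omega>)))) (\<lambda>\<omega>. snd (snd (snd (g \<omega>))))
    (\<lambda>\<omega> i. f (fst (snd (g \<omega>)) i))"
proof (unfold_locales)
  note [measurable] = measurable_compose[OF g \<Omega>_measurable(1)] measurable_compose[OF g \<Omega>_measurable(2)]
    measurable_compose[OF g \<Omega>_measurable(3)]
  fix i
  show "(\<lambda>\<omega>. fst (snd (g \<omega>)) i) \<in> measurable \<Omega>' M" by measurable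
  show "(\<lambda>\<omega>. fst (snd (snd (g \<omega>))) i) \<in> measurable \<Omega>' M" by measurable
  show "(\<lambda>\<omega>. snd (snd (snd (g \<omega>))) i) \<in> measurable \<Omega>' M" by measurable
  show "Measurable.pred \<Omega>' (\<lambda>\<omega>. f (fst (snd (g \<omega>)) i))" by measurable
qed

definition hyp :: "nat \<Rightarrow> nat \<Rightarrow> (nat \<Rightarrow> 'r) \<times> 'a unlabeled \<Rightarrow> 'a classifier" where
  "hyp n k \<omega> = hypothesis A C N n (fst \<omega>) (snd \<omega>) (\<lambda>i. f (fst (snd \<omega>) i)) k"

definition out :: "nat \<Rightarrow> (nat \<Rightarrow> 'r) \<times> 'a unlabeled \<Rightarrow> 'a classifier" where
  "out n \<omega> = hyp n (output_index A C N n (fst \<omega>) (snd \<omega>) (\<lambda>i. f (fst (snd \<omega>) i))) \<omega>"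

lemma pred_hyp:
  assumes "g \<in> measurable \<Omega>' \<Omega>" "z \<in> measurable \<Omega>' M" "k \<in> {1..N}"
  shows "Measurable.pred \<Omega>' (\<lambda>\<omega>. hyp n k (g \<omega>) (z \<omega>))"
  using data_source.measurable_hypothesis[OF data_source_\<Omega>[OF assms(1)] passive_A
      measurable_compose[OF assms(1) seed_measurable] assms(3,2), where n = n]
  by (simp add: hyp_def)

lemma pred_out:
  assumes "g \<in> measurable \<Omega>' \<Omega>" "z \<in> measurable \<Omega>' M"
  shows "Measurable.pred \<Omega>' (\<lambda>\<omega>. out n (g \<omega>) (z \<omega>))"
  using data_source.measurable_output[OF data_source_\<Omega>[OF assms(1)] passive_A N
      measurable_compose[OF assms(1) seed_measurable] assms(2), where n = n]
  by (simp add: hyp_def out_def)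

lemma measurable_er:
  assumes "Measurable.pred (\<Omega>' \<Otimes>\<^sub>M P) (\<lambda>z. h (fst z) (snd z))"
  shows "(\<lambda>\<omega>. er P f (h \<omega>)) \<in> borel_measurable \<Omega>'"
  unfolding er_def
proof (rule measurable_measure)
  have [measurable]: "Measurable.pred P f" by (simp add: pred_P_iff)
  note [measurable] = assms
  have "{z \<in> space (\<Omega>' \<Otimes>\<^sub>M P). snd z \<in> {x \<in> space P. h (fst z) x \<noteq> f x}}
      = {z \<in> space (\<Omega>' \<Otimes>\<^sub>M P). h (fst z) (snd z) \<noteq> f (snd z)}"
    by (auto simp: space_pair_measure)
  also have "\<dots> \<in> sets (\<Omega>' \<Otimes>\<^sub>M P)" by measurable
  finally show "{z \<in> space (\<Omega>' \<Otimes>\<^sub>M P). snd z \<in> {x \<in> space P. h (fst z) x \<noteq> f x}} \<in> sets (\<Omega>' \<Otimes>\<^sub>M P)" .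
qed auto

lemma snd_measurable_P: "snd \<in> measurable (\<Omega>' \<Otimes>\<^sub>M P) M"
  using measurable_snd[of \<Omega>' P] by (simp only: measurable_into_P)

lemma measurable_er_hyp:
  "k \<in> {1..N} \<Longrightarrow> g \<in> measurable \<Omega>' \<Omega> \<Longrightarrow> (\<lambda>\<omega>. er P f (hyp n k (g \<omega>))) \<in> borel_measurable \<Omega>'"
  by (rule measurable_er, rule pred_hyp[OF measurable_compose[OF measurable_fst] snd_measurable_P])

lemma measurable_er_out:
  "g \<in> measurable \<Omega>' \<Omega> \<Longrightarrow> (\<lambda>\<omega>. er P f (out n (g \<omega>))) \<in> borel_measurable \<Omega>'"
  by (rule measurable_er, rule pred_out[OF measurable_compose[OF measurable_fst] snd_measurable_P])

lemma section_measurable: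
  assumes "s \<in> space Sd" "w \<in> space Q" "w' \<in> space Q"
  shows "(\<lambda>X. (s, X, w, w')) \<in> measurable Q \<Omega>"
  unfolding unlabeled_data_def using assms by measurable

lemma prob_section_\<Omega>_X:
  assumes \<phi>: "Measurable.pred \<Omega> \<phi>" and "0 \<le> \<delta>"
    and le: "\<And>s w w'. s \<in> space Sd \<Longrightarrow> w \<in> space Q \<Longrightarrow> w' \<in> space Q \<Longrightarrow>
      \<P>(X in Q. \<phi> (s, X, w, w')) \<le> \<delta>"
  shows "\<P>(\<omega> in \<Omega>. \<phi> \<omega>) \<le> \<delta>"
proof (rule prob_pair_le[OF prob_space_Sd prob_space_Q3 \<phi> \<open>0 \<le> \<delta>\<close>])
  fix s assume s: "s \<in> space Sd"
  have "Measurable.pred Q3 (\<lambda>U. \<phi> (s, U))" by (rule measurable_compose[OF measurable_Pair1'[OF s] \<phi>])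
  then show "\<P>(U in Q3. \<phi> (s, U)) \<le> \<delta>"
    by (rule prob_section_X[OF _ \<open>0 \<le> \<delta>\<close>]) (rule le[OF s])
qed

lemma hyp_classifier:
  assumes "\<omega> \<in> space \<Omega>" "k \<in> {1..N}" shows "hyp n k \<omega> \<in> classifiers M"
  unfolding classifiers_def
  using pred_hyp[of "\<lambda>_. \<omega>" M "\<lambda>x. x" k n] assms by simp

text \<open>
  Given the data used to build them, the hypotheses are fixed and the remaining points are
  independent of them.
\<close>

lemma prob_selection_fails:
  assumes q: "q \<in> {1..N}"
  shows "\<P>(\<omega> in \<Omega>. 2 * er P f (hyp n q \<omega>) < er P f (out n \<omega>))
    \<le> real (N * N) * select_rate ^ (n div (3 * N ^ 3))"
proof (rule prob_section_\<Omega>_X)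
  have [measurable]: "(\<lambda>\<omega>. er P f (hyp n q \<omega>)) \<in> borel_measurable \<Omega>" "(\<lambda>\<omega>. er P f (out n \<omega>)) \<in> borel_measurable \<Omega>"
    using measurable_er_hyp[OF q, of "\<lambda>\<omega>. \<omega>" \<Omega>] measurable_er_out[of "\<lambda>\<omega>. \<omega>" \<Omega>] by auto
  show "Measurable.pred \<Omega> (\<lambda>\<omega>. 2 * er P f (hyp n q \<omega>) < er P f (out n \<omega>))" by measurable
  show "0 \<le> real (N * N) * select_rate ^ (n div (3 * N ^ 3))" using select_rate(3) by simp
  fix s w w' assume s: "s \<in> space Sd" and w: "w \<in> space Q" and w': "w' \<in> space Q"
  define m where "m = n div 3"
  define \<tau> where "\<tau> = (\<lambda>X. select_start C N n (X, w, w') (\<lambda>i. f (X i)))"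
  let ?\<phi> = "\<lambda>X. 2 * er P f (hyp n q (s, X, w, w')) < er P f (out n (s, X, w, w'))"
  note g = section_measurable[OF s w w']
  show "\<P>(X in Q. ?\<phi> X) \<le> real (N * N) * select_rate ^ (n div (3 * N ^ 3))"
  proof (rule measure_strong_markov[where \<tau> = "\<lambda>X. \<tau> X + 1"])
    note [measurable] = measurable_er_hyp[OF q g] measurable_er_out[OF g]
    show "Measurable.pred Q ?\<phi>" by measurable
    have "\<tau> \<in> measurable Q (count_space UNIV)"
      using data_source.measurable_select_start[OF data_source_\<Omega>[OF g], of N n] by (simp add: \<tau>_def)
    then show "(\<lambda>X. \<tau> X + 1) \<in> measurable Q (count_space UNIV)" by measurable
  next
    fix v X assume "v \<in> space Q" "X \<in> space Q" and *: "\<And>i. i < \<tau> v + 1 \<Longrightarrow> X i = v i"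
    have le: "n div 3 \<le> \<tau> v" by (simp add: \<tau>_def select_start_def)
    have "X i = v i" if "i \<in> {1..n div 3}" for i using that le by (intro *) simp
    then show "\<tau> X + 1 = \<tau> v + 1"
      unfolding \<tau>_def by (intro arg_cong[where f = "\<lambda>t. t + 1"] select_start_cong) simp
  next
    show "0 \<le> real (N * N) * select_rate ^ (n div (3 * N ^ 3))" using select_rate(3) by simp
    fix v assume v: "v \<in> space Q"
    define u where "u = \<tau> v"
    define h where "h = (\<lambda>k. hyp n k (s, v, w, w'))"
    let ?X = "\<lambda>x. comb_seq (u + 1) v x"
    have in_\<Omega>: "(s, v, w, w') \<in> space \<Omega>"
      using s v w w' by (simp add: unlabeled_data_def space_pair_measure)
    have h_class: "h k \<in> classifiers M" if "k \<in> {1..N}" for k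
      unfolding h_def by (rule hyp_classifier[OF in_\<Omega> that])
    have h_meas: "Measurable.pred M (h k)" if "k \<in> {1..N}" for k
      using h_class[OF that] by (simp add: classifiers_def)
    have h_eq: "hyp n k (s, ?X x, w, w') = h k" if "k \<in> {1..N}" for k x
      unfolding h_def hyp_def fst_conv snd_conv
      by (rule hypothesis_cong[symmetric, OF _ that]) (auto simp: u_def \<tau>_def comb_seq_less)
    have u_eq: "select_start C N n (?X x, w, w') (\<lambda>i. f (?X x i)) = u" for x
      unfolding u_def \<tau>_def
      by (rule select_start_cong) (auto simp: comb_seq_def select_start_def u_def \<tau>_def)
    have out_eq: "out n (s, ?X x, w, w') = h (selected h N m (?X x) (\<lambda>i. f (?X x i)) u)" for x
    proof -
      have "output_index A C N n s (?X x, w, w') (\<lambda>i. f (?X x i)) = selected h N m (?X x) (\<lambda>i. f (?X x i)) u"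
        unfolding output_index_def u_eq fst_conv m_def
        using h_eq by (intro selected_cong) (simp add: hyp_def)
      then show ?thesis
        using h_eq[OF selected_mem[OF N]] by (simp add: out_def)
    qed
    define b where "b = select_rate ^ (n div (3 * N ^ 3))"
    define mis where "mis = (\<lambda>j k x. j < k \<and> misleads h (?X x) u (comparison_size N m j) j k)"
    have pred_mis: "Measurable.pred Q (mis j k)" if jk: "j \<in> {1..N}" "k \<in> {1..N}" for j k
    proof -
      interpret data_source M C Q ?X "\<lambda>_. w" "\<lambda>_. w'" "\<lambda>x i. f (?X x i)"
      proof unfold_locales
        note [measurable] = comb_seq_measurable2[OF v]
        show "(\<lambda>x. ?X x i) \<in> measurable Q M" for i by measurable
        show "Measurable.pred Q (\<lambda>x. f (?X x i))" for i by measurable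
      qed (use w w' space_Q_M in auto)
      have [measurable]: "(\<lambda>x. comparison (?X x) (\<lambda>i. f (?X x i)) u l {z. h j z \<noteq> h k z} (h k)) \<in> borel_measurable Q" for l
        by (rule measurable_comparison[where h = "\<lambda>_. h", OF _ _ jk]) (auto intro: measurable_compose[OF _ h_meas])
      show ?thesis unfolding mis_def misleads_def Let_def by measurable
    qed
    have prob_mis: "\<P>(x in Q. mis j k x) \<le> b" if jk: "j \<in> {1..N}" "k \<in> {1..N}" for j k
    proof (cases "j < k")
      case True
      have "\<P>(x in Q. mis j k x) \<le> select_rate ^ comparison_size N m j"
        using prob_misleads[where h = h and l = "comparison_size N m j", OF h_class[OF jk(1)] h_class[OF jk(2)] v, of u]
          True by (simp add: mis_def)
      also have "m div N ^ 3 \<le> comparison_size N m j"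
        using jk True by (intro comparison_size_ge) auto
      then have "n div (3 * N ^ 3) \<le> comparison_size N m j" by (simp add: m_def div_mult2_eq)
      then have "select_rate ^ comparison_size N m j \<le> b"
        unfolding b_def using select_rate(3,4) by (intro power_decreasing) auto
      finally show ?thesis .
    next
      case False
      then show ?thesis using select_rate(3) by (simp add: mis_def b_def)
    qed
    \<comment> \<open>If no comparison misleads, \<open>er_selected_le\<close> applies, so a failed
      selection requires one of the at most \<open>N * N\<close> events
      \<open>mis j k\<close>.\<close>
    have "\<P>(x in Q. ?\<phi> (?X x)) \<le> \<P>(x in Q. \<exists>j\<in>{1..N}. \<exists>k\<in>{1..N}. mis j k x)"
    proof (rule Q.finite_measure_mono)
      show "{x \<in> space Q. ?\<phi> (?X x)} \<subseteq> {x \<in> space Q. \<exists>j\<in>{1..N}. \<exists>k\<in>{1..N}. mis j k x}"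
      proof (safe, rule ccontr)
        fix x assume fail: "?\<phi> (?X x)" and no: "\<not> (\<exists>j\<in>{1..N}. \<exists>k\<in>{1..N}. mis j k x)"
        have "er P f (h (selected h N m (?X x) (\<lambda>i. f (?X x i)) u)) \<le> 2 * er P f (h q)"
        proof (rule er_selected_le[OF h_class _ q])
          fix j k assume "j \<in> {1..<k}" "k \<in> {1..N}"
          then show "\<not> misleads h (?X x) u (comparison_size N m j) j k"
            using no by (auto simp: mis_def)
        qed
        then show False using fail by (simp only: out_eq h_eq[OF q])
      qed
      show "{x \<in> space Q. \<exists>j\<in>{1..N}. \<exists>k\<in>{1..N}. mis j k x} \<in> sets Q"
        unfolding pred_def[symmetric]
        by (intro pred_intros_finite(4)[OF finite_atLeastAtMost] pred_mis)
    qed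
    also have "\<dots> \<le> real (card {1..N}) * (real (card {1..N}) * b)"
      by (intro Q.prob_Bex_le finite_atLeastAtMost prob_mis pred_intros_finite(4)[OF finite_atLeastAtMost] pred_mis)
    also have "\<dots> = real (N * N) * select_rate ^ (n div (3 * N ^ 3))" by (simp add: b_def)
    finally show "\<P>(x in Q. ?\<phi> (comb_seq (\<tau> v + 1) v x)) \<le> real (N * N) * select_rate ^ (n div (3 * N ^ 3))"
      by (simp only: u_def)
  qed
qed

end

lemma (in prob_space) unit_valued:
  assumes "F \<in> borel_measurable M" "\<And>x. 0 \<le> F x" "\<And>x. F x \<le> (1::real)"
  shows "integrable M F" and "(\<integral>\<^sup>+ x. ennreal (F x) \<partial>M) = ennreal (\<integral>x. F x \<partial>M)"
proof -
  show int: "integrable M F"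
    by (rule integrable_const_bound[where B = 1]) (use assms in auto)
  show "(\<integral>\<^sup>+ x. ennreal (F x) \<partial>M) = ennreal (\<integral>x. F x \<partial>M)"
    by (rule nn_integral_eq_integral[OF int]) (use assms in auto)
qed

section \<open>The passive algorithm on the correctly labelled sample of one round\<close>

context learning
begin

definition loss :: "nat \<Rightarrow> 'r \<Rightarrow> (nat \<Rightarrow> 'a) \<Rightarrow> real" where
  "loss q r X = er P f (plearn A r (map (\<lambda>i. (X i, f (X i))) [0..<q]))"

lemma loss_nonneg: "0 \<le> loss q r X" and loss_le_1: "loss q r X \<le> 1"
  by (simp_all add: loss_def er_def)

lemma er_nonneg: "0 \<le> er P f h" and er_le_1: "er P f h \<le> 1"
  by (simp_all add: er_def)

lemma measurable_loss:
  assumes r: "r \<in> measurable \<Omega>' (pseeds A)" and X: "\<And>i. (\<lambda>\<omega>. X \<omega> i) \<in> measurable \<Omega>' M"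
  shows "(\<lambda>\<omega>. loss q (r \<omega>) (X \<omega>)) \<in> borel_measurable \<Omega>'"
  unfolding loss_def
proof (rule measurable_er)
  have 1: "(\<lambda>z. (r (fst z), (\<lambda>i\<in>{..<q}. (X (fst z) i, f (X (fst z) i))), snd z))
      \<in> measurable (\<Omega>' \<Otimes>\<^sub>M P) (pseeds A \<Otimes>\<^sub>M PiM {..<q} (\<lambda>_. M \<Otimes>\<^sub>M count_space UNIV) \<Otimes>\<^sub>M M)"
    by (intro measurable_Pair measurable_restrict measurable_compose[OF measurable_fst r]
        measurable_compose[OF measurable_fst X] snd_measurable_P
        measurable_compose[OF measurable_compose[OF measurable_fst X] f_measurable])
  have 2: "(\<lambda>(r, z, x). plearn A r (map z [0..<q]) x)
            \<in> measurable (pseeds A \<Otimes>\<^sub>M PiM {..<q} (\<lambda>_. M \<Otimes>\<^sub>M count_space UNIV) \<Otimes>\<^sub>M M) (count_space UNIV)"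
    using passive_A by (simp add: passive_algorithm_def)
  have eq: "map (\<lambda>i\<in>{..<q}. (x i, f (x i))) [0..<q] = map (\<lambda>i. (x i, f (x i))) [0..<q]" for x
    by auto
  show "Measurable.pred (\<Omega>' \<Otimes>\<^sub>M P) (\<lambda>z. plearn A (r (fst z)) (map (\<lambda>i. (X (fst z) i, f (X (fst z) i))) [0..<q]) (snd z))"
    using measurable_compose[OF 1 2] by (simp only: prod.case eq)
qed

lemma nn_integral_seed:
  assumes k: "k \<in> {1..N}" and F: "F \<in> borel_measurable (pseeds A)"
  shows "(\<integral>\<^sup>+ s. F (s k) \<partial>Sd) = (\<integral>\<^sup>+ r. F r \<partial>pseeds A)"
proof -
  have "(\<integral>\<^sup>+ r. F r \<partial>pseeds A) = (\<integral>\<^sup>+ r. F r \<partial>distr Sd (pseeds A) (\<lambda>s. s k))"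
    by (subst distr_PiM_component[OF prob_space_pseeds k]) simp
  also have "\<dots> = (\<integral>\<^sup>+ s. F (s k) \<partial>Sd)"
    by (rule nn_integral_distr) (use k F in auto)
  finally show ?thesis by simp
qed

text \<open>\<open>loss\<close> reads the sequence from index 0 and uses one coordinate of the seed
  vector. The former amounts to a shift, which preserves the distribution, and coordinate
  \<open>k\<close> is distributed like a seed of \<open>A\<close>.\<close>

lemma passive_risk_eq:
  assumes k: "k \<in> {1..N}"
  shows "(\<integral>\<^sup>+ X. \<integral>\<^sup>+ s. ennreal (loss q (s k) X) \<partial>Sd \<partial>Q) = ennreal (passive_risk A q f P)"
proof -
  interpret R: prob_space "pseeds A" by (rule prob_space_pseeds)
  interpret Sd: prob_space Sd by (rule prob_space_Sd)
  interpret RQ: pair_prob_space "pseeds A" Q ..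
  have [measurable]: "(\<lambda>z. loss q (fst z) (shift 1 (snd z))) \<in> borel_measurable (pseeds A \<Otimes>\<^sub>M Q)"
    by (rule measurable_loss) (auto simp: shift_def)
  have lab: "loss q r (shift 1 X) = er P f (plearn A r (labeled_data f X q))" for r X
  proof -
    have "map (\<lambda>i. (shift 1 X i, f (shift 1 X i))) [0..<q] = labeled_data f X q"
      unfolding labeled_data_def by (rule nth_equalityI) (auto simp: shift_def simp del: upt_Suc)
    then show ?thesis by (simp only: loss_def)
  qed
  have [measurable]: "(\<lambda>z. loss q (snd z k) (fst z)) \<in> borel_measurable (Q \<Otimes>\<^sub>M Sd)"
    by (rule measurable_loss) (use k in \<open>auto intro!: measurable_compose[OF measurable_snd] measurable_compose[OF measurable_fst]\<close>)
  have [measurable]: "(\<lambda>X. \<integral>\<^sup>+ s. ennreal (loss q (s k) X) \<partial>Sd) \<in> borel_measurable Q"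
    by (rule Sd.borel_measurable_nn_integral) (unfold split_beta', measurable)
  have "ennreal (passive_risk A q f P) = ennreal (\<integral>z. loss q (fst z) (shift 1 (snd z)) \<partial>(pseeds A \<Otimes>\<^sub>M Q))"
    unfolding passive_risk_def lab by (simp add: split_beta')
  also have "\<dots> = (\<integral>\<^sup>+ z. ennreal (loss q (fst z) (shift 1 (snd z))) \<partial>(pseeds A \<Otimes>\<^sub>M Q))"
    by (rule RQ.P.unit_valued(2)[symmetric]) (measurable, rule loss_nonneg, rule loss_le_1)
  also have "\<dots> = (\<integral>\<^sup>+ X. \<integral>\<^sup>+ r. ennreal (loss q r (shift 1 X)) \<partial>pseeds A \<partial>Q)"
  proof -
    have "(\<lambda>z. ennreal (loss q (fst z) (shift 1 (snd z)))) \<in> borel_measurable (pseeds A \<Otimes>\<^sub>M Q)" by measurable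
    from RQ.nn_integral_snd[OF this] show ?thesis by simp
  qed
  also have "\<dots> = (\<integral>\<^sup>+ X. \<integral>\<^sup>+ s. ennreal (loss q (s k) (shift 1 X)) \<partial>Sd \<partial>Q)"
  proof (rule nn_integral_cong)
    fix X assume X: "X \<in> space Q"
    have "(\<lambda>r. ennreal (loss q r (shift 1 X))) \<in> borel_measurable (pseeds A)"
      by (intro measurable_compose[OF _ measurable_ennreal] measurable_loss) (use X in \<open>auto simp: shift_def space_Q_M\<close>)
    from nn_integral_seed[OF k this]
    show "(\<integral>\<^sup>+ r. ennreal (loss q r (shift 1 X)) \<partial>pseeds A) = (\<integral>\<^sup>+ s. ennreal (loss q (s k) (shift 1 X)) \<partial>Sd)"
      by simp
  qed
  also have "\<dots> = (\<integral>\<^sup>+ X. \<integral>\<^sup>+ s. ennreal (loss q (s k) X) \<partial>Sd \<partial>Q)"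
    by (rule nn_integral_shift) measurable
  finally show ?thesis by simp
qed

definition target_length :: "nat \<Rightarrow> nat \<Rightarrow> 'a unlabeled \<Rightarrow> nat" where
  "target_length n k U = round_length C n U (\<lambda>i. f (fst U i)) k"

text \<open>The sample carries the true labels, whether or not the algorithm finds them. Setting the
  loss to 0 for samples shorter than \<open>l\<close> makes the passive risk bound applicable to
  every outcome; on typical data the sample is long enough.\<close>

definition target_loss :: "nat \<Rightarrow> nat \<Rightarrow> nat \<Rightarrow> (nat \<Rightarrow> 'r) \<times> 'a unlabeled \<Rightarrow> real" where
  "target_loss n k l \<omega> = (if l \<le> target_length n k (snd \<omega>)
     then loss (target_length n k (snd \<omega>)) (fst \<omega> k) (shift (n div 3 + 1) (fst (snd \<omega>))) else 0)"

lemma measurable_target_loss: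
  assumes g: "g \<in> measurable \<Omega>' \<Omega>" and k: "k \<in> {1..N}"
  shows "(\<lambda>\<omega>. target_loss n k l (g \<omega>)) \<in> borel_measurable \<Omega>'"
proof -
  have L: "(\<lambda>\<omega>. target_length n k (snd (g \<omega>))) \<in> measurable \<Omega>' (count_space UNIV)"
    using data_source.measurable_round_length[OF data_source_\<Omega>[OF g], of n k]
    by (simp add: target_length_def)
  have "(\<lambda>\<omega>. if l \<le> q then loss q (fst (g \<omega>) k) (shift (n div 3 + 1) (fst (snd (g \<omega>)))) else 0) \<in> borel_measurable \<Omega>'" for q
  proof -
    note [measurable] = measurable_compose[OF g \<Omega>_measurable(1)]
    have [measurable]: "(\<lambda>\<omega>. loss q (fst (g \<omega>) k) (shift (n div 3 + 1) (fst (snd (g \<omega>))))) \<in> borel_measurable \<Omega>'"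
      by (rule measurable_loss[OF measurable_compose[OF g seed_measurable[OF k]]]) (simp add: shift_def)
    show ?thesis by measurable
  qed
  from measurable_compose_countable[OF this L] show ?thesis
    by (simp add: target_loss_def)
qed

lemma target_loss_bounds: "0 \<le> target_loss n k l \<omega>" "target_loss n k l \<omega> \<le> 1"
  by (simp_all add: target_loss_def loss_nonneg loss_le_1)

text \<open>The sample length depends only on the first \<open>n div 3\<close> points of
  \<open>X\<close> and on the auxiliary sequences, not on the points of the sample. Given these data
  the sample is i.i.d. of fixed length, and its expected loss is a passive risk.\<close>

lemma nn_integral_target_loss:
  assumes k: "k \<in> {1..N}" and risk: "\<And>q. l \<le> q \<Longrightarrow> passive_risk A q f P \<le> \<epsilon>"
  shows "(\<integral>\<^sup>+ \<omega>. ennreal (target_loss n k l \<omega>) \<partial>\<Omega>) \<le> ennreal \<epsilon>"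
proof -
  interpret Sd: prob_space Sd by (rule prob_space_Sd)
  interpret Q3: prob_space Q3 by (rule prob_space_Q3)
  interpret SQ: pair_prob_space Sd Q3 ..
  interpret QQ: prob_space "Q \<Otimes>\<^sub>M Q" by (rule prob_space_QQ)
  interpret Q_QQ: pair_prob_space Q "Q \<Otimes>\<^sub>M Q" ..
  have [measurable]: "target_loss n k l \<in> borel_measurable \<Omega>"
    using measurable_target_loss[OF _ k, of "\<lambda>\<omega>. \<omega>" \<Omega>] by simp
  define F where "F = (\<lambda>U. \<integral>\<^sup>+ s. ennreal (target_loss n k l (s, U)) \<partial>Sd)"
  have F: "F \<in> borel_measurable Q3"
    unfolding F_def by measurable
  then have F' [measurable]: "F \<in> borel_measurable (Q \<Otimes>\<^sub>M (Q \<Otimes>\<^sub>M Q))" by (simp add: unlabeled_data_def)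
  have "(\<integral>\<^sup>+ \<omega>. ennreal (target_loss n k l \<omega>) \<partial>\<Omega>) = (\<integral>\<^sup>+ U. F U \<partial>Q3)"
    unfolding F_def by (rule SQ.nn_integral_snd[symmetric]) measurable
  also have "\<dots> = (\<integral>\<^sup>+ W. \<integral>\<^sup>+ X. F (X, W) \<partial>Q \<partial>(Q \<Otimes>\<^sub>M Q))"
    unfolding unlabeled_data_def by (rule Q_QQ.nn_integral_snd[symmetric]) measurable
  also have "\<dots> \<le> (\<integral>\<^sup>+ W. ennreal \<epsilon> \<partial>(Q \<Otimes>\<^sub>M Q))"
  proof (rule nn_integral_mono)
    fix W assume W: "W \<in> space (Q \<Otimes>\<^sub>M Q)"
    show "(\<integral>\<^sup>+ X. F (X, W) \<partial>Q) \<le> ennreal \<epsilon>"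
    proof (rule strong_markov[where \<tau> = "\<lambda>_. n div 3 + 1"])
      show "(\<lambda>X. F (X, W)) \<in> borel_measurable Q" using W by measurable
    next
      fix v assume v: "v \<in> space Q"
      define L where "L = target_length n k (v, W)"
      have "target_length n k (comb_seq (n div 3 + 1) v x, W) = L" for x
        using round_length_cong[of n "comb_seq (n div 3 + 1) v x" v "\<lambda>i. f (comb_seq (n div 3 + 1) v x i)"
            "\<lambda>i. f (v i)" C "fst W" "snd W"]
        by (simp add: L_def target_length_def comb_seq_less)
      moreover have "shift (n div 3 + 1) (comb_seq (n div 3 + 1) v x) = x" for x
        using shift_comb_seq[of 0 "n div 3 + 1" v x] by simp
      ultimately have eq: "target_loss n k l (s, comb_seq (n div 3 + 1) v x, W) = (if l \<le> L then loss L (s k) x else 0)" for s x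
        unfolding target_loss_def fst_conv snd_conv by simp
      have "(\<integral>\<^sup>+ x. F (comb_seq (n div 3 + 1) v x, W) \<partial>Q)
          = (if l \<le> L then ennreal (passive_risk A L f P) else 0)"
        unfolding F_def eq using passive_risk_eq[OF k, of L] by simp
      also have "\<dots> \<le> ennreal \<epsilon>" using risk[of L] by (auto intro: ennreal_leI)
      finally show "(\<integral>\<^sup>+ x. F (comb_seq (n div 3 + 1) v x, W) \<partial>Q) \<le> ennreal \<epsilon>" .
    qed auto
  qed
  also have "\<dots> = ennreal \<epsilon>" by (simp add: QQ.emeasure_space_1)
  finally show ?thesis .
qed

lemma typical_hyp:
  assumes \<omega>: "\<omega> \<in> space \<Omega>"
    and tp: "typical K \<sigma> \<tau> n (fst (snd \<omega>)) (fst (snd (snd \<omega>))) (snd (snd (snd \<omega>)))"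
    and K: "1 \<le> K" "K \<le> N" and \<sigma>: "0 < \<sigma>" and n: "3 \<le> n" "3 * 2 ^ K \<le> n"
    and l: "real l \<le> real n / (6 * 2 ^ K * (3 / real (n div 3) + \<tau> / \<sigma>)) - 1"
  shows "er P f (hyp n K \<omega>) = target_loss n K l \<omega>"
proof -
  obtain s X w w' where \<omega>_eq: "\<omega> = (s, X, w, w')" by (cases \<omega>) auto
  have X: "X \<in> space Q" using \<omega> by (simp add: \<omega>_eq unlabeled_data_def space_pair_measure)
  define m where "m = n div 3"
  define L where "L = target_length n K (X, w, w')"
  have L: "L = sample_length n w w' (V m X) K"
    by (simp add: L_def target_length_def round_length_def m_def)
  have tp: "typical K \<sigma> \<tau> n X w w'" using tp by (simp add: \<omega>_eq)
  have labels: "round_lists C N n (X, w, w') (\<lambda>i. f (X i)) ! (K - 1) = map (\<lambda>i. f (X i)) [m + 1..<m + L + 1]"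
    unfolding L m_def by (rule typical_labels[OF tp K(1) \<sigma> n(1) X n(2) K(2)])
  have "real l \<le> real L"
    using l typical_length[OF tp K(1) \<sigma> n(1) X] unfolding L m_def by simp
  then have lL: "l \<le> L" by simp
  have "zip (map X [m + 1..<m + L + 1]) (map (\<lambda>i. f (X i)) [m + 1..<m + L + 1])
      = map (\<lambda>i. (shift (m + 1) X i, f (shift (m + 1) X i))) [0..<L]"
    by (rule nth_equalityI) (auto simp: shift_def simp del: upt_Suc)
  then have "hyp n K \<omega> = plearn A (s K) (map (\<lambda>i. (shift (m + 1) X i, f (shift (m + 1) X i))) [0..<L])"
    unfolding hyp_def hypothesis_def \<omega>_eq fst_conv snd_conv Let_def labels m_def[symmetric]
    by (simp del: upt_Suc)
  then show ?thesis
    using lL by (simp add: target_loss_def loss_def \<omega>_eq L_def[symmetric] m_def)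
qed

text \<open>Errors are at most 1, so atypical data and failed selection cost at most their
  probabilities. Otherwise the output errs at most twice as much as the hypothesis of round
  \<open>K\<close>, whose error is \<open>target_loss\<close>.\<close>

lemma risk_le:
  assumes K: "1 \<le> K" "K \<le> N" and \<sigma>: "0 < \<sigma>" and n: "3 \<le> n" "3 * 2 ^ K \<le> n" and \<epsilon>: "0 \<le> \<epsilon>"
    and l: "real l \<le> real n / (6 * 2 ^ K * (3 / real (n div 3) + \<tau> / \<sigma>)) - 1"
    and risk: "\<And>q. l \<le> q \<Longrightarrow> passive_risk A q f P \<le> \<epsilon>"
  shows "(\<integral>\<omega>. er P f (out n \<omega>) \<partial>\<Omega>) \<le> 2 * \<epsilon> +
    (\<P>(U in Q3. \<not> typical K \<sigma> \<tau> n (fst U) (fst (snd U)) (snd (snd U)))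
      + real (N * N) * select_rate ^ (n div (3 * N ^ 3)))"
proof -
  interpret \<Omega>: prob_space \<Omega> by (rule prob_space_\<Omega>)
  have kK: "K \<in> {1..N}" using K by simp
  define \<phi> where "\<phi> = (\<lambda>U. \<not> typical K \<sigma> \<tau> n (fst U) (fst (snd U)) (snd (snd U)))"
  define fail where "fail = (\<lambda>\<omega>. 2 * er P f (hyp n K \<omega>) < er P f (out n \<omega>))"
  have [measurable]: "(\<lambda>\<omega>. er P f (hyp n K \<omega>)) \<in> borel_measurable \<Omega>"
      "(\<lambda>\<omega>. er P f (out n \<omega>)) \<in> borel_measurable \<Omega>" "target_loss n K l \<in> borel_measurable \<Omega>"
    using measurable_er_hyp[OF kK, of "\<lambda>\<omega>. \<omega>" \<Omega>] measurable_er_out[of "\<lambda>\<omega>. \<omega>" \<Omega>]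
      measurable_target_loss[OF _ kK, of "\<lambda>\<omega>. \<omega>" \<Omega>] by auto
  have \<phi>: "Measurable.pred Q3 \<phi>"
    unfolding \<phi>_def using pred_typical[OF \<sigma> n(1), of K \<tau>] by measurable
  have [measurable]: "Measurable.pred \<Omega> (\<lambda>\<omega>. \<phi> (snd \<omega>))" "Measurable.pred \<Omega> fail"
    using measurable_compose[OF measurable_snd \<phi>] unfolding fail_def by measurable
  have sets: "{\<omega> \<in> space \<Omega>. \<phi> (snd \<omega>)} \<in> sets \<Omega>" "{\<omega> \<in> space \<Omega>. fail \<omega>} \<in> sets \<Omega>" by measurable
  have int: "integrable \<Omega> (target_loss n K l)"
    by (rule \<Omega>.unit_valued(1)) (measurable, rule target_loss_bounds, rule target_loss_bounds)
  have ind: "integrable \<Omega> (indicator S :: _ \<Rightarrow> real)" "(\<integral>\<omega>. indicator S \<omega> \<partial>\<Omega>) = measure \<Omega> S" if "S \<in> sets \<Omega>" for S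
  proof -
    show "integrable \<Omega> (indicator S :: _ \<Rightarrow> real)"
      by (rule \<Omega>.integrable_const_bound[where B = 1]) (use that in auto)
    show "(\<integral>\<omega>. indicator S \<omega> \<partial>\<Omega>) = measure \<Omega> S"
      using that by (simp add: sets.Int_space_eq2)
  qed
  define a where "a = \<P>(U in Q3. \<phi> U)"
  define b where "b = real (N * N) * select_rate ^ (n div (3 * N ^ 3))"
  have "\<P>(\<omega> in \<Omega>. \<phi> (snd \<omega>)) \<le> a"
  proof (rule prob_pair_le[OF prob_space_Sd prob_space_Q3])
    show "Measurable.pred \<Omega> (\<lambda>\<omega>. \<phi> (snd \<omega>))" by measurable
  qed (simp_all add: a_def)
  moreover have "\<P>(\<omega> in \<Omega>. fail \<omega>) \<le> b"
    unfolding fail_def b_def by (rule prob_selection_fails[OF kK])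
  moreover have "(\<integral>\<omega>. target_loss n K l \<omega> \<partial>\<Omega>) \<le> \<epsilon>"
  proof -
    have "ennreal (\<integral>\<omega>. target_loss n K l \<omega> \<partial>\<Omega>) = (\<integral>\<^sup>+ \<omega>. ennreal (target_loss n K l \<omega>) \<partial>\<Omega>)"
      by (rule \<Omega>.unit_valued(2)[symmetric]) (measurable, rule target_loss_bounds, rule target_loss_bounds)
    also have "\<dots> \<le> ennreal \<epsilon>" by (rule nn_integral_target_loss[OF kK risk])
    finally show ?thesis using \<epsilon> by (simp add: ennreal_le_iff)
  qed
  moreover have "(\<integral>\<omega>. er P f (out n \<omega>) \<partial>\<Omega>) \<le>
      (\<integral>\<omega>. 2 * target_loss n K l \<omega> + (indicator {\<omega> \<in> space \<Omega>. \<phi> (snd \<omega>)} \<omega> + indicator {\<omega> \<in> space \<Omega>. fail \<omega>} \<omega>) \<partial>\<Omega>)"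
  proof (rule integral_mono)
    show "integrable \<Omega> (\<lambda>\<omega>. er P f (out n \<omega>))"
      by (rule \<Omega>.unit_valued(1)) (measurable, rule er_nonneg, rule er_le_1)
    show "integrable \<Omega> (\<lambda>\<omega>. 2 * target_loss n K l \<omega> + (indicator {\<omega> \<in> space \<Omega>. \<phi> (snd \<omega>)} \<omega> + indicator {\<omega> \<in> space \<Omega>. fail \<omega>} \<omega>))"
      by (intro Bochner_Integration.integrable_add integrable_mult_right int ind(1) sets)
    fix \<omega> assume \<omega>: "\<omega> \<in> space \<Omega>"
    show "er P f (out n \<omega>) \<le> 2 * target_loss n K l \<omega> + (indicator {\<omega> \<in> space \<Omega>. \<phi> (snd \<omega>)} \<omega> + indicator {\<omega> \<in> space \<Omega>. fail \<omega>} \<omega>)"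
    proof (cases "\<phi> (snd \<omega>) \<or> fail \<omega>")
      case True
      then have "(1::real) \<le> indicator {\<omega> \<in> space \<Omega>. \<phi> (snd \<omega>)} \<omega> + indicator {\<omega> \<in> space \<Omega>. fail \<omega>} \<omega>"
        using \<omega> by (auto simp: indicator_def)
      then show ?thesis using er_le_1[of "out n \<omega>"] target_loss_bounds(1)[of n K l \<omega>] by linarith
    next
      case False
      then have "er P f (hyp n K \<omega>) = target_loss n K l \<omega>"
        by (intro typical_hyp[OF \<omega> _ K \<sigma> n l]) (simp add: \<phi>_def)
      then show ?thesis using False by (simp add: fail_def not_less)
    qed
  qed
  moreover have "(\<integral>\<omega>. 2 * target_loss n K l \<omega> + (indicator {\<omega> \<in> space \<Omega>. \<phi> (snd \<omega>)} \<omega> + indicator {\<omega> \<in> space \<Omega>. fail \<omega>} \<omega>) \<partial>\<Omega>)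
    = 2 * (\<integral>\<omega>. target_loss n K l \<omega> \<partial>\<Omega>) + (\<P>(\<omega> in \<Omega>. \<phi> (snd \<omega>)) + \<P>(\<omega> in \<Omega>. fail \<omega>))"
    using int ind[OF sets(1)] ind[OF sets(2)] by simp
  ultimately show ?thesis unfolding a_def b_def \<phi>_def by linarith
qed

text \<open>In effect the passive algorithm receives at least \<open>B * n\<close> labels on budget
  \<open>n\<close>. \<open>K\<close> and \<open>\<sigma>\<close> are chosen without regard to
  \<open>B\<close>; a larger \<open>B\<close> is paid for by a smaller \<open>\<tau>\<close>, and
  hence in \<open>\<delta>\<close>.\<close>

lemma risk_eventually_le:
  assumes d: "vc_dim M C = enat d" "N = d + 1" and B: "0 < B"
  obtains \<delta> where "exponentially_small \<delta>"
    "\<forall>\<^sub>F n in sequentially. \<forall>l \<epsilon>. real l \<le> B * real n \<longrightarrow> 0 \<le> \<epsilon> \<longrightarrow>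
       (\<forall>q\<ge>l. passive_risk A q f P \<le> \<epsilon>) \<longrightarrow> (\<integral>\<omega>. er P f (out n \<omega>) \<partial>\<Omega>) \<le> 2 * \<epsilon> + \<delta> n"
proof -
  define K where "K = (LEAST k. limit_prob k = 0)"
  have last: "limit_prob (Suc d) = 0" by (rule limit_prob_beyond_vc_dim[OF d(1)])
  have K0: "limit_prob K = 0" unfolding K_def by (rule LeastI[of _ "Suc d"]) (rule last)
  have KN: "K \<le> N" unfolding K_def d(2) by (rule Least_le) (use last in simp)
  have K1: "1 \<le> K" using K0 limit_prob_0 by (cases K) auto
  define \<sigma> where "\<sigma> = limit_prob (K - 1) / 20"
  have "limit_prob (K - 1) \<noteq> 0"
    using not_less_Least[of "K - 1" "\<lambda>k. limit_prob k = 0"] K1 unfolding K_def[symmetric] by simp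
  then have \<sigma>: "0 < \<sigma>" using limit_prob_nonneg[of "K - 1"] by (simp add: \<sigma>_def)
  \<comment> \<open>After multiplication by \<open>6 * 2 ^ K\<close> the summands
    \<open>3 / (n div 3)\<close> and \<open>\<tau> / \<sigma>\<close> contribute at most
    \<open>1 / b\<close> each, so the sample has length at least \<open>n * b / 2 - 1\<close>, which
    is \<open>2 * (B + 1) * n - 1\<close>.\<close>
  define b where "b = 4 * (B + 1)"
  have b: "0 < b" using B by (simp add: b_def)
  define \<tau> where "\<tau> = \<sigma> / (6 * 2 ^ K * b)"
  have \<tau>: "0 < \<tau>" using \<sigma> b by (simp add: \<tau>_def)
  define \<delta> where "\<delta> = (\<lambda>n. \<P>(U in Q3. \<not> typical K \<sigma> \<tau> n (fst U) (fst (snd U)) (snd (snd U)))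
      + real (N * N) * select_rate ^ (n div (3 * N ^ 3)))"
  have "exponentially_small \<delta>"
    unfolding \<delta>_def
    by (intro exponentially_small_add prob_not_typical exponentially_small_power_div K1 \<sigma>)
       (use K0 \<tau> N select_rate in \<open>auto simp: \<sigma>_def\<close>)
  moreover obtain z :: nat where z: "18 * 2 ^ K * b \<le> real z" using real_arch_simple by blast
  define n0 where "n0 = 3 * z + 3 * 2 ^ K + 3"
  have "(\<integral>\<omega>. er P f (out n \<omega>) \<partial>\<Omega>) \<le> 2 * \<epsilon> + \<delta> n"
    if n: "n0 \<le> n" and l: "real l \<le> B * real n" and \<epsilon>: "0 \<le> \<epsilon>" and risk: "\<forall>q\<ge>l. passive_risk A q f P \<le> \<epsilon>" for n l \<epsilon>
  proof -
    have n3: "3 \<le> n" "3 * 2 ^ K \<le> n" using n by (simp_all add: n0_def)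
    have "z \<le> n div 3" using n by (simp add: n0_def)
    then have "real z \<le> real (n div 3)" by (simp only: of_nat_le_iff)
    then have "18 * 2 ^ K * b \<le> real (n div 3)" using z by linarith
    moreover have m: "0 < real (n div 3)" using n3 by simp
    ultimately have "18 * 2 ^ K / real (n div 3) \<le> 1 / b"
      using b by (simp add: field_simps)
    moreover have "6 * 2 ^ K * (\<tau> / \<sigma>) = 1 / b" using \<sigma> by (simp add: \<tau>_def)
    ultimately have D: "6 * 2 ^ K * (3 / real (n div 3) + \<tau> / \<sigma>) \<le> 2 / b"
      by (simp add: distrib_left)
    have "0 < 6 * 2 ^ K * (3 / real (n div 3) + \<tau> / \<sigma>)"
      using m \<tau> \<sigma> by (intro mult_pos_pos add_pos_pos) auto
    then have "real n / (2 / b) \<le> real n / (6 * 2 ^ K * (3 / real (n div 3) + \<tau> / \<sigma>))"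
      using D b by (intro divide_left_mono) auto
    moreover have "real n / (2 / b) = 2 * (B + 1) * real n" by (simp add: b_def)
    moreover have "B * real n \<le> 2 * (B + 1) * real n - 1"
    proof -
      have "1 \<le> real n" "0 \<le> B * real n" using n3 B by auto
      then show ?thesis by (simp add: algebra_simps)
    qed
    ultimately have "real l \<le> real n / (6 * 2 ^ K * (3 / real (n div 3) + \<tau> / \<sigma>)) - 1" using l by linarith
    then show ?thesis
      unfolding \<delta>_def using risk by (intro risk_le[OF K1 KN \<sigma> n3 \<epsilon>]) auto
  qed
  then have "\<forall>\<^sub>F n in sequentially. \<forall>l \<epsilon>. real l \<le> B * real n \<longrightarrow> 0 \<le> \<epsilon> \<longrightarrow>
       (\<forall>q\<ge>l. passive_risk A q f P \<le> \<epsilon>) \<longrightarrow> (\<integral>\<omega>. er P f (out n \<omega>) \<partial>\<Omega>) \<le> 2 * \<epsilon> + \<delta> n"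
    unfolding eventually_sequentially by blast
  ultimately show thesis by (rule that)
qed

lemma active_risk_eq:
  assumes "N = the_enat (vc_dim M C) + 1"
  shows "active_risk (meta_algorithm1 M C A) n f P = (\<integral>\<omega>. er P f (out n \<omega>) \<partial>\<Omega>)"
proof -
  have "aseeds (meta_algorithm1 M C A) = Sd"
    by (simp add: meta_algorithm1_def Let_def assms)
  then show ?thesis
    unfolding active_risk_def run_meta_algorithm1 assms[symmetric]
    by (simp add: out_def hyp_def split_beta')
qed

end

section \<open>Label complexities\<close>

text \<open>The pointwise smallest label complexity achieved; the maximum with 1 enforces the
  convention that label complexities are positive.\<close>

definition least_label_complexity :: "(nat \<Rightarrow> 'a classifier \<Rightarrow> 'a measure \<Rightarrow> real) \<Rightarrow> 'a label_complexity" where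
  "least_label_complexity risk \<epsilon> f P =
     (if \<exists>n0. \<forall>n\<ge>n0. risk n f P \<le> \<epsilon> then enat (max 1 (LEAST n0. \<forall>n\<ge>n0. risk n f P \<le> \<epsilon>)) else \<infinity>)"

lemma least_label_complexity_le:
  assumes "\<forall>n\<ge>n0. risk n f P \<le> \<epsilon>"
  shows "least_label_complexity risk \<epsilon> f P \<le> enat (max 1 n0)"
proof -
  have "(LEAST n0. \<forall>n\<ge>n0. risk n f P \<le> \<epsilon>) \<le> n0" by (rule Least_le) (rule assms)
  then show ?thesis using assms unfolding least_label_complexity_def by auto
qed

lemma achieves_least_label_complexity: "achieves M C risk (least_label_complexity risk)"
  unfolding achieves_def
proof (intro ballI conjI allI impI)
  fix f P \<epsilon>
  show "1 \<le> least_label_complexity risk \<epsilon> f P"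
    by (simp add: least_label_complexity_def one_enat_def)
  fix n assume n: "least_label_complexity risk \<epsilon> f P \<le> enat n"
  then have ex: "\<exists>n0. \<forall>n\<ge>n0. risk n f P \<le> \<epsilon>" by (auto simp: least_label_complexity_def split: if_splits)
  then have "(LEAST n0. \<forall>n\<ge>n0. risk n f P \<le> \<epsilon>) \<le> n" using n by (simp add: least_label_complexity_def)
  then show "risk n f P \<le> \<epsilon>" using LeastI_ex[OF ex] by blast
qed

text \<open>\<open>ln (1 / \<epsilon>)\<close> is the scale of budgets at which exponentially small
  failure probabilities become as small as \<open>\<epsilon>\<close>.\<close>

lemma ln_polylog: "(\<lambda>\<epsilon>. ln (1 / \<epsilon>)) \<in> polylog"
proof -
  have "(\<lambda>\<epsilon> :: real. ln (1 / \<epsilon>)) \<in> O[at_right 0](\<lambda>\<epsilon>. ln (1 / \<epsilon>) powr 1)"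
  proof (rule bigoI[where c = 1])
    have "\<forall>\<^sub>F \<epsilon> :: real in at_right 0. \<epsilon> \<in> {0<..<1}"
      by (rule eventually_at_right_real) simp
    then show "\<forall>\<^sub>F \<epsilon> :: real in at_right 0. norm (ln (1 / \<epsilon>)) \<le> 1 * norm (ln (1 / \<epsilon>) powr 1)"
      by eventually_elim (simp add: ln_div)
  qed
  then show ?thesis
    unfolding polylog_def by (auto intro!: exI[of _ 1])
qed

text \<open>Let \<open>T\<close> be the passive label complexity at \<open>\<epsilon>\<close> and
  take \<open>B = 2 / \<eta>\<close>. For \<open>n\<close> at least \<open>\<eta> / 2 * T\<close>
  the passive algorithm in effect gets at least \<open>T\<close> labels, so the risk is at most
  \<open>2 * \<epsilon> + exp (- c * n)\<close>. As \<open>T\<close> outgrows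
  \<open>ln (1 / \<epsilon>)\<close>, the last term is eventually at most
  \<open>\<epsilon>\<close>.\<close>

lemma nontrivial_sublinear:
  fixes \<Lambda>p :: "'a label_complexity"
  assumes nt: "(f, P) \<in> nontrivial \<Lambda>p"
    and bound: "\<And>B. 0 < B \<Longrightarrow> \<exists>\<delta>. exponentially_small \<delta> \<and> (\<forall>\<^sub>F n in sequentially. \<forall>l \<epsilon>. real l \<le> B * real n \<longrightarrow> 0 \<le> \<epsilon> \<longrightarrow>
       (\<forall>q\<ge>l. prisk q \<le> \<epsilon>) \<longrightarrow> risk n f P \<le> 2 * \<epsilon> + \<delta> n)"
    and prisk: "\<And>\<epsilon> q. 0 < \<epsilon> \<Longrightarrow> \<epsilon> < 1 \<Longrightarrow> \<Lambda>p \<epsilon> f P \<le> enat q \<Longrightarrow> prisk q \<le> \<epsilon>"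
    and \<eta>: "0 < \<eta>"
  shows "\<forall>\<^sub>F \<epsilon> in at_right 0. least_label_complexity risk (3 * \<epsilon>) f P < \<infinity> \<and>
    real (the_enat (least_label_complexity risk (3 * \<epsilon>) f P)) \<le> \<eta> * real (the_enat (\<Lambda>p \<epsilon> f P))"
proof -
  define T where "T = (\<lambda>\<epsilon>. real (the_enat (\<Lambda>p \<epsilon> f P)))"
  obtain \<delta> where \<delta>: "exponentially_small \<delta>" and ev: "\<forall>\<^sub>F n in sequentially. \<forall>l \<epsilon>. real l \<le> 2 / \<eta> * real n \<longrightarrow> 0 \<le> \<epsilon> \<longrightarrow>
       (\<forall>q\<ge>l. prisk q \<le> \<epsilon>) \<longrightarrow> risk n f P \<le> 2 * \<epsilon> + \<delta> n"
    using bound[of "2 / \<eta>"] \<eta> by auto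
  obtain c where c: "0 < c" "\<forall>\<^sub>F n in sequentially. \<delta> n \<le> exp (- c * real n)"
    using \<delta> by (auto simp: exponentially_small_def)
  obtain n1 where n1: "\<And>n l \<epsilon>. n1 \<le> n \<Longrightarrow> real l \<le> 2 / \<eta> * real n \<Longrightarrow> 0 \<le> \<epsilon> \<Longrightarrow>
       (\<forall>q\<ge>l. prisk q \<le> \<epsilon>) \<Longrightarrow> risk n f P \<le> 2 * \<epsilon> + exp (- c * real n)"
  proof -
    have "\<forall>\<^sub>F n in sequentially. \<forall>l \<epsilon>. real l \<le> 2 / \<eta> * real n \<longrightarrow> 0 \<le> \<epsilon> \<longrightarrow>
       (\<forall>q\<ge>l. prisk q \<le> \<epsilon>) \<longrightarrow> risk n f P \<le> 2 * \<epsilon> + exp (- c * real n)"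
      using ev c(2) by eventually_elim (meson add_left_mono order_trans)
    then show thesis using that unfolding eventually_sequentially by blast
  qed
  have "T \<in> \<omega>[at_right 0](\<lambda>\<epsilon>. ln (1 / \<epsilon>))"
    using nt ln_polylog unfolding nontrivial_def T_def by blast
  \<comment> \<open>The first summand makes \<open>exp (- c * n)\<close> at most
    \<open>\<epsilon>\<close> for the budgets considered; the second makes these budgets exceed
    \<open>n1\<close> and pays for rounding up.\<close>
  define a where "a = 2 / (\<eta> * c) + 2 / \<eta> * (real n1 + 1) + 1"
  have a: "0 < a" using \<eta> c by (simp add: a_def add_pos_pos add_nonneg_pos)
  have "\<forall>\<^sub>F \<epsilon> in at_right 0. norm (T \<epsilon>) \<ge> a * norm (ln (1 / \<epsilon>))"
    using \<open>T \<in> \<omega>[at_right 0](\<lambda>\<epsilon>. ln (1 / \<epsilon>))\<close> a by (rule landau_omega.smallD)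
  \<comment> \<open>Below \<open>exp (-1)\<close> the logarithm is at least 1, so constants are
    absorbed in multiples of it.\<close>
  moreover have "\<forall>\<^sub>F \<epsilon> :: real in at_right 0. \<epsilon> \<in> {0<..<exp (-1)}"
    by (rule eventually_at_right_real) simp
  ultimately show ?thesis
  proof eventually_elim
    case (elim \<epsilon>)
    then have \<epsilon>: "0 < \<epsilon>" "\<epsilon> < exp (-1)" by auto
    then have \<epsilon>1: "\<epsilon> < 1" using exp_le_one_iff[of "-1::real"] by linarith
    have ln: "1 \<le> ln (1 / \<epsilon>)" using \<epsilon> by (simp add: ln_div) (metis ln_exp ln_le_cancel_iff exp_gt_zero less_imp_le minus_le_iff)
    define x where "x = 2 / (\<eta> * c) * ln (1 / \<epsilon>)"
    define z where "z = 2 / \<eta> * (real n1 + 1)"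
    define y where "y = (z + 1) * ln (1 / \<epsilon>)"
    have "a * ln (1 / \<epsilon>) \<le> T \<epsilon>" using elim(1) ln by (simp add: T_def)
    moreover have "a * ln (1 / \<epsilon>) = x + y"
      unfolding a_def x_def y_def z_def by (simp only: distrib_right add.assoc)
    moreover have nonneg: "0 \<le> x" "0 \<le> z" using \<eta> c ln by (simp_all add: x_def z_def)
    moreover have "z + 1 \<le> y"
      using mult_left_mono[of 1 "ln (1 / \<epsilon>)" "z + 1"] ln nonneg by (simp only: y_def mult_1_right)
    ultimately have "x \<le> T \<epsilon>" "z \<le> T \<epsilon>" by linarith+
    then have T1: "2 / (\<eta> * c) * ln (1 / \<epsilon>) \<le> T \<epsilon>" and T2: "2 / \<eta> * (real n1 + 1) \<le> T \<epsilon>"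
      by (simp_all only: x_def z_def)
    have cT: "ln (1 / \<epsilon>) \<le> c * (\<eta> / 2 * T \<epsilon>)"
      using mult_left_mono[OF T1, of "c * \<eta> / 2"] \<eta> c by (simp add: field_simps)
    have nT: "real n1 + 1 \<le> \<eta> / 2 * T \<epsilon>"
    proof -
      have "\<eta> / 2 * (2 / \<eta> * (real n1 + 1)) \<le> \<eta> / 2 * T \<epsilon>"
        using T2 \<eta> by (intro mult_left_mono) auto
      moreover have "\<eta> / 2 * (2 / \<eta> * (real n1 + 1)) = real n1 + 1" using \<eta> by simp
      ultimately show ?thesis by simp
    qed
    define n\<^sub>0 where "n\<^sub>0 = nat \<lceil>\<eta> / 2 * T \<epsilon>\<rceil>"
    have "\<Lambda>p \<epsilon> f P < \<infinity>" using nt \<epsilon> by (auto simp: nontrivial_def)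
    then have \<Lambda>p: "\<Lambda>p \<epsilon> f P = enat (the_enat (\<Lambda>p \<epsilon> f P))" by auto
    have "risk n f P \<le> 3 * \<epsilon>" if n: "n\<^sub>0 \<le> n" for n
    proof -
      have n': "\<eta> / 2 * T \<epsilon> \<le> real n" using n unfolding n\<^sub>0_def by linarith
      have "risk n f P \<le> 2 * \<epsilon> + exp (- c * real n)"
      proof (rule n1[of n "the_enat (\<Lambda>p \<epsilon> f P)" \<epsilon>])
        show "n1 \<le> n" using nT n' by linarith
        show "real (the_enat (\<Lambda>p \<epsilon> f P)) \<le> 2 / \<eta> * real n"
          using n' \<eta> by (simp add: T_def field_simps)
        show "\<forall>q\<ge>the_enat (\<Lambda>p \<epsilon> f P). prisk q \<le> \<epsilon>"
          using prisk[OF \<epsilon>(1) \<epsilon>1] \<Lambda>p by (metis enat_ord_simps(1))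
      qed (use \<epsilon> in simp)
      also have "exp (- c * real n) \<le> exp (- ln (1 / \<epsilon>))"
      proof -
        have "c * (\<eta> / 2 * T \<epsilon>) \<le> c * real n" using n' c(1) by (intro mult_left_mono) auto
        then show ?thesis using cT by simp
      qed
      also have "exp (- ln (1 / \<epsilon>)) = \<epsilon>" using \<epsilon> by (simp add: ln_div)
      finally show ?thesis by simp
    qed
    then have le: "least_label_complexity risk (3 * \<epsilon>) f P \<le> enat (max 1 n\<^sub>0)"
      by (intro least_label_complexity_le) blast
    then obtain k where k: "least_label_complexity risk (3 * \<epsilon>) f P = enat k" "k \<le> max 1 n\<^sub>0"
      by (cases "least_label_complexity risk (3 * \<epsilon>) f P") auto
    have "real k \<le> real (max 1 n\<^sub>0)" using k by simp
    also have "\<dots> \<le> \<eta> * T \<epsilon>"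
    proof -
      \<comment> \<open>Rounding up costs at most 1, which \<open>nT\<close> bounds by a second
        \<open>\<eta> / 2 * T\<close>.\<close>
      have "real n\<^sub>0 \<le> \<eta> / 2 * T \<epsilon> + 1" unfolding n\<^sub>0_def using nT by linarith
      then show ?thesis using nT by (auto simp: max_def)
    qed
    finally show ?case using k by (simp add: T_def)
  qed
qed

theorem theorem6:
  fixes M :: "'a measure" and C :: "'a classifier set"
  assumes "standard_borel M"
    and "vc_class M C"
    and "measurable_concepts M C"
  shows "universal_activizer M C
           (meta_algorithm1 M C :: ('r, 'a) passive_alg \<Rightarrow> (nat \<Rightarrow> 'r, 'a) active_alg)"
  unfolding universal_activizer_def
proof (intro conjI allI impI)
  interpret concepts M C
    by unfold_locales (use assms in \<open>auto simp: vc_class_def\<close>)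
  show "active_meta_algorithm M (meta_algorithm1 M C :: ('r, 'a) passive_alg \<Rightarrow> (nat \<Rightarrow> 'r, 'a) active_alg)"
    by (rule active_meta_algorithm)
  fix A :: "('r, 'a) passive_alg" assume A: "passive_algorithm M A"
  obtain d where d: "vc_dim M C = enat d"
    using assms(2) by (cases "vc_dim M C") (auto simp: vc_class_def)
  let ?risk = "active_risk (meta_algorithm1 M C A)"
  show "activizes M C (meta_algorithm1 M C) A"
    unfolding activizes_def
  \<comment> \<open>One active label complexity, the least one achieved, serves for every
    \<open>\<Lambda>p\<close>.\<close>
  proof (intro allI impI exI[of _ "least_label_complexity ?risk"] conjI ballI)
    show "achieves M C ?risk (least_label_complexity ?risk)"
      by (rule achieves_least_label_complexity)
    fix \<Lambda>p f P
    assume ach: "achieves M C (passive_risk A) \<Lambda>p" and f: "f \<in> C" and P: "P \<in> distributions M"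
      and nt: "(f, P) \<in> nontrivial \<Lambda>p"
    interpret prob_space P using P by (simp add: distributions_def)
    interpret learning M C P f A "d + 1"
      by unfold_locales (use f P A in \<open>auto simp: distributions_def\<close>)
    have N_eq: "d + 1 = the_enat (vc_dim M C) + 1" by (simp add: d)
    have sublinear: "\<forall>\<^sub>F \<epsilon> in at_right 0. least_label_complexity ?risk (3 * \<epsilon>) f P < \<infinity> \<and>
      real (the_enat (least_label_complexity ?risk (3 * \<epsilon>) f P)) \<le> \<eta> * real (the_enat (\<Lambda>p \<epsilon> f P))" if "0 < \<eta>" for \<eta>
    proof (rule nontrivial_sublinear[OF nt _ _ that, where prisk = "\<lambda>q. passive_risk A q f P"])
      fix B :: real assume "0 < B"
      show "\<exists>\<delta>. exponentially_small \<delta> \<and> (\<forall>\<^sub>F n in sequentially. \<forall>l \<epsilon>. real l \<le> B * real n \<longrightarrow> 0 \<le> \<epsilon> \<longrightarrow>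
       (\<forall>q\<ge>l. passive_risk A q f P \<le> \<epsilon>) \<longrightarrow> ?risk n f P \<le> 2 * \<epsilon> + \<delta> n)"
        unfolding active_risk_eq[OF N_eq] by (rule risk_eventually_le[OF d refl \<open>0 < B\<close>]) blast
    next
      fix \<epsilon> :: real and q assume "0 < \<epsilon>" "\<epsilon> < 1" "\<Lambda>p \<epsilon> f P \<le> enat q"
      then show "passive_risk A q f P \<le> \<epsilon>"
        using ach f P by (auto simp: achieves_def)
    qed
    show "\<exists>c\<ge>1. (\<forall>\<^sub>F \<epsilon> in at_right 0. least_label_complexity ?risk (c * \<epsilon>) f P < \<infinity>) \<and>
      (\<lambda>\<epsilon>. real (the_enat (least_label_complexity ?risk (c * \<epsilon>) f P)))
         \<in> o[at_right 0](\<lambda>\<epsilon>. real (the_enat (\<Lambda>p \<epsilon> f P)))"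
    \<comment> \<open>Of the factor 3, two parts are lost in the selection and one covers the
      failure probabilities.\<close>
    proof (intro exI[of _ 3] conjI)
      show "\<forall>\<^sub>F \<epsilon> in at_right 0. least_label_complexity ?risk (3 * \<epsilon>) f P < \<infinity>"
        using sublinear[of 1] by (auto elim: eventually_mono)
      show "(\<lambda>\<epsilon>. real (the_enat (least_label_complexity ?risk (3 * \<epsilon>) f P)))
         \<in> o[at_right 0](\<lambda>\<epsilon>. real (the_enat (\<Lambda>p \<epsilon> f P)))"
      proof (rule landau_o.smallI)
        fix \<eta> :: real assume "0 < \<eta>"
        from sublinear[OF this]
        show "\<forall>\<^sub>F \<epsilon> in at_right 0. norm (real (the_enat (least_label_complexity ?risk (3 * \<epsilon>) f P)))
            \<le> \<eta> * norm (real (the_enat (\<Lambda>p \<epsilon> f P)))"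
          by eventually_elim simp
      qed
    qed simp
  qed
qed

end
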